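(* Let $S:\mathscr{C}\to\mathscr{D}$ be a virtual discrete cofibration between small categories. Then for an arbitrary group diagram $\mathcal{G}:\mathscr{C}\to\mathrm{Grp}$ there exists an isomorphism of non-Abelian homology $$\mathrm{colim}^{\mathscr{C}}_n\mathcal{G}\cong\mathrm{colim}^{\mathscr{D}}_n\,\mathrm{Lan}^S\mathcal{G}\quad\text{for all } n\geq 0,$$ where $\mathrm{Lan}^S\mathcal{G}(d)$, for each $d\in\mathrm{Ob}\,\mathscr{D}$, equals the free product $\star_{\beta\in \mathrm{fin}(S\downarrow d)}\mathcal{G}Q_d(\beta)$, and $\mathrm{Lan}^S\mathcal{G}$ assigns to each morphism $\alpha:d\to d'$ of $\mathscr{D}$ the homomorphism defined on the factors of the free product by $$(\beta\in \mathrm{fin}(S\downarrow d),\ g\in\mathcal{G}Q_d(\beta))\mapsto(\phi(\alpha\beta),\ \mathcal{G}Q_{d'}(\phi_{\alpha\beta})(g)).$$ Here, for $\gamma\in S\downarrow d'$, $\phi(\gamma)\in\mathrm{fin}(S\downarrow d')$ denotes the final object of the connected component of $S\downarrow d'$ containing $\gamma$, and $\phi_\gamma:\gamma\to\phi(\gamma)$ is the unique morphism to this final object.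
   Context: For a functor $S:\mathscr{C}\to\mathscr{D}$ and $d\in\mathrm{Ob}\,\mathscr{D}$, the comma category $S\downarrow d$ has as objects pairs $(c\in\mathrm{Ob}\,\mathscr{C},\ \beta:S(c)\to d)$ (written simply $\beta$), and as morphisms $(c,\beta)\to(c',\beta')$ the morphisms $\alpha:c\to c'$ with $\beta'\circ S(\alpha)=\beta$. $Q_d:S\downarrow d\to\mathscr{C}$ is the forgetful functor $(c,\beta)\mapsto c$. A category is finally discrete if each of its connected components contains a final (terminal) object of that component; for a finally discrete category $\mathscr{B}$, $\mathrm{fin}(\mathscr{B})$ denotes a discrete subcategory of such final objects, one from each connected component. $S$ is a virtual discrete cofibration if $S\downarrow d$ is finally discrete for each $d\in\mathrm{Ob}\,\mathscr{D}$. $\mathrm{Lan}^S:\mathrm{Grp}^{\mathscr{C}}\to\mathrm{Grp}^{\mathscr{D}}$ is the left Kan extension, left adjoint to $\mathcal{H}\mapsto\mathcal{H}\circ S$, with $\mathrm{Lan}^S\mathcal{G}(d)=\mathrm{colim}^{S\downarrow d}\,\mathcal{G}Q_d$. For a small category $\mathscr{C}$ and a functor (group diagram) $\mathcal{G}:\mathscr{C}\to\mathrm{Grp}$, the simplicial replacement is the simplicial group $C_*(\mathscr{C},\mathcal{G})$ with $C_n(\mathscr{C},\mathcal{G})=\star_{c_0\to\cdots\to c_n}\mathcal{G}(c_0)$ (free product over $n$-simplices of the nerve), where $d^0_n$ sends $(c_0\xrightarrow{\alpha_1}c_1\to\cdots\to c_n,x)$ to $(c_1\to\cdots\to c_n,\mathcal{G}(\alpha_1)(x))$,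 $d^i_n$ for $i>0$ takes the $i$-th face of the nerve simplex and keeps $x$, and $s^i_n$ inserts the identity of $c_i$ and keeps $x$. The non-Abelian homology groups are $\mathrm{colim}^{\mathscr{C}}_n\mathcal{G}:=\pi_n(C_*(\mathscr{C},\mathcal{G}))$, $n\ge0$. *)

theory Defs
  imports "HOL-Algebra.Coset"
begin

section \<open>Small categories and functors\<close>

text \<open>Object and arrow collections are sets, so every category below is small.
  \<open>Cmp C g f\<close> is "\<open>g\<close> after \<open>f\<close>" and is only meaningful when \<open>Cod C f = Dom C g\<close>.\<close>

record ('o, 'm) cat =
  Ob :: "'o set"
  Ar :: "'m set"
  Dom :: "'m \<Rightarrow> 'o"
  Cod :: "'m \<Rightarrow> 'o"
  Idn :: "'o \<Rightarrow> 'm"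
  Cmp :: "'m \<Rightarrow> 'm \<Rightarrow> 'm"

locale category =
  fixes C :: "('o, 'm) cat"
  assumes dom_closed: "f \<in> Ar C \<Longrightarrow> Dom C f \<in> Ob C"
    and cod_closed: "f \<in> Ar C \<Longrightarrow> Cod C f \<in> Ob C"
    and idn_closed: "a \<in> Ob C \<Longrightarrow> Idn C a \<in> Ar C"
    and dom_idn: "a \<in> Ob C \<Longrightarrow> Dom C (Idn C a) = a"
    and cod_idn: "a \<in> Ob C \<Longrightarrow> Cod C (Idn C a) = a"
    and cmp_closed: "\<lbrakk>f \<in> Ar C; g \<in> Ar C; Cod C f = Dom C g\<rbrakk> \<Longrightarrow> Cmp C g f \<in> Ar C"
    and dom_cmp: "\<lbrakk>f \<in> Ar C; g \<in> Ar C; Cod C f = Dom C g\<rbrakk> \<Longrightarrow> Dom C (Cmp C g f) = Dom C f"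
    and cod_cmp: "\<lbrakk>f \<in> Ar C; g \<in> Ar C; Cod C f = Dom C g\<rbrakk> \<Longrightarrow> Cod C (Cmp C g f) = Cod C g"
    and cmp_idn_right: "f \<in> Ar C \<Longrightarrow> Cmp C f (Idn C (Dom C f)) = f"
    and cmp_idn_left: "f \<in> Ar C \<Longrightarrow> Cmp C (Idn C (Cod C f)) f = f"
    and cmp_assoc: "\<lbrakk>f \<in> Ar C; g \<in> Ar C; h \<in> Ar C; Cod C f = Dom C g; Cod C g = Dom C h\<rbrakk>
      \<Longrightarrow> Cmp C h (Cmp C g f) = Cmp C (Cmp C h g) f"

record ('o, 'm, 'p, 'q) funct =
  FOb :: "'o \<Rightarrow> 'p"
  FAr :: "'m \<Rightarrow> 'q"

locale cat_functor =
  fixes C :: "('o, 'm) cat" and D :: "('p, 'q) cat" and S :: "('o, 'm, 'p, 'q) funct"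
  assumes fob_closed: "a \<in> Ob C \<Longrightarrow> FOb S a \<in> Ob D"
    and far_closed: "f \<in> Ar C \<Longrightarrow> FAr S f \<in> Ar D"
    and dom_far: "f \<in> Ar C \<Longrightarrow> Dom D (FAr S f) = FOb S (Dom C f)"
    and cod_far: "f \<in> Ar C \<Longrightarrow> Cod D (FAr S f) = FOb S (Cod C f)"
    and far_idn: "a \<in> Ob C \<Longrightarrow> FAr S (Idn C a) = Idn D (FOb S a)"
    and far_cmp: "\<lbrakk>f \<in> Ar C; g \<in> Ar C; Cod C f = Dom C g\<rbrakk>
      \<Longrightarrow> FAr S (Cmp C g f) = Cmp D (FAr S g) (FAr S f)"


section \<open>Comma categories and virtual discrete cofibrations\<close>

text \<open>An arrow of \<open>S \<down> d\<close> carries its source and target, since the same \<open>\<alpha>\<close> may be an arrow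
  between several pairs of objects.\<close>

definition comma :: "('o, 'm) cat \<Rightarrow> ('p, 'q) cat \<Rightarrow> ('o, 'm, 'p, 'q) funct \<Rightarrow> 'p
    \<Rightarrow> ('o \<times> 'q, ('o \<times> 'q) \<times> 'm \<times> ('o \<times> 'q)) cat" where
  "comma C D S d =
    (let X = {(c, \<beta>). c \<in> Ob C \<and> \<beta> \<in> Ar D \<and> Dom D \<beta> = FOb S c \<and> Cod D \<beta> = d} in
     \<lparr>Ob = X,
      Ar = {((c, \<beta>), \<alpha>, (c', \<beta>')). (c, \<beta>) \<in> X \<and> (c', \<beta>') \<in> X \<and> \<alpha> \<in> Ar C
              \<and> Dom C \<alpha> = c \<and> Cod C \<alpha> = c' \<and> Cmp D \<beta>' (FAr S \<alpha>) = \<beta>},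
      Dom = (\<lambda>(x, \<alpha>, y). x),
      Cod = (\<lambda>(x, \<alpha>, y). y),
      Idn = (\<lambda>x. (x, Idn C (fst x), x)),
      Cmp = (\<lambda>(x', \<alpha>', y') (x, \<alpha>, y). (x, Cmp C \<alpha>' \<alpha>, y'))\<rparr>)"

definition comma_forget :: "('o \<times> 'q, ('o \<times> 'q) \<times> 'm \<times> ('o \<times> 'q), 'o, 'm) funct" where
  "comma_forget = \<lparr>FOb = fst, FAr = (\<lambda>(x, \<alpha>, y). \<alpha>)\<rparr>"

text \<open>Two objects are in the same connected component iff they are joined by a zigzag of arrows.\<close>

definition connected_objects :: "('o, 'm) cat \<Rightarrow> 'o \<Rightarrow> 'o \<Rightarrow> bool" where
  "connected_objects B a b \<longleftrightarrow> a \<in> Ob B \<and> b \<in> Ob B \<and>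
     (a, b) \<in> ({(Dom B f, Cod B f) | f. f \<in> Ar B} \<union> {(Cod B f, Dom B f) | f. f \<in> Ar B})\<^sup>*"

definition final_in_component :: "('o, 'm) cat \<Rightarrow> 'o \<Rightarrow> bool" where
  "final_in_component B t \<longleftrightarrow> t \<in> Ob B \<and>
     (\<forall>a. connected_objects B a t \<longrightarrow> (\<exists>!f. f \<in> Ar B \<and> Dom B f = a \<and> Cod B f = t))"

definition finally_discrete :: "('o, 'm) cat \<Rightarrow> bool" where
  "finally_discrete B \<longleftrightarrow>
     (\<forall>a \<in> Ob B. \<exists>t. connected_objects B a t \<and> final_in_component B t)"

text \<open>\<open>is_fin B T\<close>: \<open>T\<close> is (the object set of) a choice of \<open>fin(B)\<close>.\<close>

definition is_fin :: "('o, 'm) cat \<Rightarrow> 'o set \<Rightarrow> bool" where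
  "is_fin B T \<longleftrightarrow> (\<forall>t \<in> T. final_in_component B t) \<and>
     (\<forall>a \<in> Ob B. \<exists>!t. t \<in> T \<and> connected_objects B a t)"

definition fin_obj :: "('o, 'm) cat \<Rightarrow> 'o set \<Rightarrow> 'o \<Rightarrow> 'o" where
  "fin_obj B T a = (THE t. t \<in> T \<and> connected_objects B a t)"

definition fin_arr :: "('o, 'm) cat \<Rightarrow> 'o set \<Rightarrow> 'o \<Rightarrow> 'm" where
  "fin_arr B T a = (THE f. f \<in> Ar B \<and> Dom B f = a \<and> Cod B f = fin_obj B T a)"

definition virtual_discrete_cofibration ::
  "('o, 'm) cat \<Rightarrow> ('p, 'q) cat \<Rightarrow> ('o, 'm, 'p, 'q) funct \<Rightarrow> bool" where
  "virtual_discrete_cofibration C D S \<longleftrightarrow>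
     cat_functor C D S \<and> (\<forall>d \<in> Ob D. finally_discrete (comma C D S d))"


section \<open>Group diagrams and left Kan extensions\<close>

text \<open>All groups of a diagram have their carriers in one common type; the carriers themselves
  are arbitrary subsets of it. Group homomorphisms are only considered on carriers.\<close>

record ('o, 'm, 'g) diagram =
  GOb :: "'o \<Rightarrow> 'g monoid"
  GAr :: "'m \<Rightarrow> 'g \<Rightarrow> 'g"

locale group_diagram =
  fixes C :: "('o, 'm) cat" and G :: "('o, 'm, 'g) diagram"
  assumes gob_group: "a \<in> Ob C \<Longrightarrow> group (GOb G a)"
    and gar_hom: "f \<in> Ar C \<Longrightarrow> GAr G f \<in> hom (GOb G (Dom C f)) (GOb G (Cod C f))"
    and gar_idn: "\<lbrakk>a \<in> Ob C; x \<in> carrier (GOb G a)\<rbrakk> \<Longrightarrow> GAr G (Idn C a) x = x"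
    and gar_cmp: "\<lbrakk>f \<in> Ar C; g \<in> Ar C; Cod C f = Dom C g; x \<in> carrier (GOb G (Dom C f))\<rbrakk>
      \<Longrightarrow> GAr G (Cmp C g f) x = GAr G g (GAr G f x)"

definition diagram_comp ::
  "('p, 'q, 'g) diagram \<Rightarrow> ('o, 'm, 'p, 'q) funct \<Rightarrow> ('o, 'm, 'g) diagram" where
  "diagram_comp H S = \<lparr>GOb = (\<lambda>a. GOb H (FOb S a)), GAr = (\<lambda>f. GAr H (FAr S f))\<rparr>"

definition diagram_map ::
  "('o, 'm) cat \<Rightarrow> ('o, 'm, 'g) diagram \<Rightarrow> ('o, 'm, 'h) diagram \<Rightarrow> ('o \<Rightarrow> 'g \<Rightarrow> 'h) \<Rightarrow> bool" where
  "diagram_map C G H \<tau> \<longleftrightarrow>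
     (\<forall>a \<in> Ob C. \<tau> a \<in> hom (GOb G a) (GOb H a)) \<and>
     (\<forall>f \<in> Ar C. \<forall>x \<in> carrier (GOb G (Dom C f)).
        \<tau> (Cod C f) (GAr G f x) = GAr H f (\<tau> (Dom C f) x))"

definition diagram_iso ::
  "('o, 'm) cat \<Rightarrow> ('o, 'm, 'g) diagram \<Rightarrow> ('o, 'm, 'h) diagram \<Rightarrow> ('o \<Rightarrow> 'g \<Rightarrow> 'h) \<Rightarrow> bool" where
  "diagram_iso C G H \<tau> \<longleftrightarrow> diagram_map C G H \<tau> \<and> (\<forall>a \<in> Ob C. \<tau> a \<in> iso (GOb G a) (GOb H a))"

text \<open>\<open>L\<close> with unit \<open>\<eta> : G \<rightarrow> L \<circ> S\<close> is a left Kan extension of \<open>G\<close> along \<open>S\<close>, i.e. a universal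
  arrow from \<open>G\<close> to the functor \<open>H \<mapsto> H \<circ> S\<close>. HOL cannot quantify over the element type of the
  diagrams \<open>H\<close> against which universality is tested, so that type is a parameter.\<close>

definition left_kan_extension ::
  "'h itself \<Rightarrow> ('o, 'm) cat \<Rightarrow> ('p, 'q) cat \<Rightarrow> ('o, 'm, 'p, 'q) funct \<Rightarrow> ('o, 'm, 'g) diagram
    \<Rightarrow> ('p, 'q, 'l) diagram \<Rightarrow> ('o \<Rightarrow> 'g \<Rightarrow> 'l) \<Rightarrow> bool" where
  "left_kan_extension _ C D S G L \<eta> \<longleftrightarrow>
     group_diagram D L \<and> diagram_map C G (diagram_comp L S) \<eta> \<and>
     (\<forall>(H :: ('p, 'q, 'h) diagram) \<tau>.
        group_diagram D H \<and> diagram_map C G (diagram_comp H S) \<tau> \<longrightarrow>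
        (let factors = (\<lambda>\<sigma>. diagram_map D L H \<sigma> \<and>
               (\<forall>c \<in> Ob C. \<forall>x \<in> carrier (GOb G c). \<sigma> (FOb S c) (\<eta> c x) = \<tau> c x))
         in (\<exists>\<sigma>. factors \<sigma>) \<and>
            (\<forall>\<sigma> \<sigma>'. factors \<sigma> \<and> factors \<sigma>' \<longrightarrow>
               (\<forall>d \<in> Ob D. \<forall>x \<in> carrier (GOb L d). \<sigma> d x = \<sigma>' d x))))"


section \<open>Free products of groups\<close>

text \<open>Words with letters \<open>(i, x)\<close>, \<open>x \<in> G i\<close>, modulo the congruence generated by
  \<open>(i, x)(i, y) \<sim> (i, xy)\<close> and \<open>(i, 1) \<sim> empty word\<close>.\<close>

definition fp_words :: "'i set \<Rightarrow> ('i \<Rightarrow> 'g monoid) \<Rightarrow> ('i \<times> 'g) list set" where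
  "fp_words I G = {w. \<forall>(i, x) \<in> set w. i \<in> I \<and> x \<in> carrier (G i)}"

inductive fp_equiv :: "'i set \<Rightarrow> ('i \<Rightarrow> 'g monoid) \<Rightarrow> ('i \<times> 'g) list \<Rightarrow> ('i \<times> 'g) list \<Rightarrow> bool"
  for I :: "'i set" and G :: "'i \<Rightarrow> 'g monoid" where
  fp_mult: "\<lbrakk>i \<in> I; x \<in> carrier (G i); y \<in> carrier (G i); u \<in> fp_words I G; v \<in> fp_words I G\<rbrakk>
    \<Longrightarrow> fp_equiv I G (u @ [(i, x), (i, y)] @ v) (u @ [(i, x \<otimes>\<^bsub>G i\<^esub> y)] @ v)"
| fp_one: "\<lbrakk>i \<in> I; u \<in> fp_words I G; v \<in> fp_words I G\<rbrakk>
    \<Longrightarrow> fp_equiv I G (u @ [(i, \<one>\<^bsub>G i\<^esub>)] @ v) (u @ v)"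
| fp_refl: "u \<in> fp_words I G \<Longrightarrow> fp_equiv I G u u"
| fp_sym: "fp_equiv I G u v \<Longrightarrow> fp_equiv I G v u"
| fp_trans: "\<lbrakk>fp_equiv I G u v; fp_equiv I G v w\<rbrakk> \<Longrightarrow> fp_equiv I G u w"

definition fp_class :: "'i set \<Rightarrow> ('i \<Rightarrow> 'g monoid) \<Rightarrow> ('i \<times> 'g) list \<Rightarrow> ('i \<times> 'g) list set" where
  "fp_class I G w = {v. fp_equiv I G w v}"

definition free_product :: "'i set \<Rightarrow> ('i \<Rightarrow> 'g monoid) \<Rightarrow> ('i \<times> 'g) list set monoid" where
  "free_product I G =
    \<lparr>carrier = fp_class I G ` fp_words I G,
     mult = (\<lambda>A B. \<Union>a \<in> A. \<Union>b \<in> B. fp_class I G (a @ b)),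
     one = fp_class I G []\<rparr>"

definition fp_in :: "'i set \<Rightarrow> ('i \<Rightarrow> 'g monoid) \<Rightarrow> 'i \<Rightarrow> 'g \<Rightarrow> ('i \<times> 'g) list set" where
  "fp_in I G i x = fp_class I G [(i, x)]"

text \<open>\<open>fp_lift H f\<close> is the homomorphism from a free product to \<open>H\<close> whose restriction to the
  \<open>i\<close>-th factor is \<open>f i\<close>: evaluate any word representing the argument. (The result does not
  depend on the representative when every \<open>f i\<close> is a homomorphism to \<open>H\<close>.)\<close>

definition fp_lift :: "'h monoid \<Rightarrow> ('i \<Rightarrow> 'g \<Rightarrow> 'h) \<Rightarrow> ('i \<times> 'g) list set \<Rightarrow> 'h" where
  "fp_lift H f W = foldr (\<lambda>(i, x) y. f i x \<otimes>\<^bsub>H\<^esub> y) (SOME w. w \<in> W) \<one>\<^bsub>H\<^esub>"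


section \<open>The free-product form of the left Kan extension\<close>

text \<open>\<open>fin d\<close> is a choice of \<open>fin(S \<down> d)\<close>.\<close>

definition lan_factors :: "('o, 'm, 'g) diagram \<Rightarrow> 'o \<times> 'q \<Rightarrow> 'g monoid" where
  "lan_factors G = GOb (diagram_comp G comma_forget)"

text \<open>For an object \<open>\<gamma>\<close> of \<open>S \<down> d\<close> and \<open>x \<in> G Q\<^sub>d(\<gamma>)\<close>: the element
  \<open>(\<phi>(\<gamma>), G Q\<^sub>d(\<phi>\<^sub>\<gamma>)(x))\<close> of the free product over \<open>fin(S \<down> d)\<close>.\<close>

definition lan_push :: "('o, 'm) cat \<Rightarrow> ('p, 'q) cat \<Rightarrow> ('o, 'm, 'p, 'q) funct
    \<Rightarrow> ('p \<Rightarrow> ('o \<times> 'q) set) \<Rightarrow> ('o, 'm, 'g) diagram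
    \<Rightarrow> 'p \<Rightarrow> 'o \<times> 'q \<Rightarrow> 'g \<Rightarrow> (('o \<times> 'q) \<times> 'g) list set" where
  "lan_push C D S fin G d \<gamma> x =
     fp_in (fin d) (lan_factors G) (fin_obj (comma C D S d) (fin d) \<gamma>)
       (GAr (diagram_comp G comma_forget) (fin_arr (comma C D S d) (fin d) \<gamma>) x)"

definition lan_fin :: "('o, 'm) cat \<Rightarrow> ('p, 'q) cat \<Rightarrow> ('o, 'm, 'p, 'q) funct
    \<Rightarrow> ('p \<Rightarrow> ('o \<times> 'q) set) \<Rightarrow> ('o, 'm, 'g) diagram
    \<Rightarrow> ('p, 'q, (('o \<times> 'q) \<times> 'g) list set) diagram" where
  "lan_fin C D S fin G =
    \<lparr>GOb = (\<lambda>d. free_product (fin d) (lan_factors G)),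
     GAr = (\<lambda>\<alpha>. fp_lift (free_product (fin (Cod D \<alpha>)) (lan_factors G))
       (\<lambda>(c, \<beta>). lan_push C D S fin G (Cod D \<alpha>) (c, Cmp D \<alpha> \<beta>)))\<rparr>"

definition lan_fin_unit :: "('o, 'm) cat \<Rightarrow> ('p, 'q) cat \<Rightarrow> ('o, 'm, 'p, 'q) funct
    \<Rightarrow> ('p \<Rightarrow> ('o \<times> 'q) set) \<Rightarrow> ('o, 'm, 'g) diagram
    \<Rightarrow> 'o \<Rightarrow> 'g \<Rightarrow> (('o \<times> 'q) \<times> 'g) list set" where
  "lan_fin_unit C D S fin G c = lan_push C D S fin G (FOb S c) (c, Idn D (FOb S c))"


section \<open>Simplicial groups and non-Abelian homology\<close>

text \<open>\<open>Face X n i : X n \<rightarrow> X (n - 1)\<close> (for \<open>n \<ge> 1\<close>, \<open>i \<le> n\<close>) and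
  \<open>Dgn X n i : X n \<rightarrow> X (n + 1)\<close> (for \<open>i \<le> n\<close>).\<close>

record 'a sgroup =
  Lev :: "nat \<Rightarrow> 'a monoid"
  Face :: "nat \<Rightarrow> nat \<Rightarrow> 'a \<Rightarrow> 'a"
  Dgn :: "nat \<Rightarrow> nat \<Rightarrow> 'a \<Rightarrow> 'a"

text \<open>The homotopy groups of a simplicial group, as the homology groups of its Moore complex
  \<open>N\<^sub>n = \<Inter>i<n. ker d\<^sup>i\<^sub>n\<close> with boundary \<open>d\<^sup>n\<^sub>n : N\<^sub>n \<rightarrow> N\<^sub>n\<^sub>-\<^sub>1\<close>. In degree \<open>0\<close> every element is
  a cycle.\<close>

definition moore :: "'a sgroup \<Rightarrow> nat \<Rightarrow> 'a set" where
  "moore X n = {x \<in> carrier (Lev X n). \<forall>i<n. Face X n i x = \<one>\<^bsub>Lev X (n - 1)\<^esub>}"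

definition moore_cycles :: "'a sgroup \<Rightarrow> nat \<Rightarrow> 'a set" where
  "moore_cycles X n = {x \<in> moore X n. n > 0 \<longrightarrow> Face X n n x = \<one>\<^bsub>Lev X (n - 1)\<^esub>}"

definition moore_boundaries :: "'a sgroup \<Rightarrow> nat \<Rightarrow> 'a set" where
  "moore_boundaries X n = Face X (Suc n) (Suc n) ` moore X (Suc n)"

definition homotopy_group :: "'a sgroup \<Rightarrow> nat \<Rightarrow> 'a set monoid" where
  "homotopy_group X n = (Lev X n)\<lparr>carrier := moore_cycles X n\<rparr> Mod moore_boundaries X n"

text \<open>An \<open>n\<close>-simplex \<open>c\<^sub>0 \<rightarrow> \<dots> \<rightarrow> c\<^sub>n\<close> of the nerve is the pair of \<open>c\<^sub>0\<close> and the list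
  \<open>[\<alpha>\<^sub>1, \<dots>, \<alpha>\<^sub>n]\<close> of its arrows \<open>\<alpha>\<^sub>i : c\<^sub>i\<^sub>-\<^sub>1 \<rightarrow> c\<^sub>i\<close>; list positions start at \<open>0\<close>, so
  \<open>\<alpha>\<^sub>i = as ! (i - 1)\<close>.\<close>

fun composable :: "('o, 'm) cat \<Rightarrow> 'o \<Rightarrow> 'm list \<Rightarrow> bool" where
  "composable C c [] \<longleftrightarrow> c \<in> Ob C"
| "composable C c (\<alpha> # as) \<longleftrightarrow> c \<in> Ob C \<and> \<alpha> \<in> Ar C \<and> Dom C \<alpha> = c \<and> composable C (Cod C \<alpha>) as"

definition nerve :: "('o, 'm) cat \<Rightarrow> nat \<Rightarrow> ('o \<times> 'm list) set" where
  "nerve C n = {(c, as). length as = n \<and> composable C c as}"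

definition nerve_vertex :: "('o, 'm) cat \<Rightarrow> nat \<Rightarrow> 'o \<times> 'm list \<Rightarrow> 'o" where
  "nerve_vertex C i = (\<lambda>(c, as). if i = 0 then c else Cod C (as ! (i - 1)))"

definition nerve_face :: "('o, 'm) cat \<Rightarrow> nat \<Rightarrow> 'o \<times> 'm list \<Rightarrow> 'o \<times> 'm list" where
  "nerve_face C i = (\<lambda>(c, as).
     if i = 0 then (Cod C (hd as), tl as)
     else if i = length as then (c, butlast as)
     else (c, take (i - 1) as @ [Cmp C (as ! i) (as ! (i - 1))] @ drop (i + 1) as))"

definition nerve_degen :: "('o, 'm) cat \<Rightarrow> nat \<Rightarrow> 'o \<times> 'm list \<Rightarrow> 'o \<times> 'm list" where
  "nerve_degen C i = (\<lambda>(c, as).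
     (c, take i as @ [Idn C (nerve_vertex C i (c, as))] @ drop i as))"

definition simplicial_replacement ::
  "('o, 'm) cat \<Rightarrow> ('o, 'm, 'g) diagram \<Rightarrow> (('o \<times> 'm list) \<times> 'g) list set sgroup" where
  "simplicial_replacement C G =
    (let factor = (\<lambda>\<sigma>. GOb G (fst \<sigma>)); L = (\<lambda>n. free_product (nerve C n) factor) in
     \<lparr>Lev = L,
      Face = (\<lambda>n i. fp_lift (L (n - 1)) (\<lambda>\<sigma> x.
        fp_in (nerve C (n - 1)) factor (nerve_face C i \<sigma>)
          (if i = 0 then GAr G (hd (snd \<sigma>)) x else x))),
      Dgn = (\<lambda>n i. fp_lift (L (Suc n)) (\<lambda>\<sigma> x.
        fp_in (nerve C (Suc n)) factor (nerve_degen C i \<sigma>) x))\<rparr>)"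

definition nonabelian_homology :: "('o, 'm) cat \<Rightarrow> ('o, 'm, 'g) diagram \<Rightarrow> nat
    \<Rightarrow> (('o \<times> 'm list) \<times> 'g) list set set monoid" where
  "nonabelian_homology C G n = homotopy_group (simplicial_replacement C G) n"

end

theory Submission
  imports Defs
begin

text \<open>Write \<open>b = t \<circ> S f\<close> for an arrow \<open>b : S c \<rightarrow> d\<close> whose component in \<open>S \<down> d\<close> has the chosen final object
  \<open>t : S c' \<rightarrow> d\<close>, where \<open>f : c \<rightarrow> c'\<close> is the unique arrow to it in \<open>S \<down> d\<close>. The hypothesis on \<open>S\<close> says exactly
  that every \<open>b\<close> has one and only one such factorization with \<open>t \<in> fin d\<close> (\<open>final_factor\<close>, \<open>final_unique\<close>),
  and every identity between the maps \<open>\<phi>\<close> and \<open>\<phi>\<^sub>\<gamma>\<close> of the statement is obtained by exhibiting two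
  factorizations of the same arrow.

  The chosen final objects of all \<open>S \<down> d\<close> are the objects of a category \<open>E\<close> (\<open>Elts\<close>), the category of
  elements of \<open>d \<mapsto> fin(S \<down> d)\<close>, and \<open>S\<close> factors as \<open>C \<rightarrow> E \<rightarrow> D\<close>.

  The first functor \<open>T\<close> has the right adjoint \<open>R : E \<rightarrow> C\<close>, \<open>(c, \<beta>) \<mapsto> c\<close>. Natural transformations induce
  simplicial homotopies between maps of simplicial replacements (\<open>replacement_maps_homotopic\<close>), and homotopic
  maps agree on homotopy groups (\<open>homotopic_homologous\<close>); unit and counit of the adjunction therefore show that
  \<open>G\<close> over \<open>C\<close> and \<open>G \<circ> R\<close> over \<open>E\<close> have the same homology (\<open>adjoint_homology\<close>).

  The second functor \<open>P : E \<rightarrow> D\<close> is a discrete opfibration with fibre \<open>fin(S \<down> d)\<close> over \<open>d\<close>, and the free products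
  of \<open>G \<circ> R\<close> over its fibres are the groups of the diagram in the statement. A simplex of the nerve of \<open>D\<close> and a
  point over its first vertex determine a unique simplex of the nerve of \<open>E\<close>, so the simplicial replacements of
  \<open>G \<circ> R\<close> and of this diagram are isomorphic in each degree (\<open>opfibration_homology\<close>).

  The universal property of the diagram is checked on the factors: the factor at \<open>\<beta> : S c \<rightarrow> d\<close> is the image under
  \<open>\<beta>\<close> of the unit at \<open>c\<close> (\<open>lan_in_unit\<close>), which dictates the values of a map out of it,
  and naturality of the prescribed map makes these values fit together. Any other left Kan extension is isomorphic to it by universality.\<close>

section \<open>Free products\<close>

locale group_family =
  fixes I :: "'i set" and G :: "'i \<Rightarrow> 'g monoid"
  assumes factor_group: "i \<in> I \<Longrightarrow> group (G i)"

lemma fp_words_Nil: "[] \<in> fp_words I G"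
  by (simp add: fp_words_def)

lemma fp_words_Cons: "(i, x) # w \<in> fp_words I G \<longleftrightarrow> i \<in> I \<and> x \<in> carrier (G i) \<and> w \<in> fp_words I G"
  by (auto simp: fp_words_def)

lemma fp_words_append: "u @ v \<in> fp_words I G \<longleftrightarrow> u \<in> fp_words I G \<and> v \<in> fp_words I G"
  by (auto simp: fp_words_def)

lemmas fp_words_simps = fp_words_Nil fp_words_Cons fp_words_append

definition fp_eval :: "'h monoid \<Rightarrow> ('i \<Rightarrow> 'g \<Rightarrow> 'h) \<Rightarrow> ('i \<times> 'g) list \<Rightarrow> 'h" where
  "fp_eval H f w = foldr (\<lambda>(i, x) y. f i x \<otimes>\<^bsub>H\<^esub> y) w \<one>\<^bsub>H\<^esub>"

lemma fp_eval_simps: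
  "fp_eval H f [] = \<one>\<^bsub>H\<^esub>"
  "fp_eval H f ((i, x) # w) = f i x \<otimes>\<^bsub>H\<^esub> fp_eval H f w"
  by (simp_all add: fp_eval_def)

lemma fp_eval_closed:
  assumes "group H" "\<And>i. i \<in> I \<Longrightarrow> f i \<in> hom (G i) H" "w \<in> fp_words I G"
  shows "fp_eval H f w \<in> carrier H"
  using assms(3)
proof (induction w)
  case Nil
  then show ?case using assms(1) by (simp add: fp_eval_simps group.is_monoid)
next
  case (Cons p w)
  then show ?case using assms(1,2)
    by (cases p) (auto simp: fp_eval_simps fp_words_simps
        intro!: monoid.m_closed group.is_monoid hom_in_carrier[OF assms(2)])
qed

lemma fp_eval_append:
  assumes "group H" "\<And>i. i \<in> I \<Longrightarrow> f i \<in> hom (G i) H" "u \<in> fp_words I G" "v \<in> fp_words I G"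
  shows "fp_eval H f (u @ v) = fp_eval H f u \<otimes>\<^bsub>H\<^esub> fp_eval H f v"
  using assms(3)
proof (induction u)
  case Nil
  then show ?case using fp_eval_closed[OF assms(1,2,4)] assms(1) 
    by (simp add: fp_eval_simps group.is_monoid)
next
  case (Cons p u)
  obtain i x where p: "p = (i, x)" by (cases p)
  have "f i x \<in> carrier H" "fp_eval H f u \<in> carrier H" "fp_eval H f v \<in> carrier H"
    using Cons.prems hom_in_carrier[OF assms(2), of i x] fp_eval_closed[where I = I and G = G, OF assms(1,2)] assms(4)
    by (simp_all add: p fp_words_simps)
  then show ?case using Cons assms(1)
    by (simp add: p fp_eval_simps fp_words_simps monoid.m_assoc group.is_monoid)
qed

context group_family
begin

lemma fp_equiv_words:
  assumes "fp_equiv I G u v"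
  shows "u \<in> fp_words I G" "v \<in> fp_words I G"
proof -
  have "u \<in> fp_words I G \<and> v \<in> fp_words I G"
    using assms
    by induction (auto simp: fp_words_simps factor_group group.is_monoid intro!: monoid.m_closed monoid.one_closed)
  then show "u \<in> fp_words I G" "v \<in> fp_words I G" by auto
qed

lemma fp_equiv_context:
  assumes "fp_equiv I G u v" "s \<in> fp_words I G" "t \<in> fp_words I G"
  shows "fp_equiv I G (s @ u @ t) (s @ v @ t)"
  using assms
proof induction
  case (fp_mult i x y u v)
  then show ?case using fp_equiv.fp_mult[of i I x G y "s @ u" "v @ t"] by (simp add: fp_words_simps)
next
  case (fp_one i u v)
  then show ?case using fp_equiv.fp_one[of i I "s @ u" G "v @ t"] by (simp add: fp_words_simps)
next
  case (fp_refl u)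
  then show ?case by (simp add: fp_equiv.fp_refl fp_words_simps)
next
  case (fp_sym u v)
  then show ?case by (simp add: fp_equiv.fp_sym)
next
  case (fp_trans u v w)
  then show ?case by (meson fp_equiv.fp_trans)
qed

lemma fp_equiv_append:
  assumes "fp_equiv I G u u'" "fp_equiv I G v v'"
  shows "fp_equiv I G (u @ v) (u' @ v')"
proof -
  have "fp_equiv I G (u @ v) (u' @ v)"
    using fp_equiv_context[OF assms(1), of "[]" v] fp_equiv_words[OF assms(2)] by (simp add: fp_words_simps)
  moreover have "fp_equiv I G (u' @ v) (u' @ v')"
    using fp_equiv_context[OF assms(2), of u' "[]"] fp_equiv_words[OF assms(1)] by (simp add: fp_words_simps)
  ultimately show ?thesis by (rule fp_equiv.fp_trans)
qed

lemma fp_class_eqI: "fp_equiv I G u v \<Longrightarrow> fp_class I G u = fp_class I G v"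
  unfolding fp_class_def by (blast intro: fp_equiv.fp_trans fp_equiv.fp_sym)

lemma carrier_fpE:
  assumes "A \<in> carrier (free_product I G)"
  obtains w where "w \<in> fp_words I G" "A = fp_class I G w"
  using assms by (auto simp: free_product_def)

lemma fp_class_closed: "w \<in> fp_words I G \<Longrightarrow> fp_class I G w \<in> carrier (free_product I G)"
  by (simp add: free_product_def)

lemma mult_fp_class:
  assumes "u \<in> fp_words I G" "v \<in> fp_words I G"
  shows "fp_class I G u \<otimes>\<^bsub>free_product I G\<^esub> fp_class I G v = fp_class I G (u @ v)"
proof -
  have *: "fp_class I G (a @ b) = fp_class I G (u @ v)"
    if "a \<in> fp_class I G u" "b \<in> fp_class I G v" for a b
    using that fp_class_eqI[OF fp_equiv_append[of u a v b]] by (simp add: fp_class_def)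
  have "u \<in> fp_class I G u" "v \<in> fp_class I G v"
    using assms by (auto simp: fp_class_def fp_equiv.fp_refl)
  then have "(\<Union>a \<in> fp_class I G u. \<Union>b \<in> fp_class I G v. fp_class I G (a @ b)) = fp_class I G (u @ v)"
    using * by blast
  then show ?thesis by (simp add: free_product_def)
qed

lemma one_fp: "\<one>\<^bsub>free_product I G\<^esub> = fp_class I G []"
  by (simp add: free_product_def)

lemma fp_in_closed: "i \<in> I \<Longrightarrow> x \<in> carrier (G i) \<Longrightarrow> fp_in I G i x \<in> carrier (free_product I G)"
  by (simp add: fp_in_def fp_class_closed fp_words_simps)

lemma fp_in_mult:
  assumes "i \<in> I" "x \<in> carrier (G i)" "y \<in> carrier (G i)"
  shows "fp_in I G i x \<otimes>\<^bsub>free_product I G\<^esub> fp_in I G i y = fp_in I G i (x \<otimes>\<^bsub>G i\<^esub> y)"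
  using fp_class_eqI[OF fp_equiv.fp_mult[of i I x G y "[]" "[]"]] assms
  by (simp add: fp_in_def mult_fp_class fp_words_simps)

lemma fp_class_Cons:
  assumes "i \<in> I" "x \<in> carrier (G i)" "w \<in> fp_words I G"
  shows "fp_class I G ((i, x) # w) = fp_in I G i x \<otimes>\<^bsub>free_product I G\<^esub> fp_class I G w"
  using assms by (simp add: fp_in_def mult_fp_class fp_words_simps)

text \<open>Inverses of the letters, in the reverse order.\<close>

lemma fp_left_inverse:
  assumes "w \<in> fp_words I G"
  shows "\<exists>v \<in> fp_words I G. fp_class I G (v @ w) = fp_class I G []"
  using assms
proof (induction w)
  case Nil
  then show ?case by (auto intro!: bexI[of _ "[]"] simp: fp_words_simps)
next
  case (Cons p w)
  obtain i x where p: "p = (i, x)" by (cases p)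
  have ix: "i \<in> I" "x \<in> carrier (G i)" "w \<in> fp_words I G" using Cons.prems by (auto simp: p fp_words_simps)
  obtain v where v: "v \<in> fp_words I G" "fp_class I G (v @ w) = fp_class I G []"
    using Cons.IH ix by blast
  interpret group "G i" using ix factor_group by simp
  have "fp_equiv I G (v @ [(i, inv\<^bsub>G i\<^esub> x), (i, x)] @ w) (v @ [(i, inv\<^bsub>G i\<^esub> x \<otimes>\<^bsub>G i\<^esub> x)] @ w)"
    by (rule fp_equiv.fp_mult) (use ix v in auto)
  also have "v @ [(i, inv\<^bsub>G i\<^esub> x \<otimes>\<^bsub>G i\<^esub> x)] @ w = v @ [(i, \<one>\<^bsub>G i\<^esub>)] @ w"
    using ix by simp
  finally have "fp_equiv I G (v @ [(i, inv\<^bsub>G i\<^esub> x), (i, x)] @ w) (v @ w)"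
    using fp_equiv.fp_one[OF ix(1) v(1) ix(3)] fp_equiv.fp_trans by blast
  then have "fp_class I G ((v @ [(i, inv\<^bsub>G i\<^esub> x)]) @ p # w) = fp_class I G []"
    using v(2) by (metis fp_class_eqI append.assoc append_Cons append_Nil p)
  moreover have "v @ [(i, inv\<^bsub>G i\<^esub> x)] \<in> fp_words I G" using v ix by (simp add: fp_words_simps)
  ultimately show ?case by blast
qed

lemma free_product_group: "group (free_product I G)"
proof (rule groupI)
  show "\<exists>y\<in>carrier (free_product I G). y \<otimes>\<^bsub>free_product I G\<^esub> x = \<one>\<^bsub>free_product I G\<^esub>"
    if x: "x \<in> carrier (free_product I G)" for x
  proof -
    obtain w where w: "w \<in> fp_words I G" "x = fp_class I G w" using x by (rule carrier_fpE)
    obtain v where v: "v \<in> fp_words I G" "fp_class I G (v @ w) = fp_class I G []"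
      using fp_left_inverse[OF w(1)] by blast
    have "fp_class I G v \<otimes>\<^bsub>free_product I G\<^esub> x = \<one>\<^bsub>free_product I G\<^esub>"
      using v w by (simp add: mult_fp_class one_fp)
    then show ?thesis using fp_class_closed[OF v(1)] by blast
  qed
next
  show "\<one>\<^bsub>free_product I G\<^esub> \<in> carrier (free_product I G)"
    by (simp add: one_fp fp_class_closed fp_words_simps)
next
  fix x y assume "x \<in> carrier (free_product I G)" "y \<in> carrier (free_product I G)"
  then show "x \<otimes>\<^bsub>free_product I G\<^esub> y \<in> carrier (free_product I G)"
    by (elim carrier_fpE) (simp add: mult_fp_class fp_class_closed fp_words_simps)
next
  fix x y z
  assume "x \<in> carrier (free_product I G)" "y \<in> carrier (free_product I G)" "z \<in> carrier (free_product I G)"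
  then show "x \<otimes>\<^bsub>free_product I G\<^esub> y \<otimes>\<^bsub>free_product I G\<^esub> z
      = x \<otimes>\<^bsub>free_product I G\<^esub> (y \<otimes>\<^bsub>free_product I G\<^esub> z)"
    by (elim carrier_fpE) (simp add: mult_fp_class fp_words_simps)
next
  fix x assume "x \<in> carrier (free_product I G)"
  then show "\<one>\<^bsub>free_product I G\<^esub> \<otimes>\<^bsub>free_product I G\<^esub> x = x"
    by (elim carrier_fpE) (simp add: mult_fp_class one_fp fp_words_simps)
qed

lemma fp_in_hom: "i \<in> I \<Longrightarrow> fp_in I G i \<in> hom (G i) (free_product I G)"
  by (auto simp: hom_def fp_in_mult fp_in_closed)

text \<open>The factors generate the free product.\<close>

lemma free_product_hom_eqI:
  assumes "group H" "a \<in> hom (free_product I G) H" "b \<in> hom (free_product I G) H"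
    and "\<And>i x. i \<in> I \<Longrightarrow> x \<in> carrier (G i) \<Longrightarrow> a (fp_in I G i x) = b (fp_in I G i x)"
    and "A \<in> carrier (free_product I G)"
  shows "a A = b A"
proof -
  have "a (fp_class I G w) = b (fp_class I G w)" if "w \<in> fp_words I G" for w
    using that
  proof (induction w)
    case Nil
    then show ?case
      using hom_one[OF assms(2) free_product_group assms(1)] hom_one[OF assms(3) free_product_group assms(1)]
      by (simp add: one_fp)
  next
    case (Cons p w)
    then show ?case
      using assms(4) by (cases p) (simp add: fp_words_simps fp_class_Cons fp_in_closed fp_class_closed
          hom_mult[OF assms(2)] hom_mult[OF assms(3)])
  qed
  then show ?thesis using assms(5) by (auto elim: carrier_fpE)
qed

lemma fp_eval_equiv:
  assumes "group H" "\<And>i. i \<in> I \<Longrightarrow> f i \<in> hom (G i) H" "fp_equiv I G u v"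
  shows "fp_eval H f u = fp_eval H f v"
  using assms(3)
proof induction
  case (fp_mult i x y u v)
  interpret G: group "G i" using fp_mult factor_group by simp
  interpret H: group H by (rule assms(1))
  have c: "f i x \<in> carrier H" "f i y \<in> carrier H" "fp_eval H f v \<in> carrier H"
    using fp_mult fp_eval_closed[where I = I and G = G, OF assms(1,2)] by (auto intro: hom_in_carrier[OF assms(2)])
  have w: "(i, x) # (i, y) # v \<in> fp_words I G" "(i, x \<otimes>\<^bsub>G i\<^esub> y) # v \<in> fp_words I G"
    using fp_mult by (auto simp: fp_words_simps)
  show ?case
    using fp_eval_append[OF assms(1,2) fp_mult(4) w(1)] fp_eval_append[OF assms(1,2) fp_mult(4) w(2)] c fp_mult
      hom_mult[OF assms(2)] by (simp add: fp_eval_simps H.m_assoc)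
next
  case (fp_one i u v)
  interpret H: group H by (rule assms(1))
  have w: "(i, \<one>\<^bsub>G i\<^esub>) # v \<in> fp_words I G"
    using fp_one factor_group[of i] by (auto simp: fp_words_simps group.is_monoid)
  show ?case
    using fp_eval_append[OF assms(1,2) fp_one(2) w] fp_eval_append[OF assms(1,2) fp_one(2,3)]
      hom_one[OF assms(2) factor_group assms(1)] fp_eval_closed[OF assms(1,2) fp_one(3)] fp_one
    by (simp add: fp_eval_simps)
qed simp_all

text \<open>The representative chosen by \<open>fp_lift\<close> is immaterial, since evaluation of words respects the congruence.\<close>

lemma fp_lift_class:
  assumes "group H" "\<And>i. i \<in> I \<Longrightarrow> f i \<in> hom (G i) H" "w \<in> fp_words I G"
  shows "fp_lift H f (fp_class I G w) = fp_eval H f w"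
proof -
  have "w \<in> fp_class I G w" using assms(3) by (auto simp: fp_class_def fp_equiv.fp_refl)
  then have "(SOME v. v \<in> fp_class I G w) \<in> fp_class I G w" by (rule someI)
  then have "fp_eval H f w = fp_eval H f (SOME v. v \<in> fp_class I G w)"
    by (intro fp_eval_equiv[OF assms(1,2)]) (simp_all add: fp_class_def)
  then show ?thesis by (simp add: fp_lift_def fp_eval_def)
qed

lemma fp_lift_hom:
  assumes "group H" "\<And>i. i \<in> I \<Longrightarrow> f i \<in> hom (G i) H"
  shows "fp_lift H f \<in> hom (free_product I G) H"
proof (rule homI)
  fix A assume "A \<in> carrier (free_product I G)"
  then show "fp_lift H f A \<in> carrier H"
    by (elim carrier_fpE) (simp add: fp_lift_class[OF assms] fp_eval_closed[OF assms])
next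
  fix A B assume "A \<in> carrier (free_product I G)" "B \<in> carrier (free_product I G)"
  then show "fp_lift H f (A \<otimes>\<^bsub>free_product I G\<^esub> B) = fp_lift H f A \<otimes>\<^bsub>H\<^esub> fp_lift H f B"
    by (elim carrier_fpE)
      (simp add: mult_fp_class fp_lift_class[OF assms] fp_words_simps fp_eval_append[OF assms])
qed

lemma fp_lift_in:
  assumes "group H" "\<And>i. i \<in> I \<Longrightarrow> f i \<in> hom (G i) H" "i \<in> I" "x \<in> carrier (G i)"
  shows "fp_lift H f (fp_in I G i x) = f i x"
proof -
  have "f i x \<in> carrier H" by (rule hom_in_carrier[OF assms(2)[OF assms(3)] assms(4)])
  interpret H: group H by (rule assms(1))
  show ?thesis
    using assms(3,4) \<open>f i x \<in> carrier H\<close> by (simp add: fp_in_def fp_lift_class[OF assms(1,2)] fp_words_simps fp_eval_simps)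
qed

end

text \<open>The face and degeneracy operators of a simplicial replacement, and all maps between simplicial
  replacements below, send factors into factors.\<close>

definition factor_map :: "'i set \<Rightarrow> ('i \<Rightarrow> 'g monoid) \<Rightarrow> 'j set \<Rightarrow> ('j \<Rightarrow> 'h monoid) \<Rightarrow> ('i \<Rightarrow> 'j) \<Rightarrow> ('i \<Rightarrow> 'g \<Rightarrow> 'h) \<Rightarrow> bool" where
  "factor_map I G J H p q \<longleftrightarrow> (\<forall>i\<in>I. p i \<in> J \<and> q i \<in> hom (G i) (H (p i)))"

definition fp_map :: "'j set \<Rightarrow> ('j \<Rightarrow> 'h monoid) \<Rightarrow> ('i \<Rightarrow> 'j) \<Rightarrow> ('i \<Rightarrow> 'g \<Rightarrow> 'h)
    \<Rightarrow> ('i \<times> 'g) list set \<Rightarrow> ('j \<times> 'h) list set" where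
  "fp_map J H p q = fp_lift (free_product J H) (\<lambda>i x. fp_in J H (p i) (q i x))"

lemma
  assumes "group_family I G" "group_family J H" and pq: "factor_map I G J H p q"
  shows fp_map_hom: "fp_map J H p q \<in> hom (free_product I G) (free_product J H)"
    and fp_map_in: "\<And>i x. i \<in> I \<Longrightarrow> x \<in> carrier (G i) \<Longrightarrow>
      fp_map J H p q (fp_in I G i x) = fp_in J H (p i) (q i x)"
proof -
  interpret I: group_family I G by fact
  interpret J: group_family J H by fact
  have h: "(\<lambda>x. fp_in J H (p i) (q i x)) \<in> hom (G i) (free_product J H)" if "i \<in> I" for i
    using hom_compose[OF _ J.fp_in_hom, of "q i" "G i" "p i"] pq that by (simp add: comp_def factor_map_def)
  show "fp_map J H p q \<in> hom (free_product I G) (free_product J H)"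
    unfolding fp_map_def by (rule I.fp_lift_hom[OF J.free_product_group h])
  show "fp_map J H p q (fp_in I G i x) = fp_in J H (p i) (q i x)"
    if "i \<in> I" "x \<in> carrier (G i)" for i x
    unfolding fp_map_def by (rule I.fp_lift_in[OF J.free_product_group h that])
qed

lemma fp_map_cong:
  assumes "group_family I G" "group_family J H" and pq: "factor_map I G J H p q"
    and eq: "\<And>i. i \<in> I \<Longrightarrow> p' i = p i" "\<And>i x. i \<in> I \<Longrightarrow> x \<in> carrier (G i) \<Longrightarrow> q' i x = q i x"
    and A: "A \<in> carrier (free_product I G)"
  shows "fp_map J H p' q' A = fp_map J H p q A"
proof -
  interpret I: group_family I G by fact
  interpret J: group_family J H by fact
  have "q' i \<in> hom (G i) (H (p i))" if i: "i \<in> I" for i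
    using pq i eq(2)[OF i] monoid.m_closed[OF group.is_monoid[OF I.factor_group[OF i]]]
    by (auto simp: factor_map_def hom_def Pi_iff)
  then have pq': "factor_map I G J H p' q'" using pq eq(1) by (simp add: factor_map_def)
  show ?thesis
    by (rule I.free_product_hom_eqI[OF J.free_product_group fp_map_hom[OF assms(1,2) pq'] fp_map_hom[OF assms(1,2) pq] _ A])
      (simp add: fp_map_in[OF assms(1,2) pq'] fp_map_in[OF assms(1,2) pq] eq)
qed

lemma fp_map_comp:
  assumes "group_family I G" "group_family J H" "group_family K M"
    and pq: "factor_map I G J H p q" and pq': "factor_map J H K M p' q'" and rs: "factor_map I G K M r s"
    and eq: "\<And>i. i \<in> I \<Longrightarrow> p' (p i) = r i" "\<And>i x. i \<in> I \<Longrightarrow> x \<in> carrier (G i) \<Longrightarrow> q' (p i) (q i x) = s i x"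
    and A: "A \<in> carrier (free_product I G)"
  shows "fp_map K M p' q' (fp_map J H p q A) = fp_map K M r s A"
proof -
  interpret I: group_family I G by fact
  interpret K: group_family K M by fact
  have "p i \<in> J" "x \<in> carrier (G i) \<Longrightarrow> q i x \<in> carrier (H (p i))" if "i \<in> I" for i x
    using pq that by (auto simp: factor_map_def hom_def)
  then have "(fp_map K M p' q' \<circ> fp_map J H p q) A = fp_map K M r s A"
    by (intro I.free_product_hom_eqI[OF K.free_product_group
        hom_compose[OF fp_map_hom[OF assms(1,2) pq] fp_map_hom[OF assms(2,3) pq']]
        fp_map_hom[OF assms(1,3) rs] _ A])
      (simp add: fp_map_in[OF assms(1,2) pq] fp_map_in[OF assms(2,3) pq'] fp_map_in[OF assms(1,3) rs] eq)
  then show ?thesis by simp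
qed

section \<open>Homotopy groups of simplicial groups\<close>

abbreviation homologous :: "'a sgroup \<Rightarrow> nat \<Rightarrow> 'a \<Rightarrow> 'a \<Rightarrow> bool" where
  "homologous X n a b \<equiv> a \<otimes>\<^bsub>Lev X n\<^esub> inv\<^bsub>Lev X n\<^esub> b \<in> moore_boundaries X n"

locale simplicial_group =
  fixes X :: "'a sgroup"
  assumes level_group: "group (Lev X n)"
    and face_hom: "i \<le> Suc n \<Longrightarrow> Face X (Suc n) i \<in> hom (Lev X (Suc n)) (Lev X n)"
    and dgn_hom: "i \<le> n \<Longrightarrow> Dgn X n i \<in> hom (Lev X n) (Lev X (Suc n))"
    and face_face: "\<lbrakk>i < j; j \<le> Suc (Suc n); x \<in> carrier (Lev X (Suc (Suc n)))\<rbrakk> \<Longrightarrow>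
      Face X (Suc n) i (Face X (Suc (Suc n)) j x) = Face X (Suc n) (j - 1) (Face X (Suc (Suc n)) i x)"
    and face_dgn_below: "\<lbrakk>i < j; j \<le> Suc n; x \<in> carrier (Lev X (Suc n))\<rbrakk> \<Longrightarrow>
      Face X (Suc (Suc n)) i (Dgn X (Suc n) j x) = Dgn X n (j - 1) (Face X (Suc n) i x)"
    and face_dgn_adjacent: "\<lbrakk>j \<le> n; i = j \<or> i = Suc j; x \<in> carrier (Lev X n)\<rbrakk> \<Longrightarrow>
      Face X (Suc n) i (Dgn X n j x) = x"
    and face_dgn_above: "\<lbrakk>Suc j < i; i \<le> Suc (Suc n); x \<in> carrier (Lev X (Suc n))\<rbrakk> \<Longrightarrow>
      Face X (Suc (Suc n)) i (Dgn X (Suc n) j x) = Dgn X n j (Face X (Suc n) (i - 1) x)"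
    and dgn_dgn: "\<lbrakk>i \<le> j; j \<le> n; x \<in> carrier (Lev X n)\<rbrakk> \<Longrightarrow>
      Dgn X (Suc n) i (Dgn X n j x) = Dgn X (Suc n) (Suc j) (Dgn X n i x)"
begin

lemma face_group_hom: "i \<le> Suc n \<Longrightarrow> group_hom (Lev X (Suc n)) (Lev X n) (Face X (Suc n) i)"
  by (simp add: group_hom_def group_hom_axioms_def level_group face_hom)

lemma dgn_group_hom: "i \<le> n \<Longrightarrow> group_hom (Lev X n) (Lev X (Suc n)) (Dgn X n i)"
  by (simp add: group_hom_def group_hom_axioms_def level_group dgn_hom)

lemmas face_closed = group_hom.hom_closed[OF face_group_hom]
lemmas face_mult = group_hom.hom_mult[OF face_group_hom]
lemmas face_one = group_hom.hom_one[OF face_group_hom]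
lemmas face_inv = group_hom.hom_inv[OF face_group_hom]
lemmas dgn_closed = group_hom.hom_closed[OF dgn_group_hom]
lemmas dgn_one = group_hom.hom_one[OF dgn_group_hom]

lemma moore_cycles_0: "moore_cycles X 0 = carrier (Lev X 0)"
  by (auto simp: moore_cycles_def moore_def)

lemma moore_cycles_Suc: "moore_cycles X (Suc n) =
  {x \<in> carrier (Lev X (Suc n)). \<forall>i\<le>Suc n. Face X (Suc n) i x = \<one>\<^bsub>Lev X n\<^esub>}"
  by (auto simp: moore_cycles_def moore_def le_less)

lemma moore_cycles_carrier: "z \<in> moore_cycles X n \<Longrightarrow> z \<in> carrier (Lev X n)"
  by (auto simp: moore_cycles_def moore_def)

lemma moore_cycles_subgroup: "subgroup (moore_cycles X n) (Lev X n)"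
proof -
  interpret group "Lev X n" by (rule level_group)
  show ?thesis
  proof (cases n)
    case 0
    then show ?thesis using subgroup_self by (simp add: moore_cycles_0)
  next
    case (Suc m)
    interpret m: group "Lev X m" by (rule level_group)
    interpret n: group "Lev X (Suc m)" by (rule level_group)
    have "subgroup (moore_cycles X (Suc m)) (Lev X (Suc m))"
      by (rule n.subgroupI) (auto simp: moore_cycles_Suc face_mult face_one face_inv
          intro!: exI[of _ "\<one>\<^bsub>Lev X (Suc m)\<^esub>"])
    then show ?thesis by (simp add: Suc)
  qed
qed

lemma moore_carrier: "y \<in> moore X n \<Longrightarrow> y \<in> carrier (Lev X n)"
  by (simp add: moore_def)

lemma moore_Suc: "moore X (Suc n) =
  {x \<in> carrier (Lev X (Suc n)). \<forall>i\<le>n. Face X (Suc n) i x = \<one>\<^bsub>Lev X n\<^esub>}"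
  by (auto simp: moore_def)

lemma moore_Suc_subgroup: "subgroup (moore X (Suc n)) (Lev X (Suc n))"
proof -
  interpret group "Lev X (Suc n)" by (rule level_group)
  interpret m: group "Lev X n" by (rule level_group)
  show ?thesis
    by (rule subgroupI) (auto simp: moore_Suc face_mult face_one face_inv
        intro!: exI[of _ "\<one>\<^bsub>Lev X (Suc n)\<^esub>"])
qed

lemma moore_boundaries_subgroup: "subgroup (moore_boundaries X n) (Lev X n)"
  unfolding moore_boundaries_def
  by (rule group_hom.subgroup_img_is_subgroup[OF face_group_hom moore_Suc_subgroup]) simp

lemma moore_boundaries_cycles: "moore_boundaries X n \<subseteq> moore_cycles X n"
proof
  fix z assume "z \<in> moore_boundaries X n"
  then obtain y where y: "y \<in> moore X (Suc n)" and z: "z = Face X (Suc n) (Suc n) y"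
    by (auto simp: moore_boundaries_def)
  have yc: "y \<in> carrier (Lev X (Suc n))" by (rule moore_carrier[OF y])
  show "z \<in> moore_cycles X n"
  proof (cases n)
    case 0
    then show ?thesis using yc by (simp add: z moore_cycles_0 face_closed)
  next
    case (Suc m)
    have "Face X (Suc m) i z = \<one>\<^bsub>Lev X m\<^esub>" if "i \<le> Suc m" for i
    proof -
      have "Face X (Suc m) i z = Face X (Suc m) (Suc m) (Face X (Suc (Suc m)) i y)"
        using face_face[of i "Suc (Suc m)" m y] that yc by (simp add: z Suc)
      also have "Face X (Suc (Suc m)) i y = \<one>\<^bsub>Lev X (Suc m)\<^esub>"
        using y that by (simp add: Suc moore_Suc)
      finally show ?thesis by (simp add: face_one)
    qed
    then show ?thesis using yc face_closed[of "Suc n" n y] by (simp add: z Suc moore_cycles_Suc)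
  qed
qed

lemma face_dgn_cycle:
  assumes "z \<in> moore_cycles X n" "j \<le> n" "i \<le> Suc n" "i \<noteq> j" "i \<noteq> Suc j"
  shows "Face X (Suc n) i (Dgn X n j z) = \<one>\<^bsub>Lev X n\<^esub>"
proof -
  obtain m where n: "n = Suc m" using assms by (cases n) auto
  have z: "z \<in> carrier (Lev X n)" by (rule moore_cycles_carrier[OF assms(1)])
  consider "i < j" | "Suc j < i" using assms by linarith
  then show ?thesis
  proof cases
    case 1
    then have "Face X (Suc m) i z = \<one>\<^bsub>Lev X m\<^esub>" using assms by (simp add: n moore_cycles_Suc)
    then show ?thesis using face_dgn_below[of i j m z] dgn_one[of "j - 1" m] 1 assms z by (simp add: n)
  next
    case 2
    then have "Face X (Suc m) (i - 1) z = \<one>\<^bsub>Lev X m\<^esub>" using assms by (simp add: n moore_cycles_Suc)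
    then show ?thesis using face_dgn_above[of j i m z] dgn_one[of j m] 2 assms z by (simp add: n)
  qed
qed

text \<open>To conjugate the boundary of \<open>y\<close> by \<open>z\<close>, conjugate \<open>y\<close> by the last degeneracy of \<open>z\<close>: its last face is
  \<open>z\<close>, and conjugation preserves the triviality of the other faces of \<open>y\<close>.\<close>

lemma moore_boundaries_normal:
  "moore_boundaries X n \<lhd> ((Lev X n)\<lparr>carrier := moore_cycles X n\<rparr>)"
proof -
  interpret L: group "Lev X n" by (rule level_group)
  interpret L': group "Lev X (Suc n)" by (rule level_group)
  interpret Z: group "(Lev X n)\<lparr>carrier := moore_cycles X n\<rparr>"
    by (rule L.subgroup_imp_group[OF moore_cycles_subgroup])
  have "z \<otimes>\<^bsub>Lev X n\<^esub> b \<otimes>\<^bsub>Lev X n\<^esub> inv\<^bsub>Lev X n\<^esub> z \<in> moore_boundaries X n"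
    if z: "z \<in> moore_cycles X n" and b: "b \<in> moore_boundaries X n" for z b
  proof -
    obtain y where y: "y \<in> moore X (Suc n)" and b: "b = Face X (Suc n) (Suc n) y"
      using b by (auto simp: moore_boundaries_def)
    have yc: "y \<in> carrier (Lev X (Suc n))" by (rule moore_carrier[OF y])
    have zc: "z \<in> carrier (Lev X n)" by (rule moore_cycles_carrier[OF z])
    let ?s = "Dgn X n n z"
    have sc: "?s \<in> carrier (Lev X (Suc n))" using zc by (simp add: dgn_closed)
    let ?w = "?s \<otimes>\<^bsub>Lev X (Suc n)\<^esub> y \<otimes>\<^bsub>Lev X (Suc n)\<^esub> inv\<^bsub>Lev X (Suc n)\<^esub> ?s"
    have face: "Face X (Suc n) i ?w = Face X (Suc n) i ?s \<otimes>\<^bsub>Lev X n\<^esub> Face X (Suc n) i y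
        \<otimes>\<^bsub>Lev X n\<^esub> inv\<^bsub>Lev X n\<^esub> (Face X (Suc n) i ?s)" if "i \<le> Suc n" for i
      using that sc yc by (simp add: face_mult face_inv)
    have "?w \<in> moore X (Suc n)"
      using y yc sc by (auto simp: moore_Suc face face_closed)
    moreover have "Face X (Suc n) (Suc n) ?w = z \<otimes>\<^bsub>Lev X n\<^esub> b \<otimes>\<^bsub>Lev X n\<^esub> inv\<^bsub>Lev X n\<^esub> z"
      using face[of "Suc n"] zc by (simp add: face_dgn_adjacent b)
    ultimately show ?thesis unfolding moore_boundaries_def by (metis imageI)
  qed
  then show ?thesis
    unfolding Z.normal_inv_iff
    using L.subgroup_incl[OF moore_boundaries_subgroup moore_cycles_subgroup moore_boundaries_cycles]
      L.m_inv_consistent[OF moore_cycles_subgroup]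
    by simp
qed

text \<open>Multiplying by a degeneracy of \<open>u\<close> moves the nontrivial face to the next position, at the price of
  inverting it; in the last position it is a Moore boundary.\<close>

lemma single_face_boundary:
  assumes "u \<in> moore_cycles X n" "y \<in> carrier (Lev X (Suc n))" "k \<le> Suc n"
    and "Face X (Suc n) k y = u"
    and "\<And>i. i \<le> Suc n \<Longrightarrow> i \<noteq> k \<Longrightarrow> Face X (Suc n) i y = \<one>\<^bsub>Lev X n\<^esub>"
  shows "u \<in> moore_boundaries X n"
  using assms
proof (induction "Suc n - k" arbitrary: k u y)
  case 0
  then have "k = Suc n" by simp
  then have "y \<in> moore X (Suc n)" using 0 by (auto simp: moore_Suc)
  then show ?case using 0 \<open>k = Suc n\<close> unfolding moore_boundaries_def by blast
next
  case (Suc d)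
  interpret L: group "Lev X n" by (rule level_group)
  interpret L': group "Lev X (Suc n)" by (rule level_group)
  have k: "k \<le> n" using Suc.hyps(2) by simp
  have u: "u \<in> carrier (Lev X n)" by (rule moore_cycles_carrier[OF Suc.prems(1)])
  have s: "Dgn X n k u \<in> carrier (Lev X (Suc n))" using u k by (simp add: dgn_closed)
  let ?y = "y \<otimes>\<^bsub>Lev X (Suc n)\<^esub> inv\<^bsub>Lev X (Suc n)\<^esub> (Dgn X n k u)"
  have face: "Face X (Suc n) i ?y = Face X (Suc n) i y \<otimes>\<^bsub>Lev X n\<^esub> inv\<^bsub>Lev X n\<^esub> Face X (Suc n) i (Dgn X n k u)"
    if "i \<le> Suc n" for i
    using that Suc.prems(2) s by (simp add: face_mult face_inv)
  have "inv\<^bsub>Lev X n\<^esub> u \<in> moore_boundaries X n"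
  proof (rule Suc.hyps(1)[of "Suc k" "inv\<^bsub>Lev X n\<^esub> u" ?y])
    show "inv\<^bsub>Lev X n\<^esub> u \<in> moore_cycles X n"
      by (rule subgroup.m_inv_closed[OF moore_cycles_subgroup Suc.prems(1)])
    show "Face X (Suc n) (Suc k) ?y = inv\<^bsub>Lev X n\<^esub> u"
      using face[of "Suc k"] Suc.prems(5)[of "Suc k"] k u by (simp add: face_dgn_adjacent)
    show "Face X (Suc n) i ?y = \<one>\<^bsub>Lev X n\<^esub>" if "i \<le> Suc n" "i \<noteq> Suc k" for i
    proof (cases "i = k")
      case True
      then show ?thesis using face[of k] Suc.prems(3,4) k u by (simp add: face_dgn_adjacent)
    next
      case False
      then show ?thesis
        using face[of i] that Suc.prems(5)[of i] face_dgn_cycle[OF Suc.prems(1) k, of i] by simp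
    qed
  qed (use Suc.hyps(2) Suc.prems(2) k s in auto)
  then show ?case
    using subgroup.m_inv_closed[OF moore_boundaries_subgroup, of "inv\<^bsub>Lev X n\<^esub> u" n] u by simp
qed

text \<open>Quotient of the \<open>j\<close>-th degeneracy of the \<open>j\<close>-th face \<open>a\<close> by \<open>y\<close>: the \<open>j\<close>-th face cancels and a single
  nontrivial face \<open>a b\<^sup>-\<^sup>1\<close> remains. That \<open>b\<close> is again a cycle is what allows iteration along a homotopy.\<close>

lemma adjacent_faces_homologous:
  assumes "y \<in> carrier (Lev X (Suc n))" "j \<le> n"
    and "Face X (Suc n) j y \<in> moore_cycles X n"
    and "\<And>i. i \<le> Suc n \<Longrightarrow> i \<noteq> j \<Longrightarrow> i \<noteq> Suc j \<Longrightarrow> Face X (Suc n) i y = \<one>\<^bsub>Lev X n\<^esub>"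
  shows "Face X (Suc n) (Suc j) y \<in> moore_cycles X n"
    and "homologous X n (Face X (Suc n) j y) (Face X (Suc n) (Suc j) y)"
proof -
  interpret L: group "Lev X n" by (rule level_group)
  interpret L': group "Lev X (Suc n)" by (rule level_group)
  let ?a = "Face X (Suc n) j y" and ?b = "Face X (Suc n) (Suc j) y"
  have ac: "?a \<in> carrier (Lev X n)" and bc: "?b \<in> carrier (Lev X n)"
    using assms(1,2) by (simp_all add: face_closed)
  show b: "?b \<in> moore_cycles X n"
  proof (cases n)
    case 0
    then show ?thesis using bc by (simp add: moore_cycles_0)
  next
    case (Suc m)
    have "Face X (Suc m) i ?b = \<one>\<^bsub>Lev X m\<^esub>" if i: "i \<le> Suc m" for i
    proof -
      consider "i < j" | "i = j" | "j < i" by linarith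
      then show ?thesis
      proof cases
        case 1
        then have "Face X (Suc m) i ?b = Face X (Suc m) j (Face X (Suc n) i y)"
          using face_face[of i "Suc j" m y] assms(1,2) by (simp add: Suc)
        then show ?thesis using assms(2) assms(4)[of i] 1 i by (simp add: face_one Suc)
      next
        case 2
        then have "Face X (Suc m) i ?b = Face X (Suc m) j (Face X (Suc n) j y)"
          using face_face[of j "Suc j" m y] assms(1,2) by (simp add: Suc)
        then show ?thesis using assms(2,3) by (simp add: Suc moore_cycles_Suc)
      next
        case 3
        then have "Face X (Suc m) i ?b = Face X (Suc m) (Suc j) (Face X (Suc n) (Suc i) y)"
          using face_face[of "Suc j" "Suc i" m y] assms(1,2) i by (simp add: Suc)
        then show ?thesis using assms(2) assms(4)[of "Suc i"] 3 i by (simp add: face_one Suc)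
      qed
    qed
    then show ?thesis using bc by (simp add: Suc moore_cycles_Suc)
  qed
  let ?s = "Dgn X n j ?a"
  have s: "?s \<in> carrier (Lev X (Suc n))" using ac assms(2) by (simp add: dgn_closed)
  let ?y = "?s \<otimes>\<^bsub>Lev X (Suc n)\<^esub> inv\<^bsub>Lev X (Suc n)\<^esub> y"
  have face: "Face X (Suc n) i ?y = Face X (Suc n) i ?s \<otimes>\<^bsub>Lev X n\<^esub> inv\<^bsub>Lev X n\<^esub> Face X (Suc n) i y"
    if "i \<le> Suc n" for i
    using that assms(1) s by (simp add: face_mult face_inv)
  show "homologous X n ?a ?b"
  proof (rule single_face_boundary[of _ _ ?y "Suc j"])
    show "?a \<otimes>\<^bsub>Lev X n\<^esub> inv\<^bsub>Lev X n\<^esub> ?b \<in> moore_cycles X n"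
      using moore_cycles_subgroup assms(3) b by (simp add: subgroup_def)
    show "Face X (Suc n) (Suc j) ?y = ?a \<otimes>\<^bsub>Lev X n\<^esub> inv\<^bsub>Lev X n\<^esub> ?b"
      using face[of "Suc j"] assms(2) ac by (simp add: face_dgn_adjacent)
    show "Face X (Suc n) i ?y = \<one>\<^bsub>Lev X n\<^esub>" if "i \<le> Suc n" "i \<noteq> Suc j" for i
    proof (cases "i = j")
      case True
      then show ?thesis using face[of j] assms(2) ac by (simp add: face_dgn_adjacent)
    next
      case False
      then show ?thesis
        using face[of i] that assms(4)[of i] face_dgn_cycle[OF assms(3,2), of i] by simp
    qed
  qed (use assms(1,2) s in auto)
qed

end

text \<open>Moore complexes only see the faces, so compatibility with them suffices to act on homotopy groups.\<close>

definition semisimplicial_hom :: "'a sgroup \<Rightarrow> 'b sgroup \<Rightarrow> (nat \<Rightarrow> 'a \<Rightarrow> 'b) \<Rightarrow> bool" where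
  "semisimplicial_hom X Y f \<longleftrightarrow> (\<forall>n. f n \<in> hom (Lev X n) (Lev Y n)) \<and>
     (\<forall>n. \<forall>i\<le>Suc n. \<forall>x\<in>carrier (Lev X (Suc n)).
        Face Y (Suc n) i (f (Suc n) x) = f n (Face X (Suc n) i x))"

definition simplicial_homotopy ::
  "'a sgroup \<Rightarrow> 'b sgroup \<Rightarrow> (nat \<Rightarrow> 'a \<Rightarrow> 'b) \<Rightarrow> (nat \<Rightarrow> 'a \<Rightarrow> 'b) \<Rightarrow> (nat \<Rightarrow> nat \<Rightarrow> 'a \<Rightarrow> 'b) \<Rightarrow> bool" where
  "simplicial_homotopy X Y f g h \<longleftrightarrow>
     (\<forall>n. \<forall>j\<le>n. h n j \<in> hom (Lev X n) (Lev Y (Suc n))) \<and>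
     (\<forall>n. \<forall>x\<in>carrier (Lev X n).
        Face Y (Suc n) 0 (h n 0 x) = f n x \<and>
        Face Y (Suc n) (Suc n) (h n n x) = g n x \<and>
        (\<forall>j<n. Face Y (Suc n) (Suc j) (h n (Suc j) x) = Face Y (Suc n) (Suc j) (h n j x))) \<and>
     (\<forall>n. \<forall>j\<le>Suc n. \<forall>x\<in>carrier (Lev X (Suc n)).
        (\<forall>i<j. Face Y (Suc (Suc n)) i (h (Suc n) j x) = h n (j - 1) (Face X (Suc n) i x)) \<and>
        (\<forall>i\<le>Suc (Suc n). Suc j < i \<longrightarrow>
           Face Y (Suc (Suc n)) i (h (Suc n) j x) = h n j (Face X (Suc n) (i - 1) x)))"

lemma semisimplicial_hom_cycles:
  assumes "simplicial_group X" "simplicial_group Y" "semisimplicial_hom X Y f" "z \<in> moore_cycles X n"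
  shows "f n z \<in> moore_cycles Y n"
proof -
  interpret X: simplicial_group X by fact
  interpret Y: simplicial_group Y by fact
  have f: "\<And>n. f n \<in> hom (Lev X n) (Lev Y n)"
    "\<And>n i x. i \<le> Suc n \<Longrightarrow> x \<in> carrier (Lev X (Suc n)) \<Longrightarrow>
      Face Y (Suc n) i (f (Suc n) x) = f n (Face X (Suc n) i x)"
    using assms(3) by (auto simp: semisimplicial_hom_def)
  show ?thesis
    using assms(4) hom_in_carrier[OF f(1)[of n] X.moore_cycles_carrier[OF assms(4)]]
    by (cases n) (auto simp: X.moore_cycles_0 Y.moore_cycles_0 X.moore_cycles_Suc Y.moore_cycles_Suc
        f(2) hom_one[OF f(1) X.level_group Y.level_group])
qed

lemma semisimplicial_hom_boundaries:
  assumes "simplicial_group X" "simplicial_group Y" "semisimplicial_hom X Y f" "b \<in> moore_boundaries X n"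
  shows "f n b \<in> moore_boundaries Y n"
proof -
  interpret X: simplicial_group X by fact
  interpret Y: simplicial_group Y by fact
  have f: "\<And>n. f n \<in> hom (Lev X n) (Lev Y n)"
    "\<And>n i x. i \<le> Suc n \<Longrightarrow> x \<in> carrier (Lev X (Suc n)) \<Longrightarrow>
      Face Y (Suc n) i (f (Suc n) x) = f n (Face X (Suc n) i x)"
    using assms(3) by (auto simp: semisimplicial_hom_def)
  obtain y where y: "y \<in> moore X (Suc n)" and b: "b = Face X (Suc n) (Suc n) y"
    using assms(4) by (auto simp: moore_boundaries_def)
  have "f (Suc n) y \<in> moore Y (Suc n)"
    using y hom_in_carrier[OF f(1)[of "Suc n"]]
    by (auto simp: X.moore_Suc Y.moore_Suc f(2) hom_one[OF f(1) X.level_group Y.level_group])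
  moreover have "f n b = Face Y (Suc n) (Suc n) (f (Suc n) y)"
    using f(2)[of "Suc n" n y] X.moore_carrier[OF y] by (simp add: b)
  ultimately show ?thesis unfolding moore_boundaries_def by blast
qed

text \<open>On a cycle \<open>z\<close>, all faces of \<open>h\<^sub>j(z)\<close> but the \<open>j\<close>-th and the next one vanish, so that these two
  are homologous; the homotopy identities chain them up from \<open>f(z)\<close> to \<open>g(z)\<close>.\<close>

lemma homotopic_homologous:
  assumes "simplicial_group X" "simplicial_group Y" "semisimplicial_hom X Y f"
    and "simplicial_homotopy X Y f g h" "z \<in> moore_cycles X n"
  shows "homologous Y n (f n z) (g n z)"
proof -
  interpret X: simplicial_group X by fact
  interpret Y: simplicial_group Y by fact
  interpret L: group "Lev Y n" by (rule Y.level_group)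
  have z: "z \<in> carrier (Lev X n)" by (rule X.moore_cycles_carrier[OF assms(5)])
  have h: "h m j \<in> hom (Lev X m) (Lev Y (Suc m))" if "j \<le> m" for m j
    using assms(4) that by (simp add: simplicial_homotopy_def)
  have h0: "Face Y (Suc n) 0 (h n 0 z) = f n z" and hn: "Face Y (Suc n) (Suc n) (h n n z) = g n z"
    and hj: "\<And>j. j < n \<Longrightarrow> Face Y (Suc n) (Suc j) (h n (Suc j) z) = Face Y (Suc n) (Suc j) (h n j z)"
    using assms(4) z by (simp_all add: simplicial_homotopy_def)
  have hc: "h n j z \<in> carrier (Lev Y (Suc n))" if "j \<le> n" for j
    using hom_in_carrier[OF h[OF that] z] .
  have other: "Face Y (Suc n) i (h n j z) = \<one>\<^bsub>Lev Y n\<^esub>"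
    if j: "j \<le> n" and i: "i \<le> Suc n" "i \<noteq> j" "i \<noteq> Suc j" for i j
  proof -
    obtain m where n: "n = Suc m" using j i by (cases n) auto
    have faces: "Face X n k z = \<one>\<^bsub>Lev X m\<^esub>" if "k \<le> n" for k
      using assms(5) that by (simp add: n X.moore_cycles_Suc)
    have one: "h m k \<one>\<^bsub>Lev X m\<^esub> = \<one>\<^bsub>Lev Y n\<^esub>" if "k \<le> m" for k
      using hom_one[OF h[OF that] X.level_group Y.level_group] by (simp add: n)
    consider "i < j" | "Suc j < i" using i by linarith
    then show ?thesis
    proof cases
      case 1
      then have "Face Y (Suc n) i (h n j z) = h m (j - 1) (Face X n i z)"
        using assms(4) j z by (simp add: simplicial_homotopy_def n)
      then show ?thesis using 1 j faces[of i] one[of "j - 1"] by (simp add: n)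
    next
      case 2
      then have "Face Y (Suc n) i (h n j z) = h m j (Face X n (i - 1) z)"
        using assms(4) i j z by (simp add: simplicial_homotopy_def n)
      then show ?thesis using 2 i faces[of "i - 1"] one[of j] by (simp add: n)
    qed
  qed
  have f: "f n z \<in> moore_cycles Y n"
    by (rule semisimplicial_hom_cycles[OF assms(1-3,5)])
  have step: "Face Y (Suc n) (Suc j) (h n j z) \<in> moore_cycles Y n \<and>
      homologous Y n (f n z) (Face Y (Suc n) (Suc j) (h n j z))"
    if "j \<le> n" for j
    using that
  proof (induction j)
    case 0
    then show ?case
      using Y.adjacent_faces_homologous[OF hc[OF 0] 0] other[OF 0] f h0 by simp
  next
    case (Suc j)
    let ?a = "Face Y (Suc n) (Suc j) (h n j z)" and ?b = "Face Y (Suc n) (Suc (Suc j)) (h n (Suc j) z)"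
    have IH: "?a \<in> moore_cycles Y n" "homologous Y n (f n z) ?a"
      using Suc by auto
    have a: "Face Y (Suc n) (Suc j) (h n (Suc j) z) = ?a" using hj Suc.prems by simp
    have b: "?b \<in> moore_cycles Y n" "homologous Y n ?a ?b"
      using Y.adjacent_faces_homologous[OF hc[OF Suc.prems] Suc.prems] other[OF Suc.prems] IH(1) a by simp_all
    have c: "f n z \<in> carrier (Lev Y n)" "?a \<in> carrier (Lev Y n)" "?b \<in> carrier (Lev Y n)"
      using Y.moore_cycles_carrier f IH(1) b(1) by auto
    have "(f n z \<otimes>\<^bsub>Lev Y n\<^esub> inv\<^bsub>Lev Y n\<^esub> ?a) \<otimes>\<^bsub>Lev Y n\<^esub> (?a \<otimes>\<^bsub>Lev Y n\<^esub> inv\<^bsub>Lev Y n\<^esub> ?b) \<in> moore_boundaries Y n"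
      by (rule subgroup.m_closed[OF Y.moore_boundaries_subgroup IH(2) b(2)])
    also have "(f n z \<otimes>\<^bsub>Lev Y n\<^esub> inv\<^bsub>Lev Y n\<^esub> ?a) \<otimes>\<^bsub>Lev Y n\<^esub> (?a \<otimes>\<^bsub>Lev Y n\<^esub> inv\<^bsub>Lev Y n\<^esub> ?b)
        = f n z \<otimes>\<^bsub>Lev Y n\<^esub> inv\<^bsub>Lev Y n\<^esub> ?b"
      using c by (simp add: L.m_assoc L.inv_solve_left flip: L.m_assoc[of "inv\<^bsub>Lev Y n\<^esub> ?a"])
    finally show ?case using b(1) by simp
  qed
  show ?thesis using step[of n] hn by simp
qed

text \<open>The map induced by \<open>f\<close> has kernel exactly the boundaries, because \<open>g\<close> sends boundaries to boundaries and
  undoes \<open>f\<close> up to boundaries; it is onto because \<open>f\<close> undoes \<open>g\<close> in the same sense.\<close>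

lemma homology_iso_of_inverse:
  assumes "simplicial_group X" "simplicial_group Y" "semisimplicial_hom X Y f" "semisimplicial_hom Y X g"
    and gf: "\<And>z. z \<in> moore_cycles X n \<Longrightarrow> homologous X n (g n (f n z)) z"
    and fg: "\<And>z. z \<in> moore_cycles Y n \<Longrightarrow> homologous Y n (f n (g n z)) z"
  shows "homotopy_group X n \<cong> homotopy_group Y n"
proof -
  interpret X: simplicial_group X by fact
  interpret Y: simplicial_group Y by fact
  interpret LX: group "Lev X n" by (rule X.level_group)
  interpret LY: group "Lev Y n" by (rule Y.level_group)
  let ?ZX = "(Lev X n)\<lparr>carrier := moore_cycles X n\<rparr>" and ?ZY = "(Lev Y n)\<lparr>carrier := moore_cycles Y n\<rparr>"
  let ?BX = "moore_boundaries X n" and ?BY = "moore_boundaries Y n"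
  interpret ZX: group ?ZX by (rule LX.subgroup_imp_group[OF X.moore_cycles_subgroup])
  interpret ZY: group ?ZY by (rule LY.subgroup_imp_group[OF Y.moore_cycles_subgroup])
  interpret BY: normal ?BY ?ZY by (rule Y.moore_boundaries_normal)
  have fh: "f n \<in> hom (Lev X n) (Lev Y n)" using assms(3) by (simp add: semisimplicial_hom_def)
  have "f n \<in> hom ?ZX ?ZY"
    using semisimplicial_hom_cycles[OF assms(1-3)] hom_mult[OF fh] X.moore_cycles_carrier
    by (intro homI) auto
  from hom_compose[OF this BY.r_coset_hom_Mod]
  have hom: "(\<lambda>z. ?BY #>\<^bsub>?ZY\<^esub> f n z) \<in> hom ?ZX (?ZY Mod ?BY)" by (simp add: comp_def)
  interpret h: group_hom ?ZX "?ZY Mod ?BY" "\<lambda>z. ?BY #>\<^bsub>?ZY\<^esub> f n z"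
    using hom BY.factorgroup_is_group by (simp add: group_hom_def group_hom_axioms_def ZX.is_group)
  have in_BY: "?BY #>\<^bsub>?ZY\<^esub> y = ?BY \<longleftrightarrow> y \<in> ?BY" if "y \<in> moore_cycles Y n" for y
    using that ZY.coset_join1[OF _ _ BY.is_subgroup, of y] ZY.coset_join2[OF _ BY.is_subgroup, of y] BY.subset
    by auto
  have "kernel ?ZX (?ZY Mod ?BY) (\<lambda>z. ?BY #>\<^bsub>?ZY\<^esub> f n z) = ?BX"
  proof (intro equalityI subsetI)
    fix z assume "z \<in> kernel ?ZX (?ZY Mod ?BY) (\<lambda>z. ?BY #>\<^bsub>?ZY\<^esub> f n z)"
    then have z: "z \<in> moore_cycles X n" and fz: "f n z \<in> ?BY"
      using in_BY semisimplicial_hom_cycles[OF assms(1-3)] by (auto simp: kernel_def FactGroup_def)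
    let ?w = "g n (f n z) \<otimes>\<^bsub>Lev X n\<^esub> inv\<^bsub>Lev X n\<^esub> z"
    have gfz: "g n (f n z) \<in> ?BX" by (rule semisimplicial_hom_boundaries[OF assms(2,1,4) fz])
    have c: "z \<in> carrier (Lev X n)" "g n (f n z) \<in> carrier (Lev X n)"
      using z gfz X.moore_cycles_carrier X.moore_boundaries_cycles by blast+
    have "inv\<^bsub>Lev X n\<^esub> ?w \<otimes>\<^bsub>Lev X n\<^esub> g n (f n z) \<in> ?BX"
      by (intro subgroup.m_closed[OF X.moore_boundaries_subgroup]
          subgroup.m_inv_closed[OF X.moore_boundaries_subgroup] gf z gfz)
    also have "inv\<^bsub>Lev X n\<^esub> ?w \<otimes>\<^bsub>Lev X n\<^esub> g n (f n z) = z"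
      using c by (simp add: LX.inv_mult_group LX.m_assoc)
    finally show "z \<in> ?BX" .
  next
    fix z assume z: "z \<in> ?BX"
    then have fz: "f n z \<in> ?BY" by (rule semisimplicial_hom_boundaries[OF assms(1-3)])
    then have "?BY #>\<^bsub>?ZY\<^esub> f n z = ?BY" using Y.moore_boundaries_cycles in_BY by blast
    then show "z \<in> kernel ?ZX (?ZY Mod ?BY) (\<lambda>z. ?BY #>\<^bsub>?ZY\<^esub> f n z)"
      using subsetD[OF X.moore_boundaries_cycles z] by (simp add: kernel_def FactGroup_def)
  qed
  moreover have "(\<lambda>z. ?BY #>\<^bsub>?ZY\<^esub> f n z) ` carrier ?ZX = carrier (?ZY Mod ?BY)"
  proof (intro equalityI subsetI)
    fix A assume "A \<in> carrier (?ZY Mod ?BY)"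
    then obtain y where y: "y \<in> moore_cycles Y n" and A: "A = ?BY #>\<^bsub>?ZY\<^esub> y"
      by (auto simp: FactGroup_def RCOSETS_def)
    have gy: "g n y \<in> moore_cycles X n" by (rule semisimplicial_hom_cycles[OF assms(2,1,4) y])
    have fgy: "f n (g n y) \<in> moore_cycles Y n" by (rule semisimplicial_hom_cycles[OF assms(1-3) gy])
    have c: "y \<in> carrier (Lev Y n)" "f n (g n y) \<in> carrier (Lev Y n)"
      using y fgy Y.moore_cycles_carrier by auto
    have "f n (g n y) = (f n (g n y) \<otimes>\<^bsub>Lev Y n\<^esub> inv\<^bsub>Lev Y n\<^esub> y) \<otimes>\<^bsub>Lev Y n\<^esub> y"
      using c by (simp add: LY.m_assoc)
    then have "f n (g n y) \<in> ?BY #>\<^bsub>?ZY\<^esub> y"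
      using fg[OF y] by (auto simp: r_coset_def)
    then have "?BY #>\<^bsub>?ZY\<^esub> f n (g n y) = A"
      using ZY.repr_independence[OF _ _ BY.is_subgroup] y A by auto
    then show "A \<in> (\<lambda>z. ?BY #>\<^bsub>?ZY\<^esub> f n z) ` carrier ?ZX" using gy by auto
  qed (use h.hom_closed in blast)
  ultimately show ?thesis
    unfolding homotopy_group_def using h.FactGroup_iso by simp
qed

text \<open>Levelwise inverses of a map that commutes with the faces commute with the faces themselves.\<close>

lemma homology_iso_of_level_iso:
  assumes "simplicial_group X" "simplicial_group Y" "semisimplicial_hom X Y f"
    and g: "\<And>n. g n \<in> hom (Lev Y n) (Lev X n)"
    and gf: "\<And>n x. x \<in> carrier (Lev X n) \<Longrightarrow> g n (f n x) = x"
    and fg: "\<And>n y. y \<in> carrier (Lev Y n) \<Longrightarrow> f n (g n y) = y"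
  shows "homotopy_group X n \<cong> homotopy_group Y n"
proof (rule homology_iso_of_inverse[OF assms(1-3)])
  interpret X: simplicial_group X by fact
  interpret Y: simplicial_group Y by fact
  have "Face X (Suc n) i (g (Suc n) y) = g n (Face Y (Suc n) i y)"
    if "i \<le> Suc n" "y \<in> carrier (Lev Y (Suc n))" for n i y
  proof -
    have gy: "g (Suc n) y \<in> carrier (Lev X (Suc n))" using hom_in_carrier[OF g that(2)] .
    have "g n (Face Y (Suc n) i (f (Suc n) (g (Suc n) y))) = g n (f n (Face X (Suc n) i (g (Suc n) y)))"
      using assms(3) that(1) gy by (simp add: semisimplicial_hom_def)
    then show ?thesis using that gy by (simp add: fg gf X.face_closed)
  qed
  then show "semisimplicial_hom Y X g" using g by (simp add: semisimplicial_hom_def)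
  show "homologous X n (g n (f n z)) z" if "z \<in> moore_cycles X n" for z
    using X.moore_cycles_carrier[OF that] subgroup.one_closed[OF X.moore_boundaries_subgroup]
    by (simp add: gf group.r_inv X.level_group)
  show "homologous Y n (f n (g n z)) z" if "z \<in> moore_cycles Y n" for z
    using Y.moore_cycles_carrier[OF that] subgroup.one_closed[OF Y.moore_boundaries_subgroup]
    by (simp add: fg group.r_inv Y.level_group)
qed

section \<open>Simplices of the nerve as functors\<close>

text \<open>An \<open>n\<close>-simplex of the nerve is a functor from the ordinal \<open>{0 < \<dots> < n}\<close>: vertices \<open>v i\<close> and arrows
  \<open>a i j : v i \<rightarrow> v j\<close> for all \<open>i \<le> j\<close>. In this form simplicial operators act by precomposition and functors by
  postcomposition, and the simplicial identities become identities between monotone maps of numbers.\<close>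

definition chain :: "('o, 'm) cat \<Rightarrow> nat \<Rightarrow> (nat \<Rightarrow> 'o) \<Rightarrow> (nat \<Rightarrow> nat \<Rightarrow> 'm) \<Rightarrow> bool" where
  "chain C n v a \<longleftrightarrow>
     (\<forall>i\<le>n. v i \<in> Ob C \<and> a i i = Idn C (v i)) \<and>
     (\<forall>i j. i \<le> j \<and> j \<le> n \<longrightarrow> a i j \<in> Ar C \<and> Dom C (a i j) = v i \<and> Cod C (a i j) = v j) \<and>
     (\<forall>i j k. i \<le> j \<and> j \<le> k \<and> k \<le> n \<longrightarrow> Cmp C (a j k) (a i j) = a i k)"

definition simplex_of :: "nat \<Rightarrow> (nat \<Rightarrow> 'o) \<Rightarrow> (nat \<Rightarrow> nat \<Rightarrow> 'm) \<Rightarrow> 'o \<times> 'm list" where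
  "simplex_of n v a = (v 0, map (\<lambda>k. a k (Suc k)) [0..<n])"

text \<open>The composite of the arrows of a simplex from its vertex \<open>i\<close> to its vertex \<open>j\<close>, for \<open>i \<le> j\<close>; an identity for
  \<open>i > j\<close>.\<close>

primrec span :: "('o, 'm) cat \<Rightarrow> 'o \<times> 'm list \<Rightarrow> nat \<Rightarrow> nat \<Rightarrow> 'm" where
  "span C \<sigma> i 0 = Idn C (nerve_vertex C 0 \<sigma>)"
| "span C \<sigma> i (Suc j) =
    (if i \<le> j then Cmp C (snd \<sigma> ! j) (span C \<sigma> i j) else Idn C (nerve_vertex C (Suc j) \<sigma>))"

lemma nerve_vertex_0: "nerve_vertex C 0 \<sigma> = fst \<sigma>"
  by (simp add: nerve_vertex_def case_prod_beta)

lemma nerve_vertex_Suc: "nerve_vertex C (Suc i) \<sigma> = Cod C (snd \<sigma> ! i)"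
  by (simp add: nerve_vertex_def case_prod_beta)

lemma span_refl: "span C \<sigma> i i = Idn C (nerve_vertex C i \<sigma>)"
  by (cases i) simp_all

lemma chainI:
  assumes "\<And>i. i \<le> n \<Longrightarrow> v i \<in> Ob C" "\<And>i. i \<le> n \<Longrightarrow> a i i = Idn C (v i)"
    and "\<And>i j. i \<le> j \<Longrightarrow> j \<le> n \<Longrightarrow> a i j \<in> Ar C"
    and "\<And>i j. i \<le> j \<Longrightarrow> j \<le> n \<Longrightarrow> Dom C (a i j) = v i"
    and "\<And>i j. i \<le> j \<Longrightarrow> j \<le> n \<Longrightarrow> Cod C (a i j) = v j"
    and "\<And>i j k. i \<le> j \<Longrightarrow> j \<le> k \<Longrightarrow> k \<le> n \<Longrightarrow> Cmp C (a j k) (a i j) = a i k"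
  shows "chain C n v a"
  using assms by (simp add: chain_def)

lemma chainD:
  assumes "chain C n v a"
  shows chain_vertex: "\<And>i. i \<le> n \<Longrightarrow> v i \<in> Ob C"
    and "\<And>i. i \<le> n \<Longrightarrow> a i i = Idn C (v i)"
    and "\<And>i j. i \<le> j \<Longrightarrow> j \<le> n \<Longrightarrow> a i j \<in> Ar C"
    and "\<And>i j. i \<le> j \<Longrightarrow> j \<le> n \<Longrightarrow> Dom C (a i j) = v i"
    and "\<And>i j. i \<le> j \<Longrightarrow> j \<le> n \<Longrightarrow> Cod C (a i j) = v j"
    and chain_cmp: "\<And>i j k. i \<le> j \<Longrightarrow> j \<le> k \<Longrightarrow> k \<le> n \<Longrightarrow> Cmp C (a j k) (a i j) = a i k"
  using assms by (auto simp: chain_def)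

lemma simplex_of_cong:
  assumes "v 0 = v' 0" "\<And>k. k < n \<Longrightarrow> a k (Suc k) = a' k (Suc k)"
  shows "simplex_of n v a = simplex_of n v' a'"
  using assms by (auto simp: simplex_of_def)

lemma (in category) composable_iff:
  "composable C c as \<longleftrightarrow> c \<in> Ob C \<and>
     (\<forall>k<length as. as ! k \<in> Ar C \<and> Dom C (as ! k) = nerve_vertex C k (c, as))"
proof (induction as arbitrary: c)
  case Nil
  then show ?case by simp
next
  case (Cons \<alpha> as)
  have v: "nerve_vertex C (Suc k) (c, \<alpha> # as) = nerve_vertex C k (Cod C \<alpha>, as)" for k
    by (simp add: nerve_vertex_def)
  show ?case
    unfolding composable.simps Cons.IH length_Cons All_less_Suc2
    by (auto simp: v nerve_vertex_0 cod_closed)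
qed

lemma (in category) nerve_iff:
  "\<sigma> \<in> nerve C n \<longleftrightarrow> length (snd \<sigma>) = n \<and> fst \<sigma> \<in> Ob C \<and>
     (\<forall>k<n. snd \<sigma> ! k \<in> Ar C \<and> Dom C (snd \<sigma> ! k) = nerve_vertex C k \<sigma>)"
  by (cases \<sigma>) (auto simp: nerve_def composable_iff)

lemma (in category) nerve_chain:
  assumes "\<sigma> \<in> nerve C n"
  shows "chain C n (\<lambda>i. nerve_vertex C i \<sigma>) (span C \<sigma>)"
proof -
  have s: "snd \<sigma> ! k \<in> Ar C" "Dom C (snd \<sigma> ! k) = nerve_vertex C k \<sigma>" if "k < n" for k
    using assms that by (auto simp: nerve_iff)
  have v: "nerve_vertex C i \<sigma> \<in> Ob C" if "i \<le> n" for i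
    using assms that by (cases i) (auto simp: nerve_iff nerve_vertex_0 nerve_vertex_Suc cod_closed)
  have a: "span C \<sigma> i j \<in> Ar C \<and> Dom C (span C \<sigma> i j) = nerve_vertex C i \<sigma> \<and>
      Cod C (span C \<sigma> i j) = nerve_vertex C j \<sigma>" if "i \<le> j" "j \<le> n" for i j
    using that
  proof (induction j)
    case 0
    then show ?case using v[of 0] by (simp add: idn_closed dom_idn cod_idn)
  next
    case (Suc j)
    show ?case
    proof (cases "i \<le> j")
      case True
      then show ?thesis
        using Suc s[of j] by (simp add: cmp_closed dom_cmp cod_cmp nerve_vertex_Suc)
    next
      case False
      then have "i = Suc j" using Suc.prems by simp
      then show ?thesis using v[of "Suc j"] Suc.prems by (simp add: idn_closed dom_idn cod_idn)
    qed
  qed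
  have c: "Cmp C (span C \<sigma> j k) (span C \<sigma> i j) = span C \<sigma> i k" if "i \<le> j" "j \<le> k" "k \<le> n" for i j k
    using that
  proof (induction k)
    case 0
    then show ?case using v[of 0] cmp_idn_left[of "Idn C (nerve_vertex C 0 \<sigma>)"]
      by (simp add: idn_closed cod_idn)
  next
    case (Suc k)
    show ?case
    proof (cases "j \<le> k")
      case True
      then show ?thesis
        using Suc s[of k] a[of i j] a[of j k] by (simp flip: cmp_assoc)
    next
      case False
      then have "j = Suc k" using Suc.prems by simp
      then show ?thesis
        using a[of i j] cmp_idn_left[of "span C \<sigma> i j"] Suc.prems span_refl[of C \<sigma> j] by simp
    qed
  qed
  show ?thesis
    using v a c by (intro chainI) (simp_all add: span_refl)
qed

lemma (in category) span_Suc: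
  assumes "\<sigma> \<in> nerve C n" "k < n"
  shows "span C \<sigma> k (Suc k) = snd \<sigma> ! k"
proof -
  have "snd \<sigma> ! k \<in> Ar C" "Dom C (snd \<sigma> ! k) = nerve_vertex C k \<sigma>"
    using assms by (auto simp: nerve_iff)
  then show ?thesis using cmp_idn_right[of "snd \<sigma> ! k"] by (simp add: span_refl)
qed

lemma (in category) simplex_of_nerve:
  assumes "\<sigma> \<in> nerve C n"
  shows "simplex_of n (\<lambda>i. nerve_vertex C i \<sigma>) (span C \<sigma>) = \<sigma>"
  using span_Suc[OF assms] assms
  by (cases \<sigma>) (auto simp: simplex_of_def nerve_vertex_0 nerve_iff intro!: nth_equalityI)

lemma vertex_simplex_of:
  assumes "chain C n v a" "i \<le> n"
  shows "nerve_vertex C i (simplex_of n v a) = v i"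
  using assms by (cases i) (simp_all add: simplex_of_def nerve_vertex_0 nerve_vertex_Suc chainD[OF assms(1)])

lemma (in category) simplex_of_in_nerve:
  assumes "chain C n v a"
  shows "simplex_of n v a \<in> nerve C n"
  using assms vertex_simplex_of[OF assms]
  by (simp add: nerve_iff chainD[OF assms]) (simp add: simplex_of_def chainD[OF assms])

lemma span_simplex_of:
  assumes "chain C n v a" "i \<le> j" "j \<le> n"
  shows "span C (simplex_of n v a) i j = a i j"
  using assms(2,3)
proof (induction j)
  case 0
  then show ?case using vertex_simplex_of[OF assms(1)] by (simp add: chainD[OF assms(1)])
next
  case (Suc j)
  show ?case
  proof (cases "i \<le> j")
    case True
    then show ?thesis
      using Suc chain_cmp[OF assms(1), of i j "Suc j"] by (simp add: simplex_of_def)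
  next
    case False
    then have "i = Suc j" using Suc.prems by simp
    then show ?thesis using vertex_simplex_of[OF assms(1)] Suc.prems by (simp add: chainD[OF assms(1)])
  qed
qed

definition simplex_operator :: "nat \<Rightarrow> nat \<Rightarrow> (nat \<Rightarrow> nat) \<Rightarrow> bool" where
  "simplex_operator m n \<mu> \<longleftrightarrow> (\<forall>j\<le>m. \<mu> j \<le> n) \<and> (\<forall>i j. i \<le> j \<and> j \<le> m \<longrightarrow> \<mu> i \<le> \<mu> j)"

lemma simplex_operatorD:
  assumes "simplex_operator m n \<mu>"
  shows "\<And>j. j \<le> m \<Longrightarrow> \<mu> j \<le> n" "\<And>i j. i \<le> j \<Longrightarrow> j \<le> m \<Longrightarrow> \<mu> i \<le> \<mu> j"
  using assms by (auto simp: simplex_operator_def)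

lemma simplex_operator_comp:
  "simplex_operator m n \<mu> \<Longrightarrow> simplex_operator l m \<nu> \<Longrightarrow> simplex_operator l n (\<lambda>k. \<mu> (\<nu> k))"
  by (simp add: simplex_operator_def)

lemma chain_reindex:
  assumes "chain C n v a" "simplex_operator m n \<mu>"
  shows "chain C m (\<lambda>i. v (\<mu> i)) (\<lambda>i j. a (\<mu> i) (\<mu> j))"
  by (intro chainI) (simp_all add: chainD[OF assms(1)] simplex_operatorD[OF assms(2)])

definition reindex :: "('o, 'm) cat \<Rightarrow> nat \<Rightarrow> (nat \<Rightarrow> nat) \<Rightarrow> 'o \<times> 'm list \<Rightarrow> 'o \<times> 'm list" where
  "reindex C m \<mu> \<sigma> = simplex_of m (\<lambda>i. nerve_vertex C (\<mu> i) \<sigma>) (\<lambda>i j. span C \<sigma> (\<mu> i) (\<mu> j))"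

definition coface :: "nat \<Rightarrow> nat \<Rightarrow> nat" where
  "coface i k = (if k < i then k else Suc k)"

definition codegeneracy :: "nat \<Rightarrow> nat \<Rightarrow> nat" where
  "codegeneracy i k = (if k \<le> i then k else k - 1)"

lemma simplex_operator_coface: "simplex_operator n (Suc n) (coface i)"
  by (auto simp: simplex_operator_def coface_def)

lemma simplex_operator_codegeneracy: "i \<le> n \<Longrightarrow> simplex_operator (Suc n) n (codegeneracy i)"
  by (auto simp: simplex_operator_def codegeneracy_def)

context category
begin

lemma
  assumes "\<sigma> \<in> nerve C n" "simplex_operator m n \<mu>"
  shows reindex_nerve: "reindex C m \<mu> \<sigma> \<in> nerve C m"
    and vertex_reindex: "\<And>i. i \<le> m \<Longrightarrow> nerve_vertex C i (reindex C m \<mu> \<sigma>) = nerve_vertex C (\<mu> i) \<sigma>"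
    and span_reindex: "\<And>i j. i \<le> j \<Longrightarrow> j \<le> m \<Longrightarrow> span C (reindex C m \<mu> \<sigma>) i j = span C \<sigma> (\<mu> i) (\<mu> j)"
proof -
  note chain = chain_reindex[OF nerve_chain[OF assms(1)] assms(2)]
  show "reindex C m \<mu> \<sigma> \<in> nerve C m"
    unfolding reindex_def by (rule simplex_of_in_nerve[OF chain])
  show "nerve_vertex C i (reindex C m \<mu> \<sigma>) = nerve_vertex C (\<mu> i) \<sigma>" if "i \<le> m" for i
    unfolding reindex_def by (rule vertex_simplex_of[OF chain that])
  show "span C (reindex C m \<mu> \<sigma>) i j = span C \<sigma> (\<mu> i) (\<mu> j)" if "i \<le> j" "j \<le> m" for i j
    unfolding reindex_def by (rule span_simplex_of[OF chain that])
qed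

lemma fst_reindex: "fst (reindex C m \<mu> \<sigma>) = nerve_vertex C (\<mu> 0) \<sigma>"
  by (simp add: reindex_def simplex_of_def)

lemma reindex_reindex:
  assumes "\<sigma> \<in> nerve C n" "simplex_operator m n \<mu>" "simplex_operator l m \<nu>"
  shows "reindex C l \<nu> (reindex C m \<mu> \<sigma>) = reindex C l (\<lambda>k. \<mu> (\<nu> k)) \<sigma>"
  unfolding reindex_def[of C l]
  by (intro simplex_of_cong)
    (simp_all add: vertex_reindex[OF assms(1,2)] span_reindex[OF assms(1,2)] simplex_operatorD[OF assms(3)])

lemma reindex_cong:
  assumes "\<And>k. k \<le> m \<Longrightarrow> \<mu> k = \<mu>' k"
  shows "reindex C m \<mu> \<sigma> = reindex C m \<mu>' \<sigma>"
  unfolding reindex_def using assms by (intro simplex_of_cong) simp_all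

lemma reindex_id:
  assumes "\<sigma> \<in> nerve C n"
  shows "reindex C n (\<lambda>k. k) \<sigma> = \<sigma>"
  using simplex_of_nerve[OF assms] by (simp add: reindex_def)

lemma nerve_face_reindex:
  assumes \<sigma>: "\<sigma> \<in> nerve C (Suc n)" and i: "i \<le> Suc n"
  shows "nerve_face C i \<sigma> = reindex C n (coface i) \<sigma>"
proof -
  obtain c as where s: "\<sigma> = (c, as)" by (cases \<sigma>)
  have len: "length as = Suc n" using \<sigma> by (simp add: s nerve_iff)
  note span1 = span_Suc[OF \<sigma>, unfolded s snd_conv]
  have span2: "span C (c, as) k (Suc (Suc k)) = Cmp C (as ! Suc k) (as ! k)" if "k < n" for k
    using span1[of k] that by simp
  consider "i = 0" | "i = Suc n" "i \<noteq> 0" | "0 < i" "i \<le> n" using i by linarith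
  then show ?thesis
  proof cases
    case 1
    have "as ! 0 = hd as" using len by (cases as) auto
    then show ?thesis using 1 len span1
      by (auto simp: s nerve_face_def reindex_def simplex_of_def coface_def nerve_vertex_Suc nth_tl
          simp del: span.simps intro!: nth_equalityI)
  next
    case 2
    then show ?thesis using len span1
      by (auto simp: s nerve_face_def reindex_def simplex_of_def coface_def nerve_vertex_0 nth_butlast
          simp del: span.simps intro!: nth_equalityI)
  next
    case 3
    have "take (i - 1) as @ [Cmp C (as ! i) (as ! (i - 1))] @ drop (i + 1) as
        = map (\<lambda>k. span C (c, as) (coface i k) (coface i (Suc k))) [0..<n]"
    proof (rule nth_equalityI)
      fix k assume "k < length (take (i - 1) as @ [Cmp C (as ! i) (as ! (i - 1))] @ drop (i + 1) as)"
      then have k: "k < n" using 3 len by simp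
      have map: "map (\<lambda>k. span C (c, as) (coface i k) (coface i (Suc k))) [0..<n] ! k
          = span C (c, as) (coface i k) (coface i (Suc k))"
        using k by simp
      consider "k < i - 1" | "k = i - 1" | "k \<ge> i" by linarith
      then show "(take (i - 1) as @ [Cmp C (as ! i) (as ! (i - 1))] @ drop (i + 1) as) ! k
          = map (\<lambda>k. span C (c, as) (coface i k) (coface i (Suc k))) [0..<n] ! k"
      proof cases
        case 1
        then have "Suc k < i" "k < i - 1" by linarith+
        then show ?thesis unfolding map using k 3 len span1[of k]
          by (simp add: nth_append coface_def del: span.simps)
      next
        case 2
        then have "Suc k = i" using 3 by simp
        then show ?thesis unfolding map using k 3 len span2[of k]
          by (auto simp add: nth_append coface_def simp del: span.simps)
      next
        case ge: 3
        then have "\<not> k < i - 1" "k - (i - 1) = Suc (k - i)" using 3 by auto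
        then show ?thesis unfolding map using k 3 ge len span1[of "Suc k"]
          by (simp add: nth_append coface_def del: span.simps)
      qed
    qed (use 3 len in simp)
    then show ?thesis using 3 len
      by (simp add: s nerve_face_def reindex_def simplex_of_def coface_def nerve_vertex_0 del: span.simps)
  qed
qed

lemma nerve_degen_reindex:
  assumes \<sigma>: "\<sigma> \<in> nerve C n" and i: "i \<le> n"
  shows "nerve_degen C i \<sigma> = reindex C (Suc n) (codegeneracy i) \<sigma>"
proof -
  obtain c as where s: "\<sigma> = (c, as)" by (cases \<sigma>)
  have len: "length as = n" using \<sigma> by (simp add: s nerve_iff)
  note span1 = span_Suc[OF \<sigma>, unfolded s snd_conv]
  have "take i as @ [Idn C (nerve_vertex C i (c, as))] @ drop i as
      = map (\<lambda>k. span C (c, as) (codegeneracy i k) (codegeneracy i (Suc k))) [0..<Suc n]"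
  proof (rule nth_equalityI)
    fix k assume "k < length (take i as @ [Idn C (nerve_vertex C i (c, as))] @ drop i as)"
    then have k: "k < Suc n" using i len by simp
    have map: "map (\<lambda>k. span C (c, as) (codegeneracy i k) (codegeneracy i (Suc k))) [0..<Suc n] ! k
        = span C (c, as) (codegeneracy i k) (codegeneracy i (Suc k))"
      using k by (simp del: upt_Suc)
    consider "k < i" | "k = i" | "k > i" by linarith
    then show "(take i as @ [Idn C (nerve_vertex C i (c, as))] @ drop i as) ! k
        = map (\<lambda>k. span C (c, as) (codegeneracy i k) (codegeneracy i (Suc k))) [0..<Suc n] ! k"
    proof cases
      case 1
      then show ?thesis unfolding map using k i len span1[of k]
        by (simp add: nth_append codegeneracy_def del: span.simps)
    next
      case 2
      then show ?thesis unfolding map using k i len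
        by (simp add: nth_append codegeneracy_def span_refl del: span.simps)
    next
      case 3
      then have "k - i = Suc (k - Suc i)" by auto
      then show ?thesis unfolding map using k i 3 len span1[of "k - 1"]
        by (simp add: nth_append codegeneracy_def del: span.simps)
    qed
  qed (use i len in simp)
  then show ?thesis using len
    by (simp add: s nerve_degen_def reindex_def simplex_of_def codegeneracy_def nerve_vertex_0 del: span.simps upt_Suc)
qed

end

section \<open>The simplicial replacement as a simplicial group\<close>

lemma hom_cong:
  assumes "f \<in> hom A B" "group A" "\<And>x. x \<in> carrier A \<Longrightarrow> f' x = f x"
  shows "f' \<in> hom A B"
  using assms by (auto simp: hom_def Pi_iff group.is_monoid monoid.m_closed)

abbreviation simplex_factor :: "('o, 'm, 'g) diagram \<Rightarrow> 'o \<times> 'm list \<Rightarrow> 'g monoid" where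
  "simplex_factor G \<equiv> \<lambda>\<sigma>. GOb G (fst \<sigma>)"

lemma Lev_simplicial_replacement:
  "Lev (simplicial_replacement C G) n = free_product (nerve C n) (simplex_factor G)"
  by (simp add: simplicial_replacement_def Let_def)

locale category_diagram = category C + group_diagram C G
  for C :: "('o, 'm) cat" and G :: "('o, 'm, 'g) diagram"
begin

lemma nerve_group_family: "group_family (nerve C n) (simplex_factor G)"
  by (rule group_family.intro) (auto simp: nerve_iff gob_group)

lemma replacement_level_group: "group (Lev (simplicial_replacement C G) n)"
  using group_family.free_product_group[OF nerve_group_family] by (simp add: Lev_simplicial_replacement)

lemma replacement_hom_eqI:
  assumes "group H" "a \<in> hom (Lev (simplicial_replacement C G) n) H" "b \<in> hom (Lev (simplicial_replacement C G) n) H"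
    and "\<And>\<sigma> x. \<sigma> \<in> nerve C n \<Longrightarrow> x \<in> carrier (GOb G (fst \<sigma>)) \<Longrightarrow>
      a (fp_in (nerve C n) (simplex_factor G) \<sigma> x) = b (fp_in (nerve C n) (simplex_factor G) \<sigma> x)"
    and "A \<in> carrier (Lev (simplicial_replacement C G) n)"
  shows "a A = b A"
  using group_family.free_product_hom_eqI[OF nerve_group_family assms(1), of a n b A] assms(2-)
  by (simp add: Lev_simplicial_replacement)

lemma span_hom:
  assumes "\<sigma> \<in> nerve C n" "i \<le> j" "j \<le> n"
  shows "GAr G (span C \<sigma> i j) \<in> hom (GOb G (nerve_vertex C i \<sigma>)) (GOb G (nerve_vertex C j \<sigma>))"
  using gar_hom[of "span C \<sigma> i j"] chainD[OF nerve_chain[OF assms(1)]] assms(2,3) by simp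

lemma span_span:
  assumes "\<sigma> \<in> nerve C n" "i \<le> j" "j \<le> k" "k \<le> n" "x \<in> carrier (GOb G (nerve_vertex C i \<sigma>))"
  shows "GAr G (span C \<sigma> j k) (GAr G (span C \<sigma> i j) x) = GAr G (span C \<sigma> i k) x"
  using gar_cmp[of "span C \<sigma> i j" "span C \<sigma> j k" x] chainD[OF nerve_chain[OF assms(1)]] assms(2-) by simp

lemma span_same:
  assumes "\<sigma> \<in> nerve C n" "i \<le> n" "x \<in> carrier (GOb G (nerve_vertex C i \<sigma>))"
  shows "GAr G (span C \<sigma> i i) x = x"
  using gar_idn chainD[OF nerve_chain[OF assms(1)]] assms(2-) by simp

text \<open>The action of a monotone map \<open>\<mu>\<close> on the simplicial replacement: the group element is transported along the
  simplex from its vertex \<open>0\<close> to the new initial vertex \<open>\<mu> 0\<close>. Of the face operators, only the \<open>0\<close>-th has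
  \<open>\<mu> 0 \<noteq> 0\<close>, which accounts for its special form.\<close>

definition operate :: "nat \<Rightarrow> (nat \<Rightarrow> nat) \<Rightarrow> (('o \<times> 'm list) \<times> 'g) list set \<Rightarrow> (('o \<times> 'm list) \<times> 'g) list set" where
  "operate m \<mu> = fp_map (nerve C m) (simplex_factor G) (reindex C m \<mu>) (\<lambda>\<sigma>. GAr G (span C \<sigma> 0 (\<mu> 0)))"

lemma operate_factor_map:
  assumes "simplex_operator m n \<mu>"
  shows "factor_map (nerve C n) (simplex_factor G) (nerve C m) (simplex_factor G)
    (reindex C m \<mu>) (\<lambda>\<sigma>. GAr G (span C \<sigma> 0 (\<mu> 0)))"
  using span_hom[of _ n 0 "\<mu> 0"] simplex_operatorD[OF assms] reindex_nerve[OF _ assms]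
  by (simp add: factor_map_def nerve_vertex_0 fst_reindex)

lemma operate_hom:
  assumes "simplex_operator m n \<mu>"
  shows "operate m \<mu> \<in> hom (Lev (simplicial_replacement C G) n) (Lev (simplicial_replacement C G) m)"
  unfolding operate_def Lev_simplicial_replacement
  by (rule fp_map_hom[OF nerve_group_family nerve_group_family operate_factor_map[OF assms]])

text \<open>Contravariance in the monotone map; all simplicial identities are instances of it.\<close>

lemma operate_operate:
  assumes \<mu>: "simplex_operator m n \<mu>" and \<nu>: "simplex_operator l m \<nu>"
    and A: "A \<in> carrier (Lev (simplicial_replacement C G) n)"
  shows "operate l \<nu> (operate m \<mu> A) = operate l (\<lambda>k. \<mu> (\<nu> k)) A"
  unfolding operate_def
proof (rule fp_map_comp[OF nerve_group_family nerve_group_family nerve_group_family operate_factor_map[OF \<mu>]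
      operate_factor_map[OF \<nu>] operate_factor_map[OF simplex_operator_comp[OF \<mu> \<nu>]]])
  fix \<sigma> assume \<sigma>: "\<sigma> \<in> nerve C n"
  show "reindex C l \<nu> (reindex C m \<mu> \<sigma>) = reindex C l (\<lambda>k. \<mu> (\<nu> k)) \<sigma>"
    by (rule reindex_reindex[OF \<sigma> \<mu> \<nu>])
  show "GAr G (span C (reindex C m \<mu> \<sigma>) 0 (\<nu> 0)) (GAr G (span C \<sigma> 0 (\<mu> 0)) x) = GAr G (span C \<sigma> 0 (\<mu> (\<nu> 0))) x"
    if "x \<in> carrier (GOb G (fst \<sigma>))" for x
    using that span_span[OF \<sigma>, of 0 "\<mu> 0" "\<mu> (\<nu> 0)" x] simplex_operatorD[OF \<mu>] simplex_operatorD[OF \<nu>]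
    by (simp add: span_reindex[OF \<sigma> \<mu>] nerve_vertex_0)
qed (use A in \<open>simp add: Lev_simplicial_replacement\<close>)

lemma operate_cong:
  assumes "\<And>k. k \<le> m \<Longrightarrow> \<mu> k = \<mu>' k"
  shows "operate m \<mu> = operate m \<mu>'"
proof -
  have "reindex C m \<mu> = reindex C m \<mu>'" by (rule ext) (rule reindex_cong[OF assms])
  then show ?thesis using assms[of 0] by (simp add: operate_def)
qed

lemma operate_id:
  assumes A: "A \<in> carrier (Lev (simplicial_replacement C G) n)"
  shows "operate n (\<lambda>k. k) A = A"
proof -
  have id: "simplex_operator n n (\<lambda>k. k)" by (simp add: simplex_operator_def)
  have "operate n (\<lambda>k. k) A = (\<lambda>A. A) A"
  proof (rule replacement_hom_eqI[OF replacement_level_group operate_hom[OF id] _ _ A])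
    fix \<sigma> x assume *: "\<sigma> \<in> nerve C n" "x \<in> carrier (GOb G (fst \<sigma>))"
    then show "operate n (\<lambda>k. k) (fp_in (nerve C n) (simplex_factor G) \<sigma> x) = fp_in (nerve C n) (simplex_factor G) \<sigma> x"
      using span_same[OF *(1), of 0 x] fp_map_in[OF nerve_group_family nerve_group_family operate_factor_map[OF id] *]
      by (simp add: operate_def reindex_id nerve_vertex_0)
  qed (simp add: hom_def)
  then show ?thesis by simp
qed

lemma face_operate:
  assumes i: "i \<le> Suc n" and A: "A \<in> carrier (Lev (simplicial_replacement C G) (Suc n))"
  shows "Face (simplicial_replacement C G) (Suc n) i A = operate n (coface i) A"
proof -
  have "Face (simplicial_replacement C G) (Suc n) i A = fp_map (nerve C n) (simplex_factor G)
      (nerve_face C i) (\<lambda>\<sigma> x. if i = 0 then GAr G (hd (snd \<sigma>)) x else x) A"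
    by (simp add: simplicial_replacement_def Let_def fp_map_def)
  also have "\<dots> = operate n (coface i) A"
    unfolding operate_def
  proof (rule fp_map_cong[OF nerve_group_family nerve_group_family operate_factor_map[OF simplex_operator_coface]])
    fix \<sigma> assume \<sigma>: "\<sigma> \<in> nerve C (Suc n)"
    show "nerve_face C i \<sigma> = reindex C n (coface i) \<sigma>" by (rule nerve_face_reindex[OF \<sigma> i])
    fix x assume x: "x \<in> carrier (GOb G (fst \<sigma>))"
    have "hd (snd \<sigma>) = snd \<sigma> ! 0" using \<sigma> by (cases "snd \<sigma>") (auto simp: nerve_iff)
    then show "(if i = 0 then GAr G (hd (snd \<sigma>)) x else x) = GAr G (span C \<sigma> 0 (coface i 0)) x"
      using span_Suc[OF \<sigma>, of 0] span_same[OF \<sigma>, of 0 x] x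
      by (simp add: coface_def nerve_vertex_0 del: span.simps)
  qed (use A in \<open>simp add: Lev_simplicial_replacement\<close>)
  finally show ?thesis .
qed

lemma dgn_operate:
  assumes i: "i \<le> n" and A: "A \<in> carrier (Lev (simplicial_replacement C G) n)"
  shows "Dgn (simplicial_replacement C G) n i A = operate (Suc n) (codegeneracy i) A"
proof -
  have "Dgn (simplicial_replacement C G) n i A
      = fp_map (nerve C (Suc n)) (simplex_factor G) (nerve_degen C i) (\<lambda>\<sigma> x. x) A"
    by (simp add: simplicial_replacement_def Let_def fp_map_def)
  also have "\<dots> = operate (Suc n) (codegeneracy i) A"
    unfolding operate_def
  proof (rule fp_map_cong[OF nerve_group_family nerve_group_family
        operate_factor_map[OF simplex_operator_codegeneracy[OF i]]])
    fix \<sigma> assume \<sigma>: "\<sigma> \<in> nerve C n"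
    show "nerve_degen C i \<sigma> = reindex C (Suc n) (codegeneracy i) \<sigma>" by (rule nerve_degen_reindex[OF \<sigma> i])
    show "x = GAr G (span C \<sigma> 0 (codegeneracy i 0)) x" if "x \<in> carrier (GOb G (fst \<sigma>))" for x
      using that span_same[OF \<sigma>, of 0 x] by (simp add: codegeneracy_def nerve_vertex_0)
  qed (use A in \<open>simp add: Lev_simplicial_replacement\<close>)
  finally show ?thesis .
qed

lemma operate_closed:
  "simplex_operator m n \<mu> \<Longrightarrow> A \<in> carrier (Lev (simplicial_replacement C G) n) \<Longrightarrow>
    operate m \<mu> A \<in> carrier (Lev (simplicial_replacement C G) m)"
  by (rule hom_in_carrier[OF operate_hom])

lemma simplicial_group_replacement: "simplicial_group (simplicial_replacement C G)"
proof (rule simplicial_group.intro)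
  let ?X = "simplicial_replacement C G"
  note [simp] = face_operate dgn_operate operate_closed[OF simplex_operator_coface]
    operate_closed[OF simplex_operator_codegeneracy] simplex_operator_coface simplex_operator_codegeneracy
  show "group (Lev ?X n)" for n by (rule replacement_level_group)
  show "Face ?X (Suc n) i \<in> hom (Lev ?X (Suc n)) (Lev ?X n)" if "i \<le> Suc n" for n i
    by (rule hom_cong[OF operate_hom[OF simplex_operator_coface] replacement_level_group]) (use that in simp)
  show "Dgn ?X n i \<in> hom (Lev ?X n) (Lev ?X (Suc n))" if "i \<le> n" for n i
    by (rule hom_cong[OF operate_hom[OF simplex_operator_codegeneracy] replacement_level_group]) (use that in simp_all)
  have coface: "operate m (coface i) (operate (Suc m) \<mu> x) = operate m (\<lambda>k. \<mu> (coface i k)) x"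
    if "simplex_operator (Suc m) n \<mu>" "x \<in> carrier (Lev ?X n)" for m n i \<mu> x
    by (rule operate_operate[OF that(1) simplex_operator_coface that(2)])
  have codeg: "operate (Suc m) (codegeneracy i) (operate m \<mu> x) = operate (Suc m) (\<lambda>k. \<mu> (codegeneracy i k)) x"
    if "simplex_operator m n \<mu>" "x \<in> carrier (Lev ?X n)" "i \<le> m" for m n i \<mu> x
    by (rule operate_operate[OF that(1) simplex_operator_codegeneracy[OF that(3)] that(2)])
  note [simp] = coface[OF simplex_operator_coface] coface[OF simplex_operator_codegeneracy]
    codeg[OF simplex_operator_coface] codeg[OF simplex_operator_codegeneracy]
  show "Face ?X (Suc n) i (Face ?X (Suc (Suc n)) j x) = Face ?X (Suc n) (j - 1) (Face ?X (Suc (Suc n)) i x)"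
    if "i < j" "j \<le> Suc (Suc n)" "x \<in> carrier (Lev ?X (Suc (Suc n)))" for i j n x
  proof -
    have "operate n (\<lambda>k. coface j (coface i k)) x = operate n (\<lambda>k. coface i (coface (j - 1) k)) x"
      by (rule fun_cong[OF operate_cong]) (use that in \<open>auto simp: coface_def\<close>)
    then show ?thesis using that by simp
  qed
  show "Face ?X (Suc (Suc n)) i (Dgn ?X (Suc n) j x) = Dgn ?X n (j - 1) (Face ?X (Suc n) i x)"
    if "i < j" "j \<le> Suc n" "x \<in> carrier (Lev ?X (Suc n))" for i j n x
  proof -
    have "operate (Suc n) (\<lambda>k. codegeneracy j (coface i k)) x = operate (Suc n) (\<lambda>k. coface i (codegeneracy (j - 1) k)) x"
      by (rule fun_cong[OF operate_cong]) (use that in \<open>auto simp: coface_def codegeneracy_def\<close>)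
    then show ?thesis using that by simp
  qed
  show "Face ?X (Suc n) i (Dgn ?X n j x) = x"
    if "j \<le> n" "i = j \<or> i = Suc j" "x \<in> carrier (Lev ?X n)" for i j n x
  proof -
    have "Face ?X (Suc n) i (Dgn ?X n j x) = operate n (\<lambda>k. codegeneracy j (coface i k)) x"
      using that(1,3) le_SucI[of i n] that(2) by (cases "i = j") simp_all
    also have "\<dots> = operate n (\<lambda>k. k) x"
      by (rule fun_cong[OF operate_cong]) (use that(2) in \<open>auto simp: coface_def codegeneracy_def\<close>)
    also have "\<dots> = x" by (rule operate_id[OF that(3)])
    finally show ?thesis .
  qed
  show "Face ?X (Suc (Suc n)) i (Dgn ?X (Suc n) j x) = Dgn ?X n j (Face ?X (Suc n) (i - 1) x)"
    if "Suc j < i" "i \<le> Suc (Suc n)" "x \<in> carrier (Lev ?X (Suc n))" for i j n x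
  proof -
    have "operate (Suc n) (\<lambda>k. codegeneracy j (coface i k)) x = operate (Suc n) (\<lambda>k. coface (i - 1) (codegeneracy j k)) x"
      by (rule fun_cong[OF operate_cong]) (use that in \<open>auto simp: coface_def codegeneracy_def\<close>)
    then show ?thesis using that by simp
  qed
  show "Dgn ?X (Suc n) i (Dgn ?X n j x) = Dgn ?X (Suc n) (Suc j) (Dgn ?X n i x)"
    if "i \<le> j" "j \<le> n" "x \<in> carrier (Lev ?X n)" for i j n x
  proof -
    have "operate (Suc (Suc n)) (\<lambda>k. codegeneracy j (codegeneracy i k)) x
        = operate (Suc (Suc n)) (\<lambda>k. codegeneracy i (codegeneracy (Suc j) k)) x"
      by (rule fun_cong[OF operate_cong]) (use that in \<open>auto simp: codegeneracy_def\<close>)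
    then show ?thesis using that by simp
  qed
qed

end

section \<open>Natural transformations induce homotopies\<close>

definition replacement_map :: "('p, 'q) cat \<Rightarrow> ('p, 'q, 'h) diagram \<Rightarrow> ('o, 'm, 'p, 'q) funct \<Rightarrow> ('o \<Rightarrow> 'g \<Rightarrow> 'h)
    \<Rightarrow> nat \<Rightarrow> (('o \<times> 'm list) \<times> 'g) list set \<Rightarrow> (('p \<times> 'q list) \<times> 'h) list set" where
  "replacement_map D H F \<tau> n = fp_map (nerve D n) (simplex_factor H)
     (\<lambda>\<sigma>. (FOb F (fst \<sigma>), map (FAr F) (snd \<sigma>))) (\<lambda>\<sigma>. \<tau> (fst \<sigma>))"

locale natural_transformation = F: cat_functor C D F + F': cat_functor C D F'
  for C :: "('o, 'm) cat" and D :: "('p, 'q) cat" and F F' :: "('o, 'm, 'p, 'q) funct" +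
  fixes \<theta> :: "'o \<Rightarrow> 'q"
  assumes component_closed: "c \<in> Ob C \<Longrightarrow> \<theta> c \<in> Ar D"
    and component_dom: "c \<in> Ob C \<Longrightarrow> Dom D (\<theta> c) = FOb F c"
    and component_cod: "c \<in> Ob C \<Longrightarrow> Cod D (\<theta> c) = FOb F' c"
    and naturality: "f \<in> Ar C \<Longrightarrow> Cmp D (\<theta> (Cod C f)) (FAr F f) = Cmp D (FAr F' f) (\<theta> (Dom C f))"

text \<open>A natural transformation \<open>\<theta> : F \<rightarrow> F'\<close> compatible with the maps of coefficients \<open>\<tau>\<close> and \<open>\<tau>'\<close> is a
  functor from the cylinder \<open>C \<times> {False < True}\<close>, given on objects by \<open>cyl_ob\<close> and on the arrow \<open>(f, u \<le> v)\<close> by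
  \<open>cyl_arr u v f\<close>, together with a map \<open>cyl_map\<close> of the coefficients. A monotone \<open>\<mu>\<close> together with a monotone
  \<open>\<epsilon>\<close> with boolean values takes a simplex of \<open>C\<close> to a simplex of the cylinder. Constant \<open>\<epsilon>\<close> gives the maps
  induced by \<open>F\<close> and \<open>F'\<close>, and letting \<open>\<epsilon>\<close> jump at the repeated vertex of a degeneracy gives the homotopy.\<close>

locale diagram_homotopy =
  C: category_diagram C G + D: category_diagram D H + natural_transformation C D F F' \<theta>
  for C :: "('o, 'm) cat" and G :: "('o, 'm, 'g) diagram" and D :: "('p, 'q) cat" and H :: "('p, 'q, 'h) diagram"
    and F F' :: "('o, 'm, 'p, 'q) funct" and \<theta> :: "'o \<Rightarrow> 'q" +
  fixes \<tau> \<tau>' :: "'o \<Rightarrow> 'g \<Rightarrow> 'h"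
  assumes \<tau>: "diagram_map C G (diagram_comp H F) \<tau>"
    and \<tau>': "diagram_map C G (diagram_comp H F') \<tau>'"
    and \<tau>_compat: "c \<in> Ob C \<Longrightarrow> x \<in> carrier (GOb G c) \<Longrightarrow> GAr H (\<theta> c) (\<tau> c x) = \<tau>' c x"
begin

definition cyl_ob :: "bool \<Rightarrow> 'o \<Rightarrow> 'p" where
  "cyl_ob u c = (if u then FOb F' c else FOb F c)"

definition cyl_arr :: "bool \<Rightarrow> bool \<Rightarrow> 'm \<Rightarrow> 'q" where
  "cyl_arr u v f = (if u then FAr F' f else if v then Cmp D (FAr F' f) (\<theta> (Dom C f)) else FAr F f)"

definition cyl_map :: "bool \<Rightarrow> 'o \<Rightarrow> 'g \<Rightarrow> 'h" where
  "cyl_map u c = (if u then \<tau>' c else \<tau> c)"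

lemma cyl_ob_closed: "c \<in> Ob C \<Longrightarrow> cyl_ob u c \<in> Ob D"
  by (simp add: cyl_ob_def F.fob_closed F'.fob_closed)

lemma cyl_arr_closed:
  assumes "f \<in> Ar C" "u \<longrightarrow> v"
  shows "cyl_arr u v f \<in> Ar D" "Dom D (cyl_arr u v f) = cyl_ob u (Dom C f)"
    "Cod D (cyl_arr u v f) = cyl_ob v (Cod C f)"
  using assms
  by (auto simp: cyl_arr_def cyl_ob_def F.far_closed F'.far_closed F.dom_far F'.dom_far F.cod_far F'.cod_far
      component_closed component_dom component_cod C.dom_closed D.cmp_closed D.dom_cmp D.cod_cmp)

lemma cyl_arr_idn: "c \<in> Ob C \<Longrightarrow> cyl_arr u u (Idn C c) = Idn D (cyl_ob u c)"
  by (simp add: cyl_arr_def cyl_ob_def F.far_idn F'.far_idn)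

text \<open>When the jump occurs in the second arrow, naturality of \<open>\<theta>\<close> moves it in front of the first.\<close>

lemma cyl_arr_cmp:
  assumes "f \<in> Ar C" "g \<in> Ar C" "Cod C f = Dom C g" "u \<longrightarrow> v" "v \<longrightarrow> w"
  shows "Cmp D (cyl_arr v w g) (cyl_arr u v f) = cyl_arr u w (Cmp C g f)"
proof -
  note [simp] = F.far_closed F'.far_closed F.dom_far F'.dom_far F.cod_far F'.cod_far
      component_closed component_dom component_cod C.dom_closed C.cod_closed D.cmp_closed D.dom_cmp D.cod_cmp
      F.far_cmp F'.far_cmp C.dom_cmp
  consider "u" | "\<not> u" "v" | "\<not> u" "\<not> v" "w" | "\<not> u" "\<not> v" "\<not> w" by blast
  then show ?thesis
  proof cases
    case 1
    then show ?thesis using assms by (simp add: cyl_arr_def)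
  next
    case 2
    then show ?thesis using assms D.cmp_assoc[of "\<theta> (Dom C f)" "FAr F' f" "FAr F' g"]
      by (simp add: cyl_arr_def)
  next
    case 3
    have "Cmp D (Cmp D (FAr F' g) (\<theta> (Dom C g))) (FAr F f)
        = Cmp D (FAr F' g) (Cmp D (\<theta> (Cod C f)) (FAr F f))"
      using assms D.cmp_assoc[of "FAr F f" "\<theta> (Dom C g)" "FAr F' g"] by simp
    also have "\<dots> = Cmp D (Cmp D (FAr F' g) (FAr F' f)) (\<theta> (Dom C f))"
      using assms naturality[of f] D.cmp_assoc[of "\<theta> (Dom C f)" "FAr F' f" "FAr F' g"] by simp
    finally show ?thesis using 3 assms by (simp add: cyl_arr_def)
  next
    case 4
    then show ?thesis using assms by (simp add: cyl_arr_def)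
  qed
qed

lemma cyl_map_hom: "c \<in> Ob C \<Longrightarrow> cyl_map u c \<in> hom (GOb G c) (GOb H (cyl_ob u c))"
  using \<tau> \<tau>' by (simp add: cyl_map_def cyl_ob_def diagram_map_def diagram_comp_def)

lemma cyl_map_natural:
  assumes "f \<in> Ar C" "u \<longrightarrow> v" "x \<in> carrier (GOb G (Dom C f))"
  shows "GAr H (cyl_arr u v f) (cyl_map u (Dom C f) x) = cyl_map v (Cod C f) (GAr G f x)"
proof -
  have n: "GAr H (FAr F f) (\<tau> (Dom C f) x) = \<tau> (Cod C f) (GAr G f x)"
    "GAr H (FAr F' f) (\<tau>' (Dom C f) x) = \<tau>' (Cod C f) (GAr G f x)"
    using \<tau> \<tau>' assms by (simp_all add: diagram_map_def diagram_comp_def)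
  have "\<tau> (Dom C f) x \<in> carrier (GOb H (FOb F (Dom C f)))"
    using cyl_map_hom[of "Dom C f" False] assms hom_in_carrier
    by (auto simp: cyl_map_def cyl_ob_def C.dom_closed)
  then have "GAr H (Cmp D (FAr F' f) (\<theta> (Dom C f))) (\<tau> (Dom C f) x)
      = GAr H (FAr F' f) (GAr H (\<theta> (Dom C f)) (\<tau> (Dom C f) x))"
    using assms by (intro D.gar_cmp)
      (simp_all add: component_closed component_dom component_cod F'.far_closed F'.dom_far C.dom_closed)
  then show ?thesis using assms n by (simp add: cyl_arr_def cyl_map_def \<tau>_compat C.dom_closed)
qed

definition cyl_operator :: "nat \<Rightarrow> nat \<Rightarrow> (nat \<Rightarrow> nat) \<Rightarrow> (nat \<Rightarrow> bool) \<Rightarrow> bool" where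
  "cyl_operator m n \<mu> \<epsilon> \<longleftrightarrow> simplex_operator m n \<mu> \<and> (\<forall>i j. i \<le> j \<and> j \<le> m \<longrightarrow> \<epsilon> i \<longrightarrow> \<epsilon> j)"

definition cyl_simplex :: "nat \<Rightarrow> (nat \<Rightarrow> nat) \<Rightarrow> (nat \<Rightarrow> bool) \<Rightarrow> 'o \<times> 'm list \<Rightarrow> 'p \<times> 'q list" where
  "cyl_simplex m \<mu> \<epsilon> \<sigma> = simplex_of m (\<lambda>i. cyl_ob (\<epsilon> i) (nerve_vertex C (\<mu> i) \<sigma>))
     (\<lambda>i j. cyl_arr (\<epsilon> i) (\<epsilon> j) (span C \<sigma> (\<mu> i) (\<mu> j)))"

lemma
  assumes "\<sigma> \<in> nerve C n" "cyl_operator m n \<mu> \<epsilon>"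
  shows cyl_simplex_nerve: "cyl_simplex m \<mu> \<epsilon> \<sigma> \<in> nerve D m"
    and vertex_cyl_simplex: "\<And>i. i \<le> m \<Longrightarrow>
      nerve_vertex D i (cyl_simplex m \<mu> \<epsilon> \<sigma>) = cyl_ob (\<epsilon> i) (nerve_vertex C (\<mu> i) \<sigma>)"
    and span_cyl_simplex: "\<And>i j. i \<le> j \<Longrightarrow> j \<le> m \<Longrightarrow>
      span D (cyl_simplex m \<mu> \<epsilon> \<sigma>) i j = cyl_arr (\<epsilon> i) (\<epsilon> j) (span C \<sigma> (\<mu> i) (\<mu> j))"
proof -
  have \<mu>: "simplex_operator m n \<mu>" and \<epsilon>: "\<And>i j. i \<le> j \<Longrightarrow> j \<le> m \<Longrightarrow> \<epsilon> i \<longrightarrow> \<epsilon> j"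
    using assms(2) by (auto simp: cyl_operator_def)
  note c = chainD[OF chain_reindex[OF C.nerve_chain[OF assms(1)] \<mu>]]
  have chain: "chain D m (\<lambda>i. cyl_ob (\<epsilon> i) (nerve_vertex C (\<mu> i) \<sigma>))
     (\<lambda>i j. cyl_arr (\<epsilon> i) (\<epsilon> j) (span C \<sigma> (\<mu> i) (\<mu> j)))"
    using c \<epsilon> by (intro chainI) (simp_all add: cyl_ob_closed cyl_arr_idn cyl_arr_closed cyl_arr_cmp)
  show "cyl_simplex m \<mu> \<epsilon> \<sigma> \<in> nerve D m"
    unfolding cyl_simplex_def by (rule D.simplex_of_in_nerve[OF chain])
  show "nerve_vertex D i (cyl_simplex m \<mu> \<epsilon> \<sigma>) = cyl_ob (\<epsilon> i) (nerve_vertex C (\<mu> i) \<sigma>)" if "i \<le> m" for i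
    unfolding cyl_simplex_def by (rule vertex_simplex_of[OF chain that])
  show "span D (cyl_simplex m \<mu> \<epsilon> \<sigma>) i j = cyl_arr (\<epsilon> i) (\<epsilon> j) (span C \<sigma> (\<mu> i) (\<mu> j))"
    if "i \<le> j" "j \<le> m" for i j
    unfolding cyl_simplex_def by (rule span_simplex_of[OF chain that])
qed

definition cyl_factor :: "(nat \<Rightarrow> nat) \<Rightarrow> (nat \<Rightarrow> bool) \<Rightarrow> 'o \<times> 'm list \<Rightarrow> 'g \<Rightarrow> 'h" where
  "cyl_factor \<mu> \<epsilon> \<sigma> x = cyl_map (\<epsilon> 0) (nerve_vertex C (\<mu> 0) \<sigma>) (GAr G (span C \<sigma> 0 (\<mu> 0)) x)"

lemma cyl_factor_map:
  assumes cyl: "cyl_operator m n \<mu> \<epsilon>"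
  shows "factor_map (nerve C n) (simplex_factor G) (nerve D m) (simplex_factor H) (cyl_simplex m \<mu> \<epsilon>) (cyl_factor \<mu> \<epsilon>)"
  unfolding factor_map_def
proof (intro ballI conjI)
  fix \<sigma> assume \<sigma>: "\<sigma> \<in> nerve C n"
  have \<mu>: "simplex_operator m n \<mu>" using cyl by (simp add: cyl_operator_def)
  show "cyl_simplex m \<mu> \<epsilon> \<sigma> \<in> nerve D m" by (rule cyl_simplex_nerve[OF \<sigma> cyl])
  have v: "nerve_vertex C (\<mu> 0) \<sigma> \<in> Ob C"
    using chain_vertex[OF C.nerve_chain[OF \<sigma>]] simplex_operatorD[OF \<mu>] by simp
  have "fst (cyl_simplex m \<mu> \<epsilon> \<sigma>) = cyl_ob (\<epsilon> 0) (nerve_vertex C (\<mu> 0) \<sigma>)"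
    using vertex_cyl_simplex[OF \<sigma> cyl, of 0] by (simp add: nerve_vertex_0)
  then show "cyl_factor \<mu> \<epsilon> \<sigma> \<in> hom (GOb G (fst \<sigma>)) (GOb H (fst (cyl_simplex m \<mu> \<epsilon> \<sigma>)))"
    using hom_compose[OF C.span_hom[OF \<sigma>, of 0 "\<mu> 0"] cyl_map_hom[OF v, of "\<epsilon> 0"]]
      simplex_operatorD[OF \<mu>] by (simp add: comp_def nerve_vertex_0 cyl_factor_def[abs_def])
qed

definition cyl_operate :: "nat \<Rightarrow> (nat \<Rightarrow> nat) \<Rightarrow> (nat \<Rightarrow> bool) \<Rightarrow>
    (('o \<times> 'm list) \<times> 'g) list set \<Rightarrow> (('p \<times> 'q list) \<times> 'h) list set" where
  "cyl_operate m \<mu> \<epsilon> = fp_map (nerve D m) (simplex_factor H) (cyl_simplex m \<mu> \<epsilon>) (cyl_factor \<mu> \<epsilon>)"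

lemma cyl_operate_hom:
  assumes "cyl_operator m n \<mu> \<epsilon>"
  shows "cyl_operate m \<mu> \<epsilon> \<in> hom (Lev (simplicial_replacement C G) n) (Lev (simplicial_replacement D H) m)"
  unfolding cyl_operate_def Lev_simplicial_replacement
  by (rule fp_map_hom[OF C.nerve_group_family D.nerve_group_family cyl_factor_map[OF assms]])

lemma cyl_operator_comp:
  "cyl_operator m n \<mu> \<epsilon> \<Longrightarrow> simplex_operator l m \<nu> \<Longrightarrow> cyl_operator l n (\<lambda>k. \<mu> (\<nu> k)) (\<lambda>k. \<epsilon> (\<nu> k))"
  unfolding cyl_operator_def simplex_operator_def by blast

lemma operator_cyl_comp:
  "simplex_operator m n \<mu> \<Longrightarrow> cyl_operator l m \<nu> \<epsilon> \<Longrightarrow> cyl_operator l n (\<lambda>k. \<mu> (\<nu> k)) \<epsilon>"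
  unfolding cyl_operator_def simplex_operator_def by blast

lemma operate_cyl_operate:
  assumes "cyl_operator m n \<mu> \<epsilon>" "simplex_operator l m \<nu>" "A \<in> carrier (Lev (simplicial_replacement C G) n)"
  shows "D.operate l \<nu> (cyl_operate m \<mu> \<epsilon> A) = cyl_operate l (\<lambda>k. \<mu> (\<nu> k)) (\<lambda>k. \<epsilon> (\<nu> k)) A"
  unfolding D.operate_def cyl_operate_def
proof (rule fp_map_comp[OF C.nerve_group_family D.nerve_group_family D.nerve_group_family cyl_factor_map[OF assms(1)]
      D.operate_factor_map[OF assms(2)] cyl_factor_map[OF cyl_operator_comp[OF assms(1,2)]]])
  have \<mu>: "simplex_operator m n \<mu>" and \<epsilon>: "\<And>i j. i \<le> j \<Longrightarrow> j \<le> m \<Longrightarrow> \<epsilon> i \<longrightarrow> \<epsilon> j"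
    using assms(1) by (auto simp: cyl_operator_def)
  fix \<sigma> assume \<sigma>: "\<sigma> \<in> nerve C n"
  note c = chainD[OF C.nerve_chain[OF \<sigma>]] and ops = simplex_operatorD[OF \<mu>] simplex_operatorD[OF assms(2)]
  show "reindex D l \<nu> (cyl_simplex m \<mu> \<epsilon> \<sigma>) = cyl_simplex l (\<lambda>k. \<mu> (\<nu> k)) (\<lambda>k. \<epsilon> (\<nu> k)) \<sigma>"
    unfolding reindex_def cyl_simplex_def[of l] using ops
    by (intro simplex_of_cong) (simp_all add: vertex_cyl_simplex[OF \<sigma> assms(1)] span_cyl_simplex[OF \<sigma> assms(1)])
  fix x assume x: "x \<in> carrier (GOb G (fst \<sigma>))"
  have bounds: "\<mu> 0 \<le> \<mu> (\<nu> 0)" "\<mu> (\<nu> 0) \<le> n" "\<epsilon> 0 \<longrightarrow> \<epsilon> (\<nu> 0)"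
    using ops \<epsilon>[of 0 "\<nu> 0"] by simp_all
  let ?y = "GAr G (span C \<sigma> 0 (\<mu> 0)) x"
  have y: "?y \<in> carrier (GOb G (nerve_vertex C (\<mu> 0) \<sigma>))"
    using hom_in_carrier[OF C.span_hom[OF \<sigma>, of 0 "\<mu> 0"]] x ops by (simp add: nerve_vertex_0)
  have "GAr H (span D (cyl_simplex m \<mu> \<epsilon> \<sigma>) 0 (\<nu> 0)) (cyl_factor \<mu> \<epsilon> \<sigma> x)
      = GAr H (cyl_arr (\<epsilon> 0) (\<epsilon> (\<nu> 0)) (span C \<sigma> (\<mu> 0) (\<mu> (\<nu> 0)))) (cyl_map (\<epsilon> 0) (nerve_vertex C (\<mu> 0) \<sigma>) ?y)"
    using ops by (simp add: span_cyl_simplex[OF \<sigma> assms(1)] cyl_factor_def)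
  also have "\<dots> = cyl_map (\<epsilon> (\<nu> 0)) (nerve_vertex C (\<mu> (\<nu> 0)) \<sigma>) (GAr G (span C \<sigma> (\<mu> 0) (\<mu> (\<nu> 0))) ?y)"
    using cyl_map_natural[of "span C \<sigma> (\<mu> 0) (\<mu> (\<nu> 0))" "\<epsilon> 0" "\<epsilon> (\<nu> 0)" ?y] bounds y
    by (simp add: c)
  also have "GAr G (span C \<sigma> (\<mu> 0) (\<mu> (\<nu> 0))) ?y = GAr G (span C \<sigma> 0 (\<mu> (\<nu> 0))) x"
    using C.span_span[OF \<sigma>, of 0 "\<mu> 0" "\<mu> (\<nu> 0)" x] x ops by (simp add: nerve_vertex_0)
  finally show "GAr H (span D (cyl_simplex m \<mu> \<epsilon> \<sigma>) 0 (\<nu> 0)) (cyl_factor \<mu> \<epsilon> \<sigma> x)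
      = cyl_factor (\<lambda>k. \<mu> (\<nu> k)) (\<lambda>k. \<epsilon> (\<nu> k)) \<sigma> x" by (simp add: cyl_factor_def)
qed (use assms(3) in \<open>simp add: Lev_simplicial_replacement\<close>)

lemma cyl_operate_operate:
  assumes "simplex_operator m n \<mu>" "cyl_operator l m \<nu> \<epsilon>" "A \<in> carrier (Lev (simplicial_replacement C G) n)"
  shows "cyl_operate l \<nu> \<epsilon> (C.operate m \<mu> A) = cyl_operate l (\<lambda>k. \<mu> (\<nu> k)) \<epsilon> A"
  unfolding C.operate_def cyl_operate_def
proof (rule fp_map_comp[OF C.nerve_group_family C.nerve_group_family D.nerve_group_family C.operate_factor_map[OF assms(1)]
      cyl_factor_map[OF assms(2)] cyl_factor_map[OF operator_cyl_comp[OF assms(1,2)]]])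
  have \<nu>: "simplex_operator l m \<nu>" using assms(2) by (auto simp: cyl_operator_def)
  fix \<sigma> assume \<sigma>: "\<sigma> \<in> nerve C n"
  note ops = simplex_operatorD[OF assms(1)] simplex_operatorD[OF \<nu>]
  show "cyl_simplex l \<nu> \<epsilon> (reindex C m \<mu> \<sigma>) = cyl_simplex l (\<lambda>k. \<mu> (\<nu> k)) \<epsilon> \<sigma>"
    unfolding cyl_simplex_def using ops
    by (intro simplex_of_cong) (simp_all add: C.vertex_reindex[OF \<sigma> assms(1)] C.span_reindex[OF \<sigma> assms(1)])
  show "cyl_factor \<nu> \<epsilon> (reindex C m \<mu> \<sigma>) (GAr G (span C \<sigma> 0 (\<mu> 0)) x) = cyl_factor (\<lambda>k. \<mu> (\<nu> k)) \<epsilon> \<sigma> x"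
    if "x \<in> carrier (GOb G (fst \<sigma>))" for x
    using that ops C.span_span[OF \<sigma>, of 0 "\<mu> 0" "\<mu> (\<nu> 0)" x]
    by (simp add: cyl_factor_def C.vertex_reindex[OF \<sigma> assms(1)] C.span_reindex[OF \<sigma> assms(1)] nerve_vertex_0)
qed (use assms(3) in \<open>simp add: Lev_simplicial_replacement\<close>)

lemma cyl_operate_cong:
  assumes "\<And>k. k \<le> m \<Longrightarrow> \<mu> k = \<mu>' k" "\<And>k. k \<le> m \<Longrightarrow> \<epsilon> k = \<epsilon>' k"
  shows "cyl_operate m \<mu> \<epsilon> = cyl_operate m \<mu>' \<epsilon>'"
proof -
  have "cyl_simplex m \<mu> \<epsilon> = cyl_simplex m \<mu>' \<epsilon>'"
    by (rule ext) (use assms in \<open>auto simp: cyl_simplex_def intro!: simplex_of_cong\<close>)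
  moreover have "cyl_factor \<mu> \<epsilon> = cyl_factor \<mu>' \<epsilon>'"
    using assms[of 0] by (simp add: cyl_factor_def[abs_def])
  ultimately show ?thesis by (simp add: cyl_operate_def)
qed

lemma cyl_operator_const: "cyl_operator n n (\<lambda>k. k) (\<lambda>_. u)"
  by (simp add: cyl_operator_def simplex_operator_def)

lemma replacement_map_cyl_end:
  assumes "A \<in> carrier (Lev (simplicial_replacement C G) n)"
  shows "replacement_map D H (if u then F' else F) (if u then \<tau>' else \<tau>) n A = cyl_operate n (\<lambda>k. k) (\<lambda>_. u) A"
  unfolding replacement_map_def cyl_operate_def
proof (rule fp_map_cong[OF C.nerve_group_family D.nerve_group_family cyl_factor_map[OF cyl_operator_const]])
  fix \<sigma> assume \<sigma>: "\<sigma> \<in> nerve C n"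
  have "map (\<lambda>k. cyl_arr u u (span C \<sigma> k (Suc k))) [0..<n] = map (cyl_arr u u) (snd \<sigma>)"
    using \<sigma> by (intro nth_equalityI) (simp_all add: C.span_Suc[OF \<sigma>] C.nerve_iff del: span.simps)
  then show "(FOb (if u then F' else F) (fst \<sigma>), map (FAr (if u then F' else F)) (snd \<sigma>)) = cyl_simplex n (\<lambda>k. k) (\<lambda>_. u) \<sigma>"
    by (auto simp: cyl_simplex_def simplex_of_def cyl_ob_def cyl_arr_def[abs_def] nerve_vertex_0)
  show "(if u then \<tau>' else \<tau>) (fst \<sigma>) x = cyl_factor (\<lambda>k. k) (\<lambda>_. u) \<sigma> x" if "x \<in> carrier (GOb G (fst \<sigma>))" for x
    using that C.span_same[OF \<sigma>, of 0 x] by (simp add: cyl_factor_def cyl_map_def nerve_vertex_0)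
qed (use assms in \<open>simp add: Lev_simplicial_replacement\<close>)

lemma replacement_map_cyl:
  assumes "A \<in> carrier (Lev (simplicial_replacement C G) n)"
  shows "replacement_map D H F \<tau> n A = cyl_operate n (\<lambda>k. k) (\<lambda>_. False) A"
    and "replacement_map D H F' \<tau>' n A = cyl_operate n (\<lambda>k. k) (\<lambda>_. True) A"
  using replacement_map_cyl_end[OF assms, of False] replacement_map_cyl_end[OF assms, of True] by simp_all

lemma cyl_operate_closed:
  "cyl_operator m n \<mu> \<epsilon> \<Longrightarrow> A \<in> carrier (Lev (simplicial_replacement C G) n) \<Longrightarrow>
    cyl_operate m \<mu> \<epsilon> A \<in> carrier (Lev (simplicial_replacement D H) m)"
  by (rule hom_in_carrier[OF cyl_operate_hom])

lemma cyl_operator_homotopy: "j \<le> n \<Longrightarrow> cyl_operator (Suc n) n (codegeneracy j) ((<) j)"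
  using simplex_operator_codegeneracy[of j n] by (auto simp: cyl_operator_def)

lemma semisimplicial_replacement_map:
  "semisimplicial_hom (simplicial_replacement C G) (simplicial_replacement D H) (replacement_map D H F \<tau>)"
  unfolding semisimplicial_hom_def
proof (intro conjI allI impI ballI)
  let ?X = "simplicial_replacement C G" and ?Y = "simplicial_replacement D H"
  show "replacement_map D H F \<tau> n \<in> hom (Lev ?X n) (Lev ?Y n)" for n
    by (rule hom_cong[OF cyl_operate_hom[OF cyl_operator_const] C.replacement_level_group replacement_map_cyl(1)])
  fix n i A assume i: "i \<le> Suc n" and A: "A \<in> carrier (Lev ?X (Suc n))"
  have "Face ?Y (Suc n) i (cyl_operate (Suc n) (\<lambda>k. k) (\<lambda>_. False) A)
      = cyl_operate n (\<lambda>k. coface i k) (\<lambda>_. False) A"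
    using D.face_operate[OF i cyl_operate_closed[OF cyl_operator_const A]]
      operate_cyl_operate[OF cyl_operator_const simplex_operator_coface A] by simp
  also have "\<dots> = cyl_operate n (\<lambda>k. k) (\<lambda>_. False) (Face ?X (Suc n) i A)"
    using C.face_operate[OF i A]
      cyl_operate_operate[OF simplex_operator_coface cyl_operator_const A] by simp
  finally show "Face ?Y (Suc n) i (replacement_map D H F \<tau> (Suc n) A) = replacement_map D H F \<tau> n (Face ?X (Suc n) i A)"
    using A i C.face_operate[OF i A] C.operate_closed[OF simplex_operator_coface A]
    by (simp add: replacement_map_cyl(1))
qed

text \<open>With the jump of \<open>\<epsilon>\<close> placed after position \<open>j\<close>, each homotopy identity compares two pairs of monotone maps
  that agree pointwise. Removing vertex \<open>0\<close> from the prism with the first jump leaves \<open>F'\<close> everywhere, which is why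
  the homotopy runs from \<open>F'\<close> to \<open>F\<close>.\<close>

lemma replacement_maps_homotopic:
  "simplicial_homotopy (simplicial_replacement C G) (simplicial_replacement D H)
     (replacement_map D H F' \<tau>') (replacement_map D H F \<tau>) (\<lambda>n j. cyl_operate (Suc n) (codegeneracy j) ((<) j))"
  unfolding simplicial_homotopy_def
proof (intro conjI allI impI ballI)
  let ?X = "simplicial_replacement C G" and ?Y = "simplicial_replacement D H"
  let ?h = "\<lambda>n j. cyl_operate (Suc n) (codegeneracy j) ((<) j)"
  show "?h n j \<in> hom (Lev ?X n) (Lev ?Y (Suc n))" if "j \<le> n" for n j
    by (rule cyl_operate_hom[OF cyl_operator_homotopy[OF that]])
  have face: "Face ?Y (Suc n) i (?h n j x) = cyl_operate n (\<lambda>k. codegeneracy j (coface i k)) (\<lambda>k. j < coface i k) x"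
    if "i \<le> Suc n" "j \<le> n" "x \<in> carrier (Lev ?X n)" for i j n x
    using D.face_operate[OF that(1) cyl_operate_closed[OF cyl_operator_homotopy[OF that(2)] that(3)]]
      operate_cyl_operate[OF cyl_operator_homotopy[OF that(2)] simplex_operator_coface that(3)] by simp
  show "Face ?Y (Suc n) 0 (?h n 0 x) = replacement_map D H F' \<tau>' n x" if "x \<in> carrier (Lev ?X n)" for n x
    unfolding replacement_map_cyl(2)[OF that] face[OF le0 le0 that]
    by (rule fun_cong[OF cyl_operate_cong]) (auto simp: codegeneracy_def coface_def)
  show "Face ?Y (Suc n) (Suc n) (?h n n x) = replacement_map D H F \<tau> n x" if "x \<in> carrier (Lev ?X n)" for n x
    unfolding replacement_map_cyl(1)[OF that] face[OF le_refl le_refl that]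
    by (rule fun_cong[OF cyl_operate_cong]) (auto simp: codegeneracy_def coface_def)
  show "Face ?Y (Suc n) (Suc j) (?h n (Suc j) x) = Face ?Y (Suc n) (Suc j) (?h n j x)"
    if "x \<in> carrier (Lev ?X n)" "j < n" for n j x
  proof -
    have "Suc j \<le> Suc n" "Suc j \<le> n" "j \<le> n" using that by auto
    show ?thesis
      unfolding face[OF \<open>Suc j \<le> Suc n\<close> \<open>Suc j \<le> n\<close> that(1)] face[OF \<open>Suc j \<le> Suc n\<close> \<open>j \<le> n\<close> that(1)]
      by (rule fun_cong[OF cyl_operate_cong]) (auto simp: codegeneracy_def coface_def)
  qed
  have h_face: "?h n j (Face ?X (Suc n) i x) = cyl_operate (Suc n) (\<lambda>k. coface i (codegeneracy j k)) ((<) j) x"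
    if "i \<le> Suc n" "j \<le> n" "x \<in> carrier (Lev ?X (Suc n))" for i j n x
    using C.face_operate[OF that(1,3)]
      cyl_operate_operate[OF simplex_operator_coface cyl_operator_homotopy[OF that(2)] that(3)] by simp
  show "Face ?Y (Suc (Suc n)) i (?h (Suc n) j x) = ?h n (j - 1) (Face ?X (Suc n) i x)"
    if "j \<le> Suc n" "x \<in> carrier (Lev ?X (Suc n))" "i < j" for i j n x
  proof -
    have b: "i \<le> Suc (Suc n)" "i \<le> Suc n" "j - 1 \<le> n" using that by auto
    show ?thesis
      unfolding face[OF b(1) that(1,2)] h_face[OF b(2,3) that(2)]
      by (rule fun_cong[OF cyl_operate_cong]) (use that in \<open>auto simp: codegeneracy_def coface_def\<close>)
  qed
  show "Face ?Y (Suc (Suc n)) i (?h (Suc n) j x) = ?h n j (Face ?X (Suc n) (i - 1) x)"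
    if "j \<le> Suc n" "x \<in> carrier (Lev ?X (Suc n))" "i \<le> Suc (Suc n)" "Suc j < i" for i j n x
  proof -
    have b: "i - 1 \<le> Suc n" "j \<le> n" using that by auto
    show ?thesis
      unfolding face[OF that(3,1,2)] h_face[OF b that(2)]
      by (rule fun_cong[OF cyl_operate_cong]) (use that in \<open>auto simp: codegeneracy_def coface_def\<close>)
  qed
qed

end

section \<open>Functoriality of simplicial replacements\<close>

text \<open>The maps of coefficient systems \<open>(C, G) \<rightarrow> (D, H)\<close> along which simplicial replacements are functorial.\<close>

locale diagram_morphism =
  C: category_diagram C G + D: category_diagram D H + F: cat_functor C D F
  for C :: "('o, 'm) cat" and G :: "('o, 'm, 'g) diagram" and D :: "('p, 'q) cat" and H :: "('p, 'q, 'h) diagram"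
    and F :: "('o, 'm, 'p, 'q) funct" +
  fixes \<tau> :: "'o \<Rightarrow> 'g \<Rightarrow> 'h"
  assumes \<tau>: "diagram_map C G (diagram_comp H F) \<tau>"
begin

lemma \<tau>_hom: "c \<in> Ob C \<Longrightarrow> \<tau> c \<in> hom (GOb G c) (GOb H (FOb F c))"
  using \<tau> by (simp add: diagram_map_def diagram_comp_def)

lemma \<tau>_natural: "f \<in> Ar C \<Longrightarrow> x \<in> carrier (GOb G (Dom C f)) \<Longrightarrow>
    \<tau> (Cod C f) (GAr G f x) = GAr H (FAr F f) (\<tau> (Dom C f) x)"
  using \<tau> by (simp add: diagram_map_def diagram_comp_def)

lemma semisimplicial_hom:
  "semisimplicial_hom (simplicial_replacement C G) (simplicial_replacement D H) (replacement_map D H F \<tau>)"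
proof -
  \<comment> \<open>The map is an end of the homotopy given by the identity transformation of \<open>F\<close>.\<close>
  interpret diagram_homotopy C G D H F F "\<lambda>c. Idn D (FOb F c)" \<tau> \<tau>
    by unfold_locales
      (use D.cmp_idn_left D.cmp_idn_right in \<open>auto simp: \<tau> D.idn_closed D.dom_idn D.cod_idn F.fob_closed F.far_closed
        F.dom_far F.cod_far D.gar_idn hom_in_carrier[OF \<tau>_hom] simp flip: F.dom_far F.cod_far\<close>)
  show ?thesis by (rule semisimplicial_replacement_map)
qed

lemma nerve_image:
  assumes "\<sigma> \<in> nerve C n"
  shows "(FOb F (fst \<sigma>), map (FAr F) (snd \<sigma>)) \<in> nerve D n"
proof -
  have "nerve_vertex D k (FOb F (fst \<sigma>), map (FAr F) (snd \<sigma>)) = FOb F (nerve_vertex C k \<sigma>)" if "k < n" for k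
    using assms that by (cases k) (auto simp: nerve_vertex_0 nerve_vertex_Suc C.nerve_iff F.cod_far)
  then show ?thesis
    using assms by (auto simp: C.nerve_iff D.nerve_iff F.fob_closed F.far_closed F.dom_far)
qed

lemma replacement_factor_map:
  "factor_map (nerve C n) (simplex_factor G) (nerve D n) (simplex_factor H)
     (\<lambda>\<sigma>. (FOb F (fst \<sigma>), map (FAr F) (snd \<sigma>))) (\<lambda>\<sigma>. \<tau> (fst \<sigma>))"
proof -
  have "fst \<sigma> \<in> Ob C" if "\<sigma> \<in> nerve C n" for \<sigma> using that by (simp add: C.nerve_iff)
  then show ?thesis using nerve_image by (simp add: factor_map_def \<tau>_hom)
qed

lemma replacement_map_hom:
  "replacement_map D H F \<tau> n \<in> hom (Lev (simplicial_replacement C G) n) (Lev (simplicial_replacement D H) n)"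
  using semisimplicial_hom by (simp add: semisimplicial_hom_def)

lemma replacement_map_in:
  assumes "\<sigma> \<in> nerve C n" "x \<in> carrier (GOb G (fst \<sigma>))"
  shows "replacement_map D H F \<tau> n (fp_in (nerve C n) (simplex_factor G) \<sigma> x)
    = fp_in (nerve D n) (simplex_factor H) (FOb F (fst \<sigma>), map (FAr F) (snd \<sigma>)) (\<tau> (fst \<sigma>) x)"
  unfolding replacement_map_def
  by (rule fp_map_in[OF C.nerve_group_family D.nerve_group_family replacement_factor_map assms])

end

definition id_funct :: "('o, 'm, 'o, 'm) funct" where
  "id_funct = \<lparr>FOb = (\<lambda>c. c), FAr = (\<lambda>f. f)\<rparr>"

lemma id_funct_simps: "FOb id_funct = (\<lambda>c. c)" "FAr id_funct = (\<lambda>f. f)"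
  by (simp_all add: id_funct_def)

definition comp_funct :: "('p, 'q, 'r, 's) funct \<Rightarrow> ('o, 'm, 'p, 'q) funct \<Rightarrow> ('o, 'm, 'r, 's) funct" where
  "comp_funct F' F = \<lparr>FOb = (\<lambda>c. FOb F' (FOb F c)), FAr = (\<lambda>f. FAr F' (FAr F f))\<rparr>"

lemma cat_functor_id: "cat_functor C C id_funct"
  by unfold_locales (simp_all add: id_funct_def)

lemma cat_functor_comp:
  assumes "cat_functor C D F" "cat_functor D E F'"
  shows "cat_functor C E (comp_funct F' F)"
proof -
  interpret F: cat_functor C D F by fact
  interpret F': cat_functor D E F' by fact
  show ?thesis
    by unfold_locales (simp_all add: comp_funct_def F.fob_closed F'.fob_closed F.far_closed F'.far_closed
        F.dom_far F'.dom_far F.cod_far F'.cod_far F.far_idn F'.far_idn F.far_cmp F'.far_cmp)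
qed

lemma group_diagram_comp:
  assumes "cat_functor C D F" "group_diagram D H"
  shows "group_diagram C (diagram_comp H F)"
proof -
  interpret F: cat_functor C D F by fact
  interpret H: group_diagram D H by fact
  have "GAr H (FAr F f) \<in> hom (GOb H (FOb F (Dom C f))) (GOb H (FOb F (Cod C f)))" if "f \<in> Ar C" for f
    using H.gar_hom[OF F.far_closed[OF that]] that by (simp add: F.dom_far F.cod_far)
  then show ?thesis
    by (intro group_diagram.intro)
      (simp_all add: diagram_comp_def H.gob_group F.fob_closed F.far_idn H.gar_idn F.far_cmp F.far_closed
        H.gar_cmp F.dom_far F.cod_far)
qed

lemma diagram_morphism_id:
  assumes "category_diagram C G"
  shows "diagram_morphism C G C G id_funct (\<lambda>c x. x)"
proof -
  interpret category_diagram C G by fact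
  interpret cat_functor C C id_funct by (rule cat_functor_id)
  show ?thesis
    by unfold_locales (simp add: diagram_map_def diagram_comp_def id_funct_def hom_def)
qed

lemma diagram_morphism_comp:
  assumes "diagram_morphism C G D H F \<tau>" "diagram_morphism D H E K F' \<tau>'"
  shows "diagram_morphism C G E K (comp_funct F' F) (\<lambda>c x. \<tau>' (FOb F c) (\<tau> c x))"
proof -
  interpret F: diagram_morphism C G D H F \<tau> by fact
  interpret F': diagram_morphism D H E K F' \<tau>' by fact
  interpret F'F: cat_functor C E "comp_funct F' F"
    by (rule cat_functor_comp[OF F.F.cat_functor_axioms F'.F.cat_functor_axioms])
  have "(\<lambda>x. \<tau>' (FOb F c) (\<tau> c x)) \<in> hom (GOb G c) (GOb K (FOb F' (FOb F c)))" if "c \<in> Ob C" for c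
    using hom_compose[OF F.\<tau>_hom[OF that] F'.\<tau>_hom[OF F.F.fob_closed[OF that]]] by (simp add: comp_def)
  moreover have "\<tau>' (FOb F (Cod C f)) (\<tau> (Cod C f) (GAr G f x)) = GAr K (FAr F' (FAr F f)) (\<tau>' (FOb F (Dom C f)) (\<tau> (Dom C f) x))"
    if f: "f \<in> Ar C" "x \<in> carrier (GOb G (Dom C f))" for f x
    using F'.\<tau>_natural[OF F.F.far_closed[OF f(1)], of "\<tau> (Dom C f) x"]
      hom_in_carrier[OF F.\<tau>_hom[OF F.C.dom_closed[OF f(1)]] f(2)] f
    by (simp add: F.\<tau>_natural F.F.dom_far F.F.cod_far)
  ultimately show ?thesis
    by unfold_locales (simp add: diagram_map_def diagram_comp_def comp_funct_def)
qed

lemma replacement_map_comp: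
  assumes "diagram_morphism C G D H F \<tau>" "diagram_morphism D H E K F' \<tau>'"
    and A: "A \<in> carrier (Lev (simplicial_replacement C G) n)"
  shows "replacement_map E K F' \<tau>' n (replacement_map D H F \<tau> n A)
    = replacement_map E K (comp_funct F' F) (\<lambda>c x. \<tau>' (FOb F c) (\<tau> c x)) n A"
proof -
  interpret F: diagram_morphism C G D H F \<tau> by fact
  interpret F': diagram_morphism D H E K F' \<tau>' by fact
  interpret F'F: diagram_morphism C G E K "comp_funct F' F" "\<lambda>c x. \<tau>' (FOb F c) (\<tau> c x)"
    by (rule diagram_morphism_comp[OF assms(1,2)])
  show ?thesis
    unfolding replacement_map_def
    by (rule fp_map_comp[OF F.C.nerve_group_family F.D.nerve_group_family F'.D.nerve_group_family
          F.replacement_factor_map F'.replacement_factor_map F'F.replacement_factor_map])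
      (use A in \<open>simp_all add: comp_funct_def Lev_simplicial_replacement\<close>)
qed

lemma replacement_map_id:
  assumes "category_diagram C G" and A: "A \<in> carrier (Lev (simplicial_replacement C G) n)"
  shows "replacement_map C G id_funct (\<lambda>c x. x) n A = A"
proof -
  interpret diagram_morphism C G C G id_funct "\<lambda>c x. x" by (rule diagram_morphism_id[OF assms(1)])
  have "(\<lambda>A. A) \<in> hom (Lev (simplicial_replacement C G) n) (Lev (simplicial_replacement C G) n)"
    by (simp add: hom_def)
  then show ?thesis
    by (rule C.replacement_hom_eqI[OF C.replacement_level_group replacement_map_hom _ _ A])
      (simp add: replacement_map_in, simp add: id_funct_def)
qed

section \<open>Invariance of homology\<close>

lemma replacement_map_inverse:
  assumes \<theta>: "diagram_morphism C G C H id_funct \<theta>" and \<sigma>: "diagram_morphism C H C G id_funct \<sigma>"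
    and \<sigma>\<theta>: "\<And>c x. c \<in> Ob C \<Longrightarrow> x \<in> carrier (GOb G c) \<Longrightarrow> \<sigma> c (\<theta> c x) = x"
    and A: "A \<in> carrier (Lev (simplicial_replacement C G) n)"
  shows "replacement_map C G id_funct \<sigma> n (replacement_map C H id_funct \<theta> n A) = A"
proof -
  interpret \<theta>: diagram_morphism C G C H id_funct \<theta> by fact
  interpret id: diagram_morphism C G C G id_funct "\<lambda>c x. x"
    by (rule diagram_morphism_id[OF \<theta>.C.category_diagram_axioms])
  have "replacement_map C G id_funct \<sigma> n (replacement_map C H id_funct \<theta> n A)
      = replacement_map C G id_funct (\<lambda>c x. x) n A"
    unfolding replacement_map_comp[OF \<theta> \<sigma> A] unfolding replacement_map_def
    by (rule fp_map_cong[OF \<theta>.C.nerve_group_family \<theta>.C.nerve_group_family id.replacement_factor_map])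
      (use A in \<open>simp_all add: comp_funct_def id_funct_simps \<sigma>\<theta> \<theta>.C.nerve_iff Lev_simplicial_replacement\<close>)
  also have "\<dots> = A" by (rule replacement_map_id[OF \<theta>.C.category_diagram_axioms A])
  finally show ?thesis .
qed

lemma diagram_iso_homology:
  assumes "category C" "group_diagram C G" "group_diagram C H" "diagram_map C G H \<theta>" "diagram_map C H G \<sigma>"
    and "\<And>c x. c \<in> Ob C \<Longrightarrow> x \<in> carrier (GOb G c) \<Longrightarrow> \<sigma> c (\<theta> c x) = x"
    and "\<And>c x. c \<in> Ob C \<Longrightarrow> x \<in> carrier (GOb H c) \<Longrightarrow> \<theta> c (\<sigma> c x) = x"
  shows "nonabelian_homology C G n \<cong> nonabelian_homology C H n"
proof -
  have id: "diagram_comp K id_funct = K" for K :: "('a, 'b, 'x) diagram"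
    by (simp add: diagram_comp_def id_funct_def)
  have mor: "diagram_morphism C G C H id_funct \<theta>" "diagram_morphism C H C G id_funct \<sigma>"
    using assms(1-5) cat_functor_id[of C]
    by (simp_all add: diagram_morphism_def diagram_morphism_axioms_def category_diagram_def id)
  interpret \<theta>: diagram_morphism C G C H id_funct \<theta> by (rule mor)
  interpret \<sigma>: diagram_morphism C H C G id_funct \<sigma> by (rule mor)
  show ?thesis
    unfolding nonabelian_homology_def
    by (rule homology_iso_of_level_iso[OF \<theta>.C.simplicial_group_replacement \<theta>.D.simplicial_group_replacement
          \<theta>.semisimplicial_hom \<sigma>.replacement_map_hom
          replacement_map_inverse[OF mor assms(6)] replacement_map_inverse[OF mor(2,1) assms(7)]])
qed

text \<open>The maps induced by \<open>T\<close> with coefficients \<open>G(\<eta>)\<close> and by \<open>R\<close> are mutually inverse up to homotopy: the unit is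
  a homotopy for one composite, and the counit for the other, where the triangle identity is the required
  compatibility with the coefficients.\<close>

theorem adjoint_homology:
  assumes "category C" "category E" "group_diagram C G"
    and \<eta>: "natural_transformation C C id_funct (comp_funct R T) \<eta>"
    and \<epsilon>: "natural_transformation E E (comp_funct T R) id_funct \<epsilon>"
    and T: "cat_functor C E T" and R: "cat_functor E C R"
    and triangle: "\<And>e. e \<in> Ob E \<Longrightarrow> Cmp C (FAr R (\<epsilon> e)) (\<eta> (FOb R e)) = Idn C (FOb R e)"
  shows "nonabelian_homology C G n \<cong> nonabelian_homology E (diagram_comp G R) n"
proof -
  let ?H = "diagram_comp G R"
  let ?X = "simplicial_replacement C G" and ?Y = "simplicial_replacement E ?H"
  interpret T: cat_functor C E T by fact
  interpret R: cat_functor E C R by fact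
  interpret \<eta>: natural_transformation C C id_funct "comp_funct R T" \<eta> by fact
  interpret \<epsilon>: natural_transformation E E "comp_funct T R" id_funct \<epsilon> by fact
  interpret C: category_diagram C G using assms by (simp add: category_diagram_def)
  interpret E: category_diagram E ?H
    using assms group_diagram_comp[OF R assms(3)] by (simp add: category_diagram_def)
  let ?\<tau> = "\<lambda>c. GAr G (\<eta> c)"
  have \<tau>: "diagram_map C G (diagram_comp ?H T) ?\<tau>"
    unfolding diagram_map_def
  proof (intro conjI ballI)
    show "?\<tau> c \<in> hom (GOb G c) (GOb (diagram_comp ?H T) c)" if "c \<in> Ob C" for c
      using C.gar_hom[OF \<eta>.component_closed[OF that]] that
      by (simp add: \<eta>.component_dom \<eta>.component_cod) (simp add: diagram_comp_def comp_funct_def id_funct_def)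
    show "?\<tau> (Cod C f) (GAr G f x) = GAr (diagram_comp ?H T) f (?\<tau> (Dom C f) x)"
      if f: "f \<in> Ar C" "x \<in> carrier (GOb G (Dom C f))" for f x
    proof -
      have "?\<tau> (Cod C f) (GAr G f x) = GAr G (Cmp C (\<eta> (Cod C f)) f) x"
        using f \<eta>.component_dom[of "Cod C f"]
        by (simp add: C.gar_cmp \<eta>.component_closed C.cod_closed id_funct_def)
      also have "Cmp C (\<eta> (Cod C f)) f = Cmp C (FAr R (FAr T f)) (\<eta> (Dom C f))"
        using \<eta>.naturality[OF f(1)] by (simp add: id_funct_def comp_funct_def)
      also have "GAr G \<dots> x = GAr G (FAr R (FAr T f)) (?\<tau> (Dom C f) x)"
        using f \<eta>.component_dom[of "Dom C f"] \<eta>.component_cod[of "Dom C f"]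
        by (intro C.gar_cmp) (simp_all add: \<eta>.component_closed C.dom_closed R.far_closed T.far_closed
            R.dom_far T.dom_far id_funct_def comp_funct_def)
      finally show ?thesis by (simp add: diagram_comp_def)
    qed
  qed
  interpret T: diagram_morphism C G E ?H T ?\<tau> by unfold_locales (rule \<tau>)
  interpret R: diagram_morphism E ?H C G R "\<lambda>e x. x"
    by unfold_locales (simp add: diagram_map_def diagram_comp_def hom_def)
  let ?f = "replacement_map E ?H T ?\<tau>" and ?g = "replacement_map C G R (\<lambda>e x. x)"
  interpret RT: diagram_morphism C G C G "comp_funct R T" ?\<tau>
    using diagram_morphism_comp[OF T.diagram_morphism_axioms R.diagram_morphism_axioms] .
  interpret TR: diagram_morphism E ?H E ?H "comp_funct T R" "\<lambda>e. ?\<tau> (FOb R e)"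
    using diagram_morphism_comp[OF R.diagram_morphism_axioms T.diagram_morphism_axioms] .
  interpret IC: diagram_morphism C G C G id_funct "\<lambda>c x. x"
    by (rule diagram_morphism_id[OF C.category_diagram_axioms])
  interpret IE: diagram_morphism E ?H E ?H id_funct "\<lambda>c x. x"
    by (rule diagram_morphism_id[OF E.category_diagram_axioms])
  interpret unit: diagram_homotopy C G C G id_funct "comp_funct R T" \<eta> "\<lambda>c x. x" ?\<tau>
    by unfold_locales (simp_all add: IC.\<tau> RT.\<tau>)
  interpret counit: diagram_homotopy E ?H E ?H "comp_funct T R" id_funct \<epsilon> "\<lambda>e. ?\<tau> (FOb R e)" "\<lambda>c x. x"
  proof (unfold_locales, rule TR.\<tau>, rule IE.\<tau>)
    fix e x assume e: "e \<in> Ob E" and x: "x \<in> carrier (GOb ?H e)"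
    have "GAr G (FAr R (\<epsilon> e)) (GAr G (\<eta> (FOb R e)) x) = GAr G (Cmp C (FAr R (\<epsilon> e)) (\<eta> (FOb R e))) x"
    proof (rule C.gar_cmp[symmetric])
      show "\<eta> (FOb R e) \<in> Ar C" using e by (simp add: \<eta>.component_closed R.fob_closed)
      show "FAr R (\<epsilon> e) \<in> Ar C" using e by (simp add: \<epsilon>.component_closed R.far_closed)
      show "Cod C (\<eta> (FOb R e)) = Dom C (FAr R (\<epsilon> e))"
        using e \<eta>.component_cod[of "FOb R e"] \<epsilon>.component_dom[of e] \<epsilon>.component_closed[of e]
        by (simp add: R.fob_closed R.dom_far comp_funct_def)
      show "x \<in> carrier (GOb G (Dom C (\<eta> (FOb R e))))"
        using e x \<eta>.component_dom[of "FOb R e"] by (simp add: R.fob_closed id_funct_def diagram_comp_def)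
    qed
    then show "GAr ?H (\<epsilon> e) (?\<tau> (FOb R e) x) = x"
      using e x by (simp add: triangle diagram_comp_def C.gar_idn R.fob_closed)
  qed
  show ?thesis
    unfolding nonabelian_homology_def
  proof (rule homology_iso_of_inverse[OF C.simplicial_group_replacement E.simplicial_group_replacement
        T.semisimplicial_hom R.semisimplicial_hom])
    interpret X: simplicial_group ?X by (rule C.simplicial_group_replacement)
    interpret Y: simplicial_group ?Y by (rule E.simplicial_group_replacement)
    show "homologous ?X n (?g n (?f n z)) z" if z: "z \<in> moore_cycles ?X n" for z
      using homotopic_homologous[OF C.simplicial_group_replacement C.simplicial_group_replacement
          RT.semisimplicial_hom unit.replacement_maps_homotopic z]
        replacement_map_comp[OF T.diagram_morphism_axioms R.diagram_morphism_axioms X.moore_cycles_carrier[OF z]]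
        replacement_map_id[OF C.category_diagram_axioms X.moore_cycles_carrier[OF z]]
      by simp
    show "homologous ?Y n (?f n (?g n z)) z" if z: "z \<in> moore_cycles ?Y n" for z
    proof -
      interpret L: group "Lev ?Y n" by (rule Y.level_group)
      have zc: "z \<in> carrier (Lev ?Y n)" by (rule Y.moore_cycles_carrier[OF z])
      have wc: "?f n (?g n z) \<in> carrier (Lev ?Y n)"
        by (intro hom_in_carrier[OF T.replacement_map_hom] hom_in_carrier[OF R.replacement_map_hom] zc)
      have "homologous ?Y n z (?f n (?g n z))"
        using homotopic_homologous[OF E.simplicial_group_replacement E.simplicial_group_replacement
            IE.semisimplicial_hom counit.replacement_maps_homotopic z]
          replacement_map_comp[OF R.diagram_morphism_axioms T.diagram_morphism_axioms zc]
          replacement_map_id[OF E.category_diagram_axioms zc]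
        by simp
      then have "inv\<^bsub>Lev ?Y n\<^esub> (z \<otimes>\<^bsub>Lev ?Y n\<^esub> inv\<^bsub>Lev ?Y n\<^esub> ?f n (?g n z)) \<in> moore_boundaries ?Y n"
        by (rule subgroup.m_inv_closed[OF Y.moore_boundaries_subgroup])
      then show ?thesis using zc wc by (simp add: L.inv_mult_group)
    qed
  qed
qed

text \<open>The last two assumptions say that \<open>L\<close> is the left Kan extension of \<open>H\<close> along \<open>P\<close>, in the form of free products
  over the fibres.\<close>

locale discrete_opfibration =
  E: category_diagram E H + D: category_diagram D L + P: cat_functor E D P
  for E :: "('e, 'a) cat" and H :: "('e, 'a, 'g) diagram" and D :: "('p, 'q) cat"
    and L :: "('p, 'q, ('e \<times> 'g) list set) diagram" and P :: "('e, 'a, 'p, 'q) funct" +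
  assumes unique_lift: "\<lbrakk>e \<in> Ob E; \<alpha> \<in> Ar D; Dom D \<alpha> = FOb P e\<rbrakk> \<Longrightarrow>
      \<exists>!a. a \<in> Ar E \<and> Dom E a = e \<and> FAr P a = \<alpha>"
    and L_ob: "d \<in> Ob D \<Longrightarrow> GOb L d = free_product {e \<in> Ob E. FOb P e = d} (GOb H)"
    and L_arr: "\<lbrakk>a \<in> Ar E; x \<in> carrier (GOb H (Dom E a))\<rbrakk> \<Longrightarrow>
      GAr L (FAr P a) (fp_in {e \<in> Ob E. FOb P e = FOb P (Dom E a)} (GOb H) (Dom E a) x)
        = fp_in {e \<in> Ob E. FOb P e = FOb P (Cod E a)} (GOb H) (Cod E a) (GAr H a x)"
begin

abbreviation fiber :: "'p \<Rightarrow> 'e set" where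
  "fiber d \<equiv> {e \<in> Ob E. FOb P e = d}"

definition lift :: "'e \<Rightarrow> 'q \<Rightarrow> 'a" where
  "lift e \<alpha> = (THE a. a \<in> Ar E \<and> Dom E a = e \<and> FAr P a = \<alpha>)"

primrec lift_path :: "'e \<Rightarrow> 'q list \<Rightarrow> 'a list" where
  "lift_path e [] = []"
| "lift_path e (\<alpha> # as) = lift e \<alpha> # lift_path (Cod E (lift e \<alpha>)) as"

lemma lift:
  assumes "e \<in> Ob E" "\<alpha> \<in> Ar D" "Dom D \<alpha> = FOb P e"
  shows "lift e \<alpha> \<in> Ar E" "Dom E (lift e \<alpha>) = e" "FAr P (lift e \<alpha>) = \<alpha>"
  using theI'[OF unique_lift[OF assms]] by (simp_all add: lift_def)

lemma lift_FAr:
  assumes "a \<in> Ar E"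
  shows "lift (Dom E a) (FAr P a) = a"
  unfolding lift_def using assms
  by (intro the1_equality unique_lift) (simp_all add: E.dom_closed P.far_closed P.dom_far)

lemma lift_path:
  assumes "e \<in> Ob E" "composable D (FOb P e) as"
  shows "composable E e (lift_path e as) \<and> map (FAr P) (lift_path e as) = as"
  using assms
proof (induction as arbitrary: e)
  case Nil
  then show ?case by simp
next
  case (Cons \<alpha> as)
  then have \<alpha>: "\<alpha> \<in> Ar D" "Dom D \<alpha> = FOb P e" and as: "composable D (Cod D \<alpha>) as" by auto
  note l = lift[OF Cons.prems(1) \<alpha>]
  have "FOb P (Cod E (lift e \<alpha>)) = Cod D \<alpha>" using P.cod_far[OF l(1)] l(3) by simp
  then show ?case using Cons.IH[of "Cod E (lift e \<alpha>)"] Cons.prems as l by (simp add: E.cod_closed)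
qed

lemma lift_path_map: "composable E e as \<Longrightarrow> lift_path e (map (FAr P) as) = as"
  by (induction as arbitrary: e) (auto simp: lift_FAr)

lemma fiber_group_family: "group_family (fiber d) (GOb H)"
  by (rule group_family.intro) (simp add: E.gob_group)

lemma inclusion: "diagram_morphism E H D L P (\<lambda>e. fp_in (fiber (FOb P e)) (GOb H) e)"
proof unfold_locales
  show "diagram_map E H (diagram_comp L P) (\<lambda>e. fp_in (fiber (FOb P e)) (GOb H) e)"
    unfolding diagram_map_def
  proof (intro conjI ballI)
    show "fp_in (fiber (FOb P e)) (GOb H) e \<in> hom (GOb H e) (GOb (diagram_comp L P) e)" if "e \<in> Ob E" for e
      using group_family.fp_in_hom[OF fiber_group_family, of e "FOb P e"] that
      by (simp add: diagram_comp_def L_ob P.fob_closed)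
    show "fp_in (fiber (FOb P (Cod E a))) (GOb H) (Cod E a) (GAr H a x)
        = GAr (diagram_comp L P) a (fp_in (fiber (FOb P (Dom E a))) (GOb H) (Dom E a) x)"
      if "a \<in> Ar E" "x \<in> carrier (GOb H (Dom E a))" for a x
      using L_arr[OF that] by (simp add: diagram_comp_def)
  qed
qed

text \<open>A free product over \<open>n\<close>-simplices \<open>\<sigma>\<close> of \<open>D\<close> of free products over the fibre at the first vertex of \<open>\<sigma>\<close> is a
  free product over pairs \<open>(\<sigma>, e)\<close>, that is, over \<open>n\<close>-simplices of \<open>E\<close> by unique path lifting.\<close>

theorem opfibration_homology: "nonabelian_homology E H n \<cong> nonabelian_homology D L n"
proof -
  interpret P: diagram_morphism E H D L P "\<lambda>e. fp_in (fiber (FOb P e)) (GOb H) e" by (rule inclusion)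
  let ?X = "simplicial_replacement E H" and ?Y = "simplicial_replacement D L"
  let ?f = "replacement_map D L P (\<lambda>e. fp_in (fiber (FOb P e)) (GOb H) e)"
  let ?inX = "\<lambda>n. fp_in (nerve E n) (simplex_factor H)" and ?inY = "\<lambda>n. fp_in (nerve D n) (simplex_factor L)"
  \<comment> \<open>The inverse \<open>?g\<close> takes the factor at \<open>(\<sigma>, e)\<close> to the factor at the lift of \<open>\<sigma>\<close> that starts in \<open>e\<close>.\<close>
  let ?u = "\<lambda>n \<sigma> e. ?inX n (e, lift_path e (snd \<sigma>))"
  let ?g = "\<lambda>n. fp_lift (Lev ?X n) (\<lambda>\<sigma>. fp_lift (Lev ?X n) (?u n \<sigma>))"
  have in_fiber: "(e, lift_path e (snd \<sigma>)) \<in> nerve E n \<and> map (FAr P) (lift_path e (snd \<sigma>)) = snd \<sigma>"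
    if "\<sigma> \<in> nerve D n" "e \<in> fiber (fst \<sigma>)" for n \<sigma> e
  proof -
    have "composable D (FOb P e) (snd \<sigma>)" "length (snd \<sigma>) = n" using that by (auto simp: nerve_def)
    then have "composable E e (lift_path e (snd \<sigma>)) \<and> map (FAr P) (lift_path e (snd \<sigma>)) = snd \<sigma>"
      using lift_path[of e "snd \<sigma>"] that by simp
    then show ?thesis using \<open>length (snd \<sigma>) = n\<close>
      by (auto simp: nerve_def) (metis length_map)
  qed
  have fst_D: "fst \<sigma> \<in> Ob D" if "\<sigma> \<in> nerve D n" for \<sigma> n using that by (simp add: D.nerve_iff)
  have Y_factor: "GOb L (fst \<sigma>) = free_product (fiber (fst \<sigma>)) (GOb H)" if "\<sigma> \<in> nerve D n" for \<sigma> n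
    by (rule L_ob[OF fst_D[OF that]])
  have u: "?u n \<sigma> e \<in> hom (GOb H e) (Lev ?X n)" if "\<sigma> \<in> nerve D n" "e \<in> fiber (fst \<sigma>)" for n \<sigma> e
    using group_family.fp_in_hom[OF E.nerve_group_family, of "(e, lift_path e (snd \<sigma>))" n] in_fiber[OF that]
    by (simp add: Lev_simplicial_replacement)
  have g1: "fp_lift (Lev ?X n) (?u n \<sigma>) \<in> hom (GOb L (fst \<sigma>)) (Lev ?X n)" if "\<sigma> \<in> nerve D n" for n \<sigma>
    unfolding Y_factor[OF that]
    by (rule group_family.fp_lift_hom[OF fiber_group_family E.replacement_level_group u[OF that]])
  have g: "?g n \<in> hom (Lev ?Y n) (Lev ?X n)" for n
    unfolding Lev_simplicial_replacement[of D]
    by (rule group_family.fp_lift_hom[OF D.nerve_group_family E.replacement_level_group g1])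
  have g_in: "?g n (?inY n \<sigma> (fp_in (fiber (fst \<sigma>)) (GOb H) e x)) = ?inX n (e, lift_path e (snd \<sigma>)) x"
    if \<sigma>: "\<sigma> \<in> nerve D n" and e: "e \<in> fiber (fst \<sigma>)" and x: "x \<in> carrier (GOb H e)" for n \<sigma> e x
  proof -
    have w: "fp_in (fiber (fst \<sigma>)) (GOb H) e x \<in> carrier (GOb L (fst \<sigma>))"
      unfolding Y_factor[OF \<sigma>] by (rule group_family.fp_in_closed[OF fiber_group_family e x])
    have "?g n (?inY n \<sigma> (fp_in (fiber (fst \<sigma>)) (GOb H) e x)) = fp_lift (Lev ?X n) (?u n \<sigma>) (fp_in (fiber (fst \<sigma>)) (GOb H) e x)"
      by (rule group_family.fp_lift_in[OF D.nerve_group_family E.replacement_level_group g1 \<sigma> w])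
    also have "\<dots> = ?u n \<sigma> e x"
      by (rule group_family.fp_lift_in[OF fiber_group_family E.replacement_level_group u[OF \<sigma>] e x])
    finally show ?thesis .
  qed
  have f_in: "?f n (?inX n (e, as) x) = ?inY n (FOb P e, map (FAr P) as) (fp_in (fiber (FOb P e)) (GOb H) e x)"
    if "(e, as) \<in> nerve E n" "x \<in> carrier (GOb H e)" for n e as x
    using P.replacement_map_in[OF that(1)] that(2) by simp
  show ?thesis
    unfolding nonabelian_homology_def
  proof (rule homology_iso_of_level_iso[OF E.simplicial_group_replacement D.simplicial_group_replacement
        P.semisimplicial_hom g])
    show "?g n (?f n A) = A" if A: "A \<in> carrier (Lev ?X n)" for n A
    proof -
      have "(?g n \<circ> ?f n) A = (\<lambda>A. A) A"
      proof (rule E.replacement_hom_eqI[OF E.replacement_level_group hom_compose[OF P.replacement_map_hom g] _ _ A])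
        fix \<sigma> x assume *: "\<sigma> \<in> nerve E n" "x \<in> carrier (GOb H (fst \<sigma>))"
        obtain e as where \<sigma>: "\<sigma> = (e, as)" by (cases \<sigma>)
        have e: "e \<in> fiber (FOb P e)" using * by (simp add: \<sigma> E.nerve_iff)
        have "lift_path e (map (FAr P) as) = as" using * by (simp add: \<sigma> nerve_def lift_path_map)
        moreover have "(FOb P e, map (FAr P) as) \<in> nerve D n"
          using P.nerve_image[OF *(1)] by (simp add: \<sigma>)
        ultimately show "(?g n \<circ> ?f n) (?inX n \<sigma> x) = ?inX n \<sigma> x"
          using g_in[of "(FOb P e, map (FAr P) as)" n e x] f_in[of e as n x] e * by (simp add: \<sigma>)
      qed (simp add: hom_def)
      then show ?thesis by simp
    qed
    show "?f n (?g n A) = A" if A: "A \<in> carrier (Lev ?Y n)" for n A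
    proof -
      have "(?f n \<circ> ?g n) A = (\<lambda>A. A) A"
      proof (rule D.replacement_hom_eqI[OF D.replacement_level_group hom_compose[OF g P.replacement_map_hom] _ _ A])
        fix \<sigma> w assume *: "\<sigma> \<in> nerve D n" "w \<in> carrier (GOb L (fst \<sigma>))"
        have inY: "?inY n \<sigma> \<in> hom (GOb L (fst \<sigma>)) (Lev ?Y n)"
          using group_family.fp_in_hom[OF D.nerve_group_family *(1)] by (simp add: Lev_simplicial_replacement)
        have "((?f n \<circ> ?g n) \<circ> ?inY n \<sigma>) w = ?inY n \<sigma> w"
        proof (rule group_family.free_product_hom_eqI[OF fiber_group_family D.replacement_level_group])
          show "((?f n \<circ> ?g n) \<circ> ?inY n \<sigma>) \<in> hom (free_product (fiber (fst \<sigma>)) (GOb H)) (Lev ?Y n)"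
            using hom_compose[OF inY hom_compose[OF g P.replacement_map_hom]] by (simp add: Y_factor[OF *(1)])
          show "?inY n \<sigma> \<in> hom (free_product (fiber (fst \<sigma>)) (GOb H)) (Lev ?Y n)"
            using inY by (simp add: Y_factor[OF *(1)])
          show "w \<in> carrier (free_product (fiber (fst \<sigma>)) (GOb H))" using *(2) by (simp add: Y_factor[OF *(1)])
          fix e x assume ex: "e \<in> fiber (fst \<sigma>)" "x \<in> carrier (GOb H e)"
          show "((?f n \<circ> ?g n) \<circ> ?inY n \<sigma>) (fp_in (fiber (fst \<sigma>)) (GOb H) e x)
              = ?inY n \<sigma> (fp_in (fiber (fst \<sigma>)) (GOb H) e x)"
            using g_in[OF *(1) ex] f_in[of e "lift_path e (snd \<sigma>)" n x] in_fiber[OF *(1) ex(1)] ex by simp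
        qed
        then show "(?f n \<circ> ?g n) (?inY n \<sigma> w) = ?inY n \<sigma> w" by simp
      qed (simp add: hom_def)
      then show ?thesis by simp
    qed
  qed
qed

end

section \<open>Virtual discrete cofibrations\<close>

locale virtual_cofibration =
  C: category C + D: category D + S: cat_functor C D S
  for C :: "('o, 'm) cat" and D :: "('p, 'q) cat" and S :: "('o, 'm, 'p, 'q) funct" +
  fixes fin :: "'p \<Rightarrow> ('o \<times> 'q) set"
  assumes is_fin: "d \<in> Ob D \<Longrightarrow> is_fin (comma C D S d) (fin d)"
begin

text \<open>The objects of all the categories \<open>S \<down> d\<close> together; \<open>d\<close> is recovered as the codomain of the second component.\<close>

definition over :: "('o \<times> 'q) set" where
  "over = {(c, b). c \<in> Ob C \<and> b \<in> Ar D \<and> Dom D b = FOb S c}"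

definition final_of :: "'o \<times> 'q \<Rightarrow> 'o \<times> 'q" where
  "final_of \<gamma> = fin_obj (comma C D S (Cod D (snd \<gamma>))) (fin (Cod D (snd \<gamma>))) \<gamma>"

text \<open>Only the underlying arrow of \<open>C\<close> is kept.\<close>

definition to_final :: "'o \<times> 'q \<Rightarrow> 'm" where
  "to_final \<gamma> = FAr comma_forget (fin_arr (comma C D S (Cod D (snd \<gamma>))) (fin (Cod D (snd \<gamma>))) \<gamma>)"

lemma over_iff: "\<gamma> \<in> over \<longleftrightarrow> fst \<gamma> \<in> Ob C \<and> snd \<gamma> \<in> Ar D \<and> Dom D (snd \<gamma>) = FOb S (fst \<gamma>)"
  by (cases \<gamma>) (simp add: over_def)

lemma Ob_comma: "\<gamma> \<in> Ob (comma C D S d) \<longleftrightarrow> \<gamma> \<in> over \<and> Cod D (snd \<gamma>) = d"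
  by (cases \<gamma>) (auto simp: comma_def Let_def over_def)

lemma Ar_comma: "a \<in> Ar (comma C D S d) \<and> Dom (comma C D S d) a = \<gamma> \<and> Cod (comma C D S d) a = t \<longleftrightarrow>
  (\<exists>f. a = (\<gamma>, f, t) \<and> \<gamma> \<in> over \<and> Cod D (snd \<gamma>) = d \<and> t \<in> over \<and> Cod D (snd t) = d \<and> f \<in> Ar C
     \<and> Dom C f = fst \<gamma> \<and> Cod C f = fst t \<and> Cmp D (snd t) (FAr S f) = snd \<gamma>)"
  by (cases a; cases \<gamma>; cases t) (auto simp: comma_def Let_def over_def)

lemma fin_over:
  assumes "d \<in> Ob D" "t \<in> fin d"
  shows "t \<in> over" "Cod D (snd t) = d"
  using is_fin[OF assms(1)] assms(2) Ob_comma[of t d] by (auto simp: is_fin_def final_in_component_def)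

text \<open>Final objects of components, restated as unique factorization: an arrow of \<open>S \<down> d\<close> from \<open>\<gamma>\<close> to some
  \<open>t \<in> fin d\<close> connects the two, which leaves one choice for \<open>t\<close> and, by finality, one for the arrow.\<close>

lemma
  assumes \<gamma>: "\<gamma> \<in> over"
  shows final_of_fin: "final_of \<gamma> \<in> fin (Cod D (snd \<gamma>))"
    and to_final_arr: "to_final \<gamma> \<in> Ar C" "Dom C (to_final \<gamma>) = fst \<gamma>" "Cod C (to_final \<gamma>) = fst (final_of \<gamma>)"
    and final_factor: "Cmp D (snd (final_of \<gamma>)) (FAr S (to_final \<gamma>)) = snd \<gamma>"
    and final_unique: "\<And>t f. \<lbrakk>t \<in> fin (Cod D (snd \<gamma>)); f \<in> Ar C; Dom C f = fst \<gamma>; Cod C f = fst t;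
      Cmp D (snd t) (FAr S f) = snd \<gamma>\<rbrakk> \<Longrightarrow> final_of \<gamma> = t \<and> to_final \<gamma> = f"
proof -
  let ?d = "Cod D (snd \<gamma>)"
  let ?B = "comma C D S ?d"
  have d: "?d \<in> Ob D" using \<gamma> by (simp add: over_iff D.cod_closed)
  have ex1: "\<exists>!t. t \<in> fin ?d \<and> connected_objects ?B \<gamma> t"
    using is_fin[OF d] \<gamma> by (auto simp: is_fin_def Ob_comma)
  have t: "final_of \<gamma> \<in> fin ?d" "connected_objects ?B \<gamma> (final_of \<gamma>)"
    using theI'[OF ex1] by (simp_all add: final_of_def fin_obj_def)
  show "final_of \<gamma> \<in> fin ?d" by (rule t(1))
  have exa: "\<exists>!a. a \<in> Ar ?B \<and> Dom ?B a = \<gamma> \<and> Cod ?B a = final_of \<gamma>"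
  proof -
    have "final_in_component ?B (final_of \<gamma>)" using is_fin[OF d] t(1) unfolding is_fin_def by blast
    then show ?thesis using t(2) unfolding final_in_component_def by blast
  qed
  let ?a = "fin_arr ?B (fin ?d) \<gamma>"
  have a_def: "?a = (THE a. a \<in> Ar ?B \<and> Dom ?B a = \<gamma> \<and> Cod ?B a = final_of \<gamma>)"
    by (simp add: fin_arr_def final_of_def)
  have "?a \<in> Ar ?B \<and> Dom ?B ?a = \<gamma> \<and> Cod ?B ?a = final_of \<gamma>"
    unfolding a_def by (rule theI'[OF exa])
  then obtain f where a: "?a = (\<gamma>, f, final_of \<gamma>)"
    and f: "f \<in> Ar C" "Dom C f = fst \<gamma>" "Cod C f = fst (final_of \<gamma>)" "Cmp D (snd (final_of \<gamma>)) (FAr S f) = snd \<gamma>"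
    unfolding Ar_comma by blast
  have tf: "to_final \<gamma> = f" by (simp add: to_final_def a comma_forget_def)
  show "to_final \<gamma> \<in> Ar C" "Dom C (to_final \<gamma>) = fst \<gamma>" "Cod C (to_final \<gamma>) = fst (final_of \<gamma>)"
    "Cmp D (snd (final_of \<gamma>)) (FAr S (to_final \<gamma>)) = snd \<gamma>"
    using f by (simp_all add: tf)
  fix t g assume g: "t \<in> fin ?d" "g \<in> Ar C" "Dom C g = fst \<gamma>" "Cod C g = fst t" "Cmp D (snd t) (FAr S g) = snd \<gamma>"
  have arr: "(\<gamma>, g, t) \<in> Ar ?B \<and> Dom ?B (\<gamma>, g, t) = \<gamma> \<and> Cod ?B (\<gamma>, g, t) = t"
    unfolding Ar_comma using g \<gamma> fin_over[OF d g(1)] by blast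
  have "connected_objects ?B \<gamma> t"
    unfolding connected_objects_def
  proof (intro conjI r_into_rtrancl)
    show "\<gamma> \<in> Ob ?B" "t \<in> Ob ?B" using \<gamma> fin_over[OF d g(1)] by (simp_all add: Ob_comma)
    show "(\<gamma>, t) \<in> {(Dom ?B f, Cod ?B f) |f. f \<in> Ar ?B} \<union> {(Cod ?B f, Dom ?B f) |f. f \<in> Ar ?B}"
      by (intro UnI1 CollectI exI[of _ "(\<gamma>, g, t)"]) (use arr in simp)
  qed
  then have t': "final_of \<gamma> = t" using ex1 t g(1) by blast
  then have "?a = (\<gamma>, g, t)" unfolding a_def using arr by (intro the1_equality[OF exa]) simp
  then show "final_of \<gamma> = t \<and> to_final \<gamma> = g" using a t' tf by simp
qed

lemma final_of_over:
  assumes "\<gamma> \<in> over"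
  shows "final_of \<gamma> \<in> over" "Cod D (snd (final_of \<gamma>)) = Cod D (snd \<gamma>)"
  using fin_over[OF _ final_of_fin[OF assms]] assms by (simp_all add: over_iff D.cod_closed)

lemma final_of_self:
  assumes "d \<in> Ob D" "t \<in> fin d"
  shows "final_of t = t" "to_final t = Idn C (fst t)"
proof -
  note t = fin_over[OF assms]
  have "Cmp D (snd t) (FAr S (Idn C (fst t))) = snd t"
    using t D.cmp_idn_right[of "snd t"] by (simp add: over_iff S.far_idn)
  then have "final_of t = t \<and> to_final t = Idn C (fst t)"
    using assms t by (intro final_unique) (simp_all add: over_iff C.idn_closed C.dom_idn C.cod_idn)
  then show "final_of t = t" "to_final t = Idn C (fst t)" by auto
qed

lemma final_of_precompose:
  assumes \<gamma>: "(c, b) \<in> over" and f: "f \<in> Ar C" "Cod C f = c"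
  shows "final_of (Dom C f, Cmp D b (FAr S f)) = final_of (c, b)"
    and "to_final (Dom C f, Cmp D b (FAr S f)) = Cmp C (to_final (c, b)) f"
proof -
  let ?\<gamma> = "(Dom C f, Cmp D b (FAr S f))"
  note [simp] = S.far_closed S.dom_far S.cod_far C.dom_closed C.cmp_closed C.dom_cmp C.cod_cmp D.cmp_closed D.dom_cmp D.cod_cmp
  have \<gamma>': "?\<gamma> \<in> over" "Cod D (snd ?\<gamma>) = Cod D b"
    using \<gamma> f by (simp_all add: over_iff)
  note u = to_final_arr[OF \<gamma>]
  have t: "final_of (c, b) \<in> over" by (rule final_of_over[OF \<gamma>])
  have "final_of ?\<gamma> = final_of (c, b) \<and> to_final ?\<gamma> = Cmp C (to_final (c, b)) f"
  proof (rule final_unique[OF \<gamma>'(1)])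
    show "final_of (c, b) \<in> fin (Cod D (snd ?\<gamma>))" using final_of_fin[OF \<gamma>] \<gamma>'(2) by simp
    have "Cmp D (snd (final_of (c, b))) (FAr S (Cmp C (to_final (c, b)) f))
        = Cmp D (Cmp D (snd (final_of (c, b))) (FAr S (to_final (c, b)))) (FAr S f)"
      using u f t D.cmp_assoc[of "FAr S f" "FAr S (to_final (c, b))" "snd (final_of (c, b))"]
      by (simp add: S.far_cmp over_iff)
    then show "Cmp D (snd (final_of (c, b))) (FAr S (Cmp C (to_final (c, b)) f)) = snd ?\<gamma>"
      using final_factor[OF \<gamma>] by simp
  qed (use u f in simp_all)
  then show "final_of ?\<gamma> = final_of (c, b)" "to_final ?\<gamma> = Cmp C (to_final (c, b)) f" by auto
qed

lemma over_postcompose: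
  assumes "(c, b) \<in> over" "\<alpha> \<in> Ar D" "Dom D \<alpha> = Cod D b"
  shows "(c, Cmp D \<alpha> b) \<in> over"
  using assms by (simp add: over_iff D.cmp_closed D.dom_cmp)

text \<open>If \<open>b = b' \<circ> S u\<close> then \<open>\<alpha> b = (\<alpha> b') \<circ> S u\<close>, so this is an instance of precomposition.\<close>

lemma final_of_postcompose:
  assumes \<gamma>: "(c, b) \<in> over" and \<alpha>: "\<alpha> \<in> Ar D" "Dom D \<alpha> = Cod D b" and t: "final_of (c, b) = (c', b')"
  shows "final_of (c, Cmp D \<alpha> b) = final_of (c', Cmp D \<alpha> b')"
    and "to_final (c, Cmp D \<alpha> b) = Cmp C (to_final (c', Cmp D \<alpha> b')) (to_final (c, b))"
proof -
  note u = to_final_arr[OF \<gamma>]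
  have t': "(c', b') \<in> over" "Cod D b' = Cod D b" using final_of_over[OF \<gamma>] by (simp_all add: t)
  have "(c', Cmp D \<alpha> b') \<in> over" using over_postcompose[OF t'(1) \<alpha>(1)] \<alpha>(2) t'(2) by simp
  moreover have "Cmp D (Cmp D \<alpha> b') (FAr S (to_final (c, b))) = Cmp D \<alpha> b"
    using final_factor[OF \<gamma>] D.cmp_assoc[of "FAr S (to_final (c, b))" b' \<alpha>] u t' \<alpha>
    by (simp add: over_iff t S.far_closed S.cod_far)
  ultimately show "final_of (c, Cmp D \<alpha> b) = final_of (c', Cmp D \<alpha> b')"
    "to_final (c, Cmp D \<alpha> b) = Cmp C (to_final (c', Cmp D \<alpha> b')) (to_final (c, b))"
    using final_of_precompose[of c' "Cmp D \<alpha> b'" "to_final (c, b)"] u by (simp_all add: t)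
qed

definition push :: "'q \<Rightarrow> 'o \<times> 'q \<Rightarrow> 'o \<times> 'q" where
  "push \<alpha> \<beta> = (fst \<beta>, Cmp D \<alpha> (snd \<beta>))"

text \<open>The category of elements of \<open>d \<mapsto> fin(S \<down> d)\<close>. An arrow is determined by its source \<open>\<beta>\<close> and the arrow \<open>\<alpha>\<close> of
  \<open>D\<close> below it; its target is the final object of the component of \<open>\<alpha>\<beta>\<close>.\<close>

definition Elts :: "('o \<times> 'q, ('o \<times> 'q) \<times> 'q) cat" where
  "Elts = \<lparr>Ob = (\<Union>d\<in>Ob D. fin d),
     Ar = {(\<beta>, \<alpha>). \<beta> \<in> (\<Union>d\<in>Ob D. fin d) \<and> \<alpha> \<in> Ar D \<and> Dom D \<alpha> = Cod D (snd \<beta>)},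
     Dom = fst, Cod = (\<lambda>(\<beta>, \<alpha>). final_of (push \<alpha> \<beta>)),
     Idn = (\<lambda>\<beta>. (\<beta>, Idn D (Cod D (snd \<beta>)))),
     Cmp = (\<lambda>(\<beta>', \<alpha>') (\<beta>, \<alpha>). (\<beta>, Cmp D \<alpha>' \<alpha>))\<rparr>"

lemma Ob_elements: "\<beta> \<in> Ob Elts \<longleftrightarrow> \<beta> \<in> over \<and> \<beta> \<in> fin (Cod D (snd \<beta>))"
  using fin_over[of _ \<beta>] by (auto simp: Elts_def over_iff D.cod_closed)

lemma Ar_elements: "(\<beta>, \<alpha>) \<in> Ar Elts \<longleftrightarrow> \<beta> \<in> Ob Elts \<and> \<alpha> \<in> Ar D \<and> Dom D \<alpha> = Cod D (snd \<beta>)"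
  by (simp add: Elts_def)

lemma elements_simps:
  "Dom Elts (\<beta>, \<alpha>) = \<beta>" "Cod Elts (\<beta>, \<alpha>) = final_of (push \<alpha> \<beta>)"
  "Idn Elts \<beta> = (\<beta>, Idn D (Cod D (snd \<beta>)))"
  "Cmp Elts (\<beta>', \<alpha>') (\<beta>, \<alpha>) = (\<beta>, Cmp D \<alpha>' \<alpha>)"
  by (simp_all add: Elts_def)

lemma final_of_element: "\<beta> \<in> Ob Elts \<Longrightarrow> final_of \<beta> = \<beta> \<and> to_final \<beta> = Idn C (fst \<beta>)"
  using final_of_self[of "Cod D (snd \<beta>)" \<beta>] by (simp add: Ob_elements over_iff D.cod_closed)

lemma push_over:
  assumes "(\<beta>, \<alpha>) \<in> Ar Elts"
  shows "push \<alpha> \<beta> \<in> over" "Cod D (snd (push \<alpha> \<beta>)) = Cod D \<alpha>"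
  using assms by (auto simp: Ar_elements Ob_elements over_iff push_def D.cmp_closed D.dom_cmp D.cod_cmp)

lemma push_closed:
  assumes "(\<beta>, \<alpha>) \<in> Ar Elts"
  shows "final_of (push \<alpha> \<beta>) \<in> Ob Elts" "Cod D (snd (final_of (push \<alpha> \<beta>))) = Cod D \<alpha>"
  using final_of_over[OF push_over(1)[OF assms]] final_of_fin[OF push_over(1)[OF assms]] push_over[OF assms]
  by (simp_all add: Ob_elements)

lemma push_idn: "\<beta> \<in> Ob Elts \<Longrightarrow> push (Idn D (Cod D (snd \<beta>))) \<beta> = \<beta>"
  by (simp add: push_def Ob_elements over_iff D.cmp_idn_left)

lemma push_push:
  assumes "(\<beta>, \<alpha>) \<in> Ar Elts" "\<alpha>' \<in> Ar D" "Dom D \<alpha>' = Cod D \<alpha>"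
  shows "final_of (push (Cmp D \<alpha>' \<alpha>) \<beta>) = final_of (push \<alpha>' (final_of (push \<alpha> \<beta>)))"
    and "to_final (push (Cmp D \<alpha>' \<alpha>) \<beta>)
      = Cmp C (to_final (push \<alpha>' (final_of (push \<alpha> \<beta>)))) (to_final (push \<alpha> \<beta>))"
proof -
  obtain c b where \<beta>: "\<beta> = (c, b)" by (cases \<beta>)
  have "Cmp D (Cmp D \<alpha>' \<alpha>) b = Cmp D \<alpha>' (Cmp D \<alpha> b)"
    using assms by (simp add: Ar_elements Ob_elements over_iff \<beta> D.cmp_assoc)
  moreover have "(c, Cmp D \<alpha> b) \<in> over" "Dom D \<alpha>' = Cod D (Cmp D \<alpha> b)"
    using push_over[OF assms(1)] assms(3) by (simp_all add: push_def \<beta>)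
  ultimately show "final_of (push (Cmp D \<alpha>' \<alpha>) \<beta>) = final_of (push \<alpha>' (final_of (push \<alpha> \<beta>)))"
    "to_final (push (Cmp D \<alpha>' \<alpha>) \<beta>)
      = Cmp C (to_final (push \<alpha>' (final_of (push \<alpha> \<beta>)))) (to_final (push \<alpha> \<beta>))"
    using final_of_postcompose[of c "Cmp D \<alpha> b" \<alpha>' "fst (final_of (c, Cmp D \<alpha> b))" "snd (final_of (c, Cmp D \<alpha> b))"] assms(2)
    by (simp_all add: push_def \<beta>)
qed

lemma category_elements: "category Elts"
proof
  fix f g h :: "('o \<times> 'q) \<times> 'q" and \<beta> :: "'o \<times> 'q"
  obtain \<beta>1 \<alpha>1 where f: "f = (\<beta>1, \<alpha>1)" by (cases f)
  obtain \<beta>2 \<alpha>2 where g: "g = (\<beta>2, \<alpha>2)" by (cases g)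
  obtain \<beta>3 \<alpha>3 where h: "h = (\<beta>3, \<alpha>3)" by (cases h)
  note [simp] = elements_simps D.idn_closed D.dom_idn D.cod_idn D.cod_closed D.cmp_closed D.dom_cmp D.cod_cmp
    D.cmp_idn_left D.cmp_idn_right
  show "f \<in> Ar Elts \<Longrightarrow> Dom Elts f \<in> Ob Elts" by (simp add: f Ar_elements)
  show "f \<in> Ar Elts \<Longrightarrow> Cod Elts f \<in> Ob Elts" by (simp add: f push_closed)
  show "\<beta> \<in> Ob Elts \<Longrightarrow> Idn Elts \<beta> \<in> Ar Elts"
    using Ob_elements[of \<beta>] by (simp add: Ar_elements over_iff)
  show "\<beta> \<in> Ob Elts \<Longrightarrow> Dom Elts (Idn Elts \<beta>) = \<beta>" by simp
  show "\<beta> \<in> Ob Elts \<Longrightarrow> Cod Elts (Idn Elts \<beta>) = \<beta>"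
    by (simp add: push_idn final_of_element)
  have cod: "Cod D \<alpha>1 = Dom D \<alpha>2"
    if "f \<in> Ar Elts" "g \<in> Ar Elts" "Cod Elts f = Dom Elts g"
    using that push_closed(2)[of \<beta>1 \<alpha>1] by (simp add: f g Ar_elements)
  show "f \<in> Ar Elts \<Longrightarrow> g \<in> Ar Elts \<Longrightarrow> Cod Elts f = Dom Elts g \<Longrightarrow>
      Cmp Elts g f \<in> Ar Elts"
    using cod by (simp add: f g Ar_elements)
  show "f \<in> Ar Elts \<Longrightarrow> g \<in> Ar Elts \<Longrightarrow> Cod Elts f = Dom Elts g \<Longrightarrow>
      Dom Elts (Cmp Elts g f) = Dom Elts f" by (simp add: f g)
  show "f \<in> Ar Elts \<Longrightarrow> g \<in> Ar Elts \<Longrightarrow> Cod Elts f = Dom Elts g \<Longrightarrow>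
      Cod Elts (Cmp Elts g f) = Cod Elts g"
    using cod push_push(1)[of \<beta>1 \<alpha>1 \<alpha>2] by (simp add: f g Ar_elements)
  show "f \<in> Ar Elts \<Longrightarrow> Cmp Elts f (Idn Elts (Dom Elts f)) = f"
    using D.cmp_idn_right[of \<alpha>1] by (simp add: f Ar_elements)
  show "f \<in> Ar Elts \<Longrightarrow> Cmp Elts (Idn Elts (Cod Elts f)) f = f"
    using push_closed(2)[of \<beta>1 \<alpha>1] by (simp add: f Ar_elements)
  have cod': "Cod D \<alpha>2 = Dom D \<alpha>3"
    if "g \<in> Ar Elts" "h \<in> Ar Elts" "Cod Elts g = Dom Elts h"
    using that push_closed(2)[of \<beta>2 \<alpha>2] by (simp add: g h Ar_elements)
  show "f \<in> Ar Elts \<Longrightarrow> g \<in> Ar Elts \<Longrightarrow> h \<in> Ar Elts \<Longrightarrow>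
      Cod Elts f = Dom Elts g \<Longrightarrow> Cod Elts g = Dom Elts h \<Longrightarrow>
      Cmp Elts h (Cmp Elts g f) = Cmp Elts (Cmp Elts h g) f"
    using cod cod' by (simp add: f g h Ar_elements D.cmp_assoc)
qed

sublocale E: category Elts by (rule category_elements)

definition elements_to_base :: "('o \<times> 'q, ('o \<times> 'q) \<times> 'q, 'p, 'q) funct" where
  "elements_to_base = \<lparr>FOb = (\<lambda>\<beta>. Cod D (snd \<beta>)), FAr = snd\<rparr>"

definition right_adj :: "('o \<times> 'q, ('o \<times> 'q) \<times> 'q, 'o, 'm) funct" where
  "right_adj = \<lparr>FOb = fst, FAr = (\<lambda>(\<beta>, \<alpha>). to_final (push \<alpha> \<beta>))\<rparr>"

definition unit_obj :: "'o \<Rightarrow> 'o \<times> 'q" where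
  "unit_obj c = (c, Idn D (FOb S c))"

definition left_adj :: "('o, 'm, 'o \<times> 'q, ('o \<times> 'q) \<times> 'q) funct" where
  "left_adj = \<lparr>FOb = (\<lambda>c. final_of (unit_obj c)), FAr = (\<lambda>f. (final_of (unit_obj (Dom C f)), FAr S f))\<rparr>"

lemma unit_obj_over: "c \<in> Ob C \<Longrightarrow> unit_obj c \<in> over \<and> Cod D (snd (unit_obj c)) = FOb S c"
  by (simp add: unit_obj_def over_iff S.fob_closed D.idn_closed D.dom_idn D.cod_idn)

lemma left_adj_ob:
  assumes "c \<in> Ob C"
  shows "final_of (unit_obj c) \<in> Ob Elts" "Cod D (snd (final_of (unit_obj c))) = FOb S c"
  using unit_obj_over[OF assms] final_of_over[of "unit_obj c"] final_of_fin[of "unit_obj c"]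
  by (simp_all add: Ob_elements)

text \<open>Factoring \<open>b = b \<circ> id\<close> in two ways: directly, and by factoring the identity first.\<close>

lemma push_unit:
  assumes "(c, b) \<in> over"
  shows "final_of (push b (final_of (unit_obj c))) = final_of (c, b)"
    and "Cmp C (to_final (push b (final_of (unit_obj c)))) (to_final (unit_obj c)) = to_final (c, b)"
proof -
  have "Cmp D b (Idn D (FOb S c)) = b"
    using assms D.cmp_idn_right[of b] by (simp add: over_iff)
  then show "final_of (push b (final_of (unit_obj c))) = final_of (c, b)"
    "Cmp C (to_final (push b (final_of (unit_obj c)))) (to_final (unit_obj c)) = to_final (c, b)"
    using final_of_postcompose[of c "Idn D (FOb S c)" b "fst (final_of (unit_obj c))" "snd (final_of (unit_obj c))"]
      unit_obj_over[of c] assms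
    by (simp_all add: push_def unit_obj_def over_iff)
qed

lemma final_of_image:
  assumes "f \<in> Ar C"
  shows "final_of (Dom C f, FAr S f) = final_of (unit_obj (Cod C f))"
    and "to_final (Dom C f, FAr S f) = Cmp C (to_final (unit_obj (Cod C f))) f"
  using final_of_precompose[of "Cod C f" "Idn D (FOb S (Cod C f))" f] unit_obj_over[of "Cod C f"] assms
    D.cmp_idn_left[of "FAr S f"]
  by (simp_all add: unit_obj_def C.cod_closed S.far_closed S.cod_far)

lemma image_over: "f \<in> Ar C \<Longrightarrow> (Dom C f, FAr S f) \<in> over"
  by (simp add: over_iff C.dom_closed S.far_closed S.dom_far)

sublocale P: cat_functor Elts D elements_to_base
  by unfold_locales
    (auto simp: elements_to_base_def Ar_elements elements_simps Ob_elements over_iff D.cod_closed push_closed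
      dest: push_closed(2))

sublocale R: cat_functor Elts C right_adj
proof
  fix f g :: "('o \<times> 'q) \<times> 'q" and \<beta> :: "'o \<times> 'q"
  obtain \<beta>1 \<alpha>1 where f: "f = (\<beta>1, \<alpha>1)" by (cases f)
  obtain \<beta>2 \<alpha>2 where g: "g = (\<beta>2, \<alpha>2)" by (cases g)
  show "\<beta> \<in> Ob Elts \<Longrightarrow> FOb right_adj \<beta> \<in> Ob C" by (simp add: right_adj_def Ob_elements over_iff)
  show "f \<in> Ar Elts \<Longrightarrow> FAr right_adj f \<in> Ar C"
    using push_over[of \<beta>1 \<alpha>1] to_final_arr by (simp add: right_adj_def f)
  show "f \<in> Ar Elts \<Longrightarrow> Dom C (FAr right_adj f) = FOb right_adj (Dom Elts f)"
    using push_over[of \<beta>1 \<alpha>1] to_final_arr(2)[of "push \<alpha>1 \<beta>1"] by (simp add: right_adj_def f elements_simps) (simp add: push_def)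
  show "f \<in> Ar Elts \<Longrightarrow> Cod C (FAr right_adj f) = FOb right_adj (Cod Elts f)"
    using push_over[of \<beta>1 \<alpha>1] to_final_arr(3)[of "push \<alpha>1 \<beta>1"] by (simp add: right_adj_def f elements_simps)
  show "\<beta> \<in> Ob Elts \<Longrightarrow> FAr right_adj (Idn Elts \<beta>) = Idn C (FOb right_adj \<beta>)"
    by (simp add: right_adj_def elements_simps push_idn final_of_element)
  show "f \<in> Ar Elts \<Longrightarrow> g \<in> Ar Elts \<Longrightarrow> Cod Elts f = Dom Elts g \<Longrightarrow>
      FAr right_adj (Cmp Elts g f) = Cmp C (FAr right_adj g) (FAr right_adj f)"
    using push_push(2)[of \<beta>1 \<alpha>1 \<alpha>2] push_closed(2)[of \<beta>1 \<alpha>1]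
    by (auto simp: right_adj_def f g elements_simps Ar_elements)
qed

sublocale T: cat_functor C Elts left_adj
proof
  fix f g c
  show "c \<in> Ob C \<Longrightarrow> FOb left_adj c \<in> Ob Elts" by (simp add: left_adj_def left_adj_ob)
  show "f \<in> Ar C \<Longrightarrow> FAr left_adj f \<in> Ar Elts"
    by (simp add: left_adj_def Ar_elements left_adj_ob C.dom_closed S.far_closed S.dom_far)
  show "f \<in> Ar C \<Longrightarrow> Dom Elts (FAr left_adj f) = FOb left_adj (Dom C f)"
    by (simp add: left_adj_def elements_simps)
  show "f \<in> Ar C \<Longrightarrow> Cod Elts (FAr left_adj f) = FOb left_adj (Cod C f)"
    by (simp add: left_adj_def elements_simps push_unit(1)[OF image_over] final_of_image(1))
  show "c \<in> Ob C \<Longrightarrow> FAr left_adj (Idn C c) = Idn Elts (FOb left_adj c)"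
    by (simp add: left_adj_def elements_simps C.dom_idn S.far_idn left_adj_ob)
  show "f \<in> Ar C \<Longrightarrow> g \<in> Ar C \<Longrightarrow> Cod C f = Dom C g \<Longrightarrow>
      FAr left_adj (Cmp C g f) = Cmp Elts (FAr left_adj g) (FAr left_adj f)"
    by (simp add: left_adj_def elements_simps C.dom_cmp S.far_cmp)
qed

text \<open>Both composites are the arrow \<open>f'\<close> in the factorization \<open>t \<circ> S f'\<close> of \<open>S f\<close>.\<close>

lemma unit_natural: "natural_transformation C C id_funct (comp_funct right_adj left_adj) (\<lambda>c. to_final (unit_obj c))"
proof -
  interpret I: cat_functor C C id_funct by (rule cat_functor_id)
  interpret RT: cat_functor C C "comp_funct right_adj left_adj"
    by (rule cat_functor_comp[OF T.cat_functor_axioms R.cat_functor_axioms])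
  show ?thesis
  proof
    fix c assume c: "c \<in> Ob C"
    note u = to_final_arr[OF conjunct1[OF unit_obj_over[OF c]]]
    show "to_final (unit_obj c) \<in> Ar C" by (rule u)
    show "Dom C (to_final (unit_obj c)) = FOb id_funct c"
      using u(2) by (simp add: id_funct_def) (simp add: unit_obj_def)
    show "Cod C (to_final (unit_obj c)) = FOb (comp_funct right_adj left_adj) c"
      using u(3) by (simp add: comp_funct_def right_adj_def left_adj_def)
  next
    fix f assume f: "f \<in> Ar C"
    then show "Cmp C (to_final (unit_obj (Cod C f))) (FAr id_funct f)
        = Cmp C (FAr (comp_funct right_adj left_adj) f) (to_final (unit_obj (Dom C f)))"
      using push_unit(2)[OF image_over[OF f]] final_of_image(2)[OF f]
      by (simp add: id_funct_def comp_funct_def right_adj_def left_adj_def)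
  qed
qed

lemma element_arrow: "\<beta> \<in> Ob Elts \<Longrightarrow> (final_of (unit_obj (fst \<beta>)), snd \<beta>) \<in> Ar Elts"
  using Ob_elements[of \<beta>] left_adj_ob[of "fst \<beta>"] by (simp add: Ar_elements over_iff)

text \<open>The first equation makes \<open>\<beta>\<close> itself, as an arrow of \<open>D\<close>, an arrow \<open>T (R \<beta>) \<rightarrow> \<beta>\<close> of the category of elements,
  the counit; the second is the triangle identity.\<close>

lemma push_element:
  assumes "\<beta> \<in> Ob Elts"
  shows "final_of (push (snd \<beta>) (final_of (unit_obj (fst \<beta>)))) = \<beta>"
    and "Cmp C (to_final (push (snd \<beta>) (final_of (unit_obj (fst \<beta>))))) (to_final (unit_obj (fst \<beta>))) = Idn C (fst \<beta>)"
  using push_unit[of "fst \<beta>" "snd \<beta>"] assms final_of_element[OF assms] by (simp_all add: Ob_elements)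

lemma counit_natural:
  "natural_transformation Elts Elts (comp_funct left_adj right_adj) id_funct
     (\<lambda>\<beta>. (final_of (unit_obj (fst \<beta>)), snd \<beta>))"
proof -
  interpret I: cat_functor Elts Elts id_funct by (rule cat_functor_id)
  interpret TR: cat_functor Elts Elts "comp_funct left_adj right_adj"
    by (rule cat_functor_comp[OF R.cat_functor_axioms T.cat_functor_axioms])
  show ?thesis
  proof
    fix \<beta> assume \<beta>: "\<beta> \<in> Ob Elts"
    show "(final_of (unit_obj (fst \<beta>)), snd \<beta>) \<in> Ar Elts" by (rule element_arrow[OF \<beta>])
    show "Dom Elts (final_of (unit_obj (fst \<beta>)), snd \<beta>) = FOb (comp_funct left_adj right_adj) \<beta>"
      by (simp add: elements_simps comp_funct_def left_adj_def right_adj_def)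
    show "Cod Elts (final_of (unit_obj (fst \<beta>)), snd \<beta>) = FOb id_funct \<beta>"
      by (simp add: elements_simps id_funct_def push_element(1)[OF \<beta>])
  next
    fix f assume f: "f \<in> Ar Elts"
    obtain \<beta> \<alpha> where f': "f = (\<beta>, \<alpha>)" by (cases f)
    note u = to_final_arr[OF push_over(1)[OF f[unfolded f']]] final_factor[OF push_over(1)[OF f[unfolded f']]]
    show "Cmp Elts (final_of (unit_obj (fst (Cod Elts f))), snd (Cod Elts f)) (FAr (comp_funct left_adj right_adj) f)
        = Cmp Elts (FAr id_funct f) (final_of (unit_obj (fst (Dom Elts f))), snd (Dom Elts f))"
      using u by (simp add: f' elements_simps comp_funct_def left_adj_def right_adj_def id_funct_def) (simp add: push_def)
  qed
qed

end

section \<open>The free-product form of the left Kan extension\<close>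

locale virtual_cofibration_diagram = virtual_cofibration C D S fin + C: category_diagram C G
  for C :: "('o, 'm) cat" and D :: "('p, 'q) cat" and S :: "('o, 'm, 'p, 'q) funct"
    and fin :: "'p \<Rightarrow> ('o \<times> 'q) set" and G :: "('o, 'm, 'g) diagram"
begin

abbreviation lan :: "('p, 'q, (('o \<times> 'q) \<times> 'g) list set) diagram" where
  "lan \<equiv> lan_fin C D S fin G"

abbreviation lan_in :: "'p \<Rightarrow> 'o \<times> 'q \<Rightarrow> 'g \<Rightarrow> (('o \<times> 'q) \<times> 'g) list set" where
  "lan_in d \<equiv> fp_in (fin d) (lan_factors G)"

lemma lan_factors_eq: "lan_factors G = (\<lambda>\<beta>. GOb G (fst \<beta>))"
  by (simp add: lan_factors_def diagram_comp_def comma_forget_def)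

lemma GOb_lan: "GOb lan d = free_product (fin d) (lan_factors G)"
  by (simp add: lan_fin_def)

lemma fin_group_family: "d \<in> Ob D \<Longrightarrow> group_family (fin d) (lan_factors G)"
  using fin_over by (intro group_family.intro) (auto simp: lan_factors_eq over_iff C.gob_group)

lemma lan_group: "d \<in> Ob D \<Longrightarrow> group (GOb lan d)"
  by (simp add: GOb_lan group_family.free_product_group[OF fin_group_family])

lemma lan_hom_eqI:
  assumes "d \<in> Ob D" "group K" "a \<in> hom (GOb lan d) K" "b \<in> hom (GOb lan d) K"
    and "\<And>\<beta> x. \<beta> \<in> fin d \<Longrightarrow> x \<in> carrier (GOb G (fst \<beta>)) \<Longrightarrow> a (lan_in d \<beta> x) = b (lan_in d \<beta> x)"
    and "A \<in> carrier (GOb lan d)"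
  shows "a A = b A"
  using group_family.free_product_hom_eqI[OF fin_group_family[OF assms(1)] assms(2), of a b A] assms(3-)
  by (simp add: GOb_lan lan_factors_eq)

lemma lan_in_hom: "d \<in> Ob D \<Longrightarrow> \<beta> \<in> fin d \<Longrightarrow> lan_in d \<beta> \<in> hom (GOb G (fst \<beta>)) (GOb lan d)"
  using group_family.fp_in_hom[OF fin_group_family] by (simp add: GOb_lan lan_factors_eq)

lemma to_final_hom: "\<gamma> \<in> over \<Longrightarrow> GAr G (to_final \<gamma>) \<in> hom (GOb G (fst \<gamma>)) (GOb G (fst (final_of \<gamma>)))"
  using C.gar_hom[OF to_final_arr(1)] by (simp add: to_final_arr)

lemma lan_push_eq:
  "lan_push C D S fin G (Cod D (snd \<gamma>)) \<gamma> x = lan_in (Cod D (snd \<gamma>)) (final_of \<gamma>) (GAr G (to_final \<gamma>) x)"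
  by (simp add: lan_push_def final_of_def to_final_def diagram_comp_def)

lemma lan_push_hom:
  assumes "\<gamma> \<in> over"
  shows "(\<lambda>x. lan_in (Cod D (snd \<gamma>)) (final_of \<gamma>) (GAr G (to_final \<gamma>) x)) \<in> hom (GOb G (fst \<gamma>)) (GOb lan (Cod D (snd \<gamma>)))"
  using hom_compose[OF to_final_hom[OF assms] lan_in_hom[OF _ final_of_fin[OF assms]]] assms
  by (simp add: comp_def over_iff D.cod_closed)

lemma
  assumes \<alpha>: "\<alpha> \<in> Ar D"
  shows lan_arr_hom: "GAr lan \<alpha> \<in> hom (GOb lan (Dom D \<alpha>)) (GOb lan (Cod D \<alpha>))"
    and lan_arr_in: "\<And>\<beta> x. \<lbrakk>\<beta> \<in> fin (Dom D \<alpha>); x \<in> carrier (GOb G (fst \<beta>))\<rbrakk> \<Longrightarrow>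
      GAr lan \<alpha> (lan_in (Dom D \<alpha>) \<beta> x)
        = lan_in (Cod D \<alpha>) (final_of (push \<alpha> \<beta>)) (GAr G (to_final (push \<alpha> \<beta>)) x)"
proof -
  let ?d = "Dom D \<alpha>" and ?d' = "Cod D \<alpha>"
  let ?p = "\<lambda>\<beta>. lan_push C D S fin G ?d' (push \<alpha> \<beta>)"
  have d: "?d \<in> Ob D" "?d' \<in> Ob D" using \<alpha> by (simp_all add: D.dom_closed D.cod_closed)
  have GAr: "GAr lan \<alpha> = fp_lift (GOb lan ?d') ?p"
    by (simp add: lan_fin_def push_def case_prod_unfold)
  have el: "(\<beta>, \<alpha>) \<in> Ar Elts" if "\<beta> \<in> fin ?d" for \<beta>
    using fin_over[OF d(1) that] that \<alpha> by (simp add: Ar_elements Ob_elements)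
  have p: "?p \<beta> x = lan_in ?d' (final_of (push \<alpha> \<beta>)) (GAr G (to_final (push \<alpha> \<beta>)) x)" if "\<beta> \<in> fin ?d" for \<beta> x
    using lan_push_eq[of "push \<alpha> \<beta>" x] push_over[OF el[OF that]] by simp
  have hom: "?p \<beta> \<in> hom (lan_factors G \<beta>) (GOb lan ?d')" if "\<beta> \<in> fin ?d" for \<beta>
  proof -
    have "?p \<beta> = (\<lambda>x. lan_in ?d' (final_of (push \<alpha> \<beta>)) (GAr G (to_final (push \<alpha> \<beta>)) x))"
      by (rule ext) (rule p[OF that])
    then show ?thesis
      using lan_push_hom[OF push_over(1)[OF el[OF that]]] push_over(2)[OF el[OF that]]
      by (simp add: lan_factors_eq) (simp add: push_def)
  qed
  show "GAr lan \<alpha> \<in> hom (GOb lan ?d) (GOb lan ?d')"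
    unfolding GAr GOb_lan[of ?d] by (rule group_family.fp_lift_hom[OF fin_group_family[OF d(1)] lan_group[OF d(2)] hom])
  show "GAr lan \<alpha> (lan_in ?d \<beta> x) = lan_in ?d' (final_of (push \<alpha> \<beta>)) (GAr G (to_final (push \<alpha> \<beta>)) x)"
    if "\<beta> \<in> fin ?d" "x \<in> carrier (GOb G (fst \<beta>))" for \<beta> x
  proof -
    have x: "x \<in> carrier (lan_factors G \<beta>)" using that(2) by (simp add: lan_factors_eq)
    have "GAr lan \<alpha> (lan_in ?d \<beta> x) = ?p \<beta> x"
      unfolding GAr
      by (rule group_family.fp_lift_in[OF fin_group_family[OF d(1)] lan_group[OF d(2)] hom that(1) x])
    then show ?thesis using p[OF that(1)] by simp
  qed
qed

lemma group_diagram_lan: "group_diagram D lan"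
proof (rule group_diagram.intro)
  show "group (GOb lan d)" if "d \<in> Ob D" for d by (rule lan_group[OF that])
  show "GAr lan \<alpha> \<in> hom (GOb lan (Dom D \<alpha>)) (GOb lan (Cod D \<alpha>))" if "\<alpha> \<in> Ar D" for \<alpha>
    by (rule lan_arr_hom[OF that])
  have el: "(\<beta>, \<alpha>) \<in> Ar Elts" if "\<alpha> \<in> Ar D" "\<beta> \<in> fin (Dom D \<alpha>)" for \<alpha> \<beta>
    using fin_over[OF D.dom_closed[OF that(1)] that(2)] that by (simp add: Ar_elements Ob_elements)
  show "GAr lan (Idn D d) A = A" if d: "d \<in> Ob D" and A: "A \<in> carrier (GOb lan d)" for d A
  proof -
    have id: "Idn D d \<in> Ar D" "Dom D (Idn D d) = d" "Cod D (Idn D d) = d"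
      using d by (simp_all add: D.idn_closed D.dom_idn D.cod_idn)
    have "GAr lan (Idn D d) A = (\<lambda>A. A) A"
    proof (rule lan_hom_eqI[OF d lan_group[OF d] _ _ _ A])
      show "GAr lan (Idn D d) \<in> hom (GOb lan d) (GOb lan d)" using lan_arr_hom[OF id(1)] id by simp
      fix \<beta> x assume *: "\<beta> \<in> fin d" "x \<in> carrier (GOb G (fst \<beta>))"
      have \<beta>: "\<beta> \<in> Ob Elts" "Cod D (snd \<beta>) = d" using fin_over[OF d *(1)] * by (simp_all add: Ob_elements)
      then have "push (Idn D d) \<beta> = \<beta>" using push_idn[of \<beta>] by simp
      then show "GAr lan (Idn D d) (lan_in d \<beta> x) = lan_in d \<beta> x"
        using lan_arr_in[OF id(1), of \<beta> x] id * \<beta> final_of_element[OF \<beta>(1)]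
        by (simp add: C.gar_idn Ob_elements over_iff)
    qed (simp add: hom_def)
    then show ?thesis by simp
  qed
  show "GAr lan (Cmp D g f) A = GAr lan g (GAr lan f A)"
    if f: "f \<in> Ar D" and g: "g \<in> Ar D" and fg: "Cod D f = Dom D g" and A: "A \<in> carrier (GOb lan (Dom D f))" for f g A
  proof -
    have gf: "Cmp D g f \<in> Ar D" "Dom D (Cmp D g f) = Dom D f" "Cod D (Cmp D g f) = Cod D g"
      using f g fg by (simp_all add: D.cmp_closed D.dom_cmp D.cod_cmp)
    have "GAr lan (Cmp D g f) A = (GAr lan g \<circ> GAr lan f) A"
    proof (rule lan_hom_eqI[OF D.dom_closed[OF f] lan_group[OF D.cod_closed[OF g]] _ _ _ A])
      show "GAr lan (Cmp D g f) \<in> hom (GOb lan (Dom D f)) (GOb lan (Cod D g))"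
        using lan_arr_hom[OF gf(1)] gf by simp
      show "GAr lan g \<circ> GAr lan f \<in> hom (GOb lan (Dom D f)) (GOb lan (Cod D g))"
        using hom_compose[OF lan_arr_hom[OF f] lan_arr_hom[OF g, folded fg]] .
      fix \<beta> x assume *: "\<beta> \<in> fin (Dom D f)" "x \<in> carrier (GOb G (fst \<beta>))"
      note e = el[OF f *(1)]
      let ?t = "final_of (push f \<beta>)" and ?y = "GAr G (to_final (push f \<beta>)) x"
      have t: "?t \<in> fin (Dom D g)" using push_closed[OF e] fg by (simp add: Ob_elements)
      have u: "to_final (push f \<beta>) \<in> Ar C" "Dom C (to_final (push f \<beta>)) = fst \<beta>" "Cod C (to_final (push f \<beta>)) = fst ?t"
        using to_final_arr[OF push_over(1)[OF e]] by (simp_all add: push_def)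
      have y: "?y \<in> carrier (GOb G (fst ?t))" using hom_in_carrier[OF C.gar_hom[OF u(1)]] u *(2) by simp
      have v: "to_final (push g ?t) \<in> Ar C" "Dom C (to_final (push g ?t)) = fst ?t"
        using to_final_arr[OF push_over(1)[OF el[OF g t]]] by (simp_all add: push_def)
      have "GAr lan (Cmp D g f) (lan_in (Dom D f) \<beta> x)
          = lan_in (Cod D g) (final_of (push g ?t)) (GAr G (Cmp C (to_final (push g ?t)) (to_final (push f \<beta>))) x)"
        using lan_arr_in[OF gf(1), of \<beta> x] gf * push_push[OF e g fg[symmetric]] by simp
      also have "GAr G (Cmp C (to_final (push g ?t)) (to_final (push f \<beta>))) x = GAr G (to_final (push g ?t)) ?y"
        using u v *(2) by (intro C.gar_cmp) simp_all
      finally show "GAr lan (Cmp D g f) (lan_in (Dom D f) \<beta> x) = (GAr lan g \<circ> GAr lan f) (lan_in (Dom D f) \<beta> x)"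
        using lan_arr_in[OF f *] lan_arr_in[OF g t y] fg by simp
    qed
    then show ?thesis by simp
  qed
qed

lemma lan_homology: "nonabelian_homology C G n \<cong> nonabelian_homology D lan n"
proof -
  let ?H = "diagram_comp G right_adj"
  have GOb_H: "GOb ?H = lan_factors G" by (simp add: diagram_comp_def right_adj_def lan_factors_eq)
  interpret H: group_diagram Elts ?H by (rule group_diagram_comp[OF R.cat_functor_axioms C.group_diagram_axioms])
  interpret L: group_diagram D lan by (rule group_diagram_lan)
  have fiber: "{\<beta> \<in> Ob Elts. FOb elements_to_base \<beta> = d} = fin d" if "d \<in> Ob D" for d
    using fin_over[OF that] by (auto simp: elements_to_base_def Ob_elements)
  interpret discrete_opfibration Elts ?H D lan elements_to_base
  proof
    fix \<beta> \<alpha> assume *: "\<beta> \<in> Ob Elts" "\<alpha> \<in> Ar D" "Dom D \<alpha> = FOb elements_to_base \<beta>"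
    then have "(\<beta>, \<alpha>) \<in> Ar Elts" by (simp add: Ar_elements elements_to_base_def)
    then show "\<exists>!a. a \<in> Ar Elts \<and> Dom Elts a = \<beta> \<and> FAr elements_to_base a = \<alpha>"
      by (intro ex1I[of _ "(\<beta>, \<alpha>)"]) (auto simp: elements_simps elements_to_base_def)
  next
    fix d assume "d \<in> Ob D"
    then show "GOb lan d = free_product {\<beta> \<in> Ob Elts. FOb elements_to_base \<beta> = d} (GOb ?H)"
      by (simp add: fiber GOb_lan GOb_H)
  next
    fix a x assume a: "a \<in> Ar Elts" and x: "x \<in> carrier (GOb ?H (Dom Elts a))"
    obtain \<beta> \<alpha> where a': "a = (\<beta>, \<alpha>)" by (cases a)
    have \<alpha>: "\<alpha> \<in> Ar D" "\<beta> \<in> fin (Dom D \<alpha>)" "Dom D \<alpha> = Cod D (snd \<beta>)"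
      using a by (simp_all add: a' Ar_elements Ob_elements)
    have "Cod D (snd \<beta>) \<in> Ob D" "Cod D \<alpha> \<in> Ob D" using \<alpha> D.dom_closed[of \<alpha>] by (simp_all add: D.cod_closed)
    then show "GAr lan (FAr elements_to_base a)
          (fp_in {e \<in> Ob Elts. FOb elements_to_base e = FOb elements_to_base (Dom Elts a)} (GOb ?H) (Dom Elts a) x)
        = fp_in {e \<in> Ob Elts. FOb elements_to_base e = FOb elements_to_base (Cod Elts a)} (GOb ?H) (Cod Elts a) (GAr ?H a x)"
      using lan_arr_in[OF \<alpha>(1,2), of x] x \<alpha>(3) push_closed(2)[OF a[unfolded a']] fiber
      by (simp add: a' elements_simps GOb_H lan_factors_eq)
        (simp add: elements_to_base_def diagram_comp_def right_adj_def)
  qed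
  have "nonabelian_homology C G n \<cong> nonabelian_homology Elts ?H n"
    by (rule adjoint_homology[OF C.category_axioms E.category_axioms C.group_diagram_axioms unit_natural counit_natural
          T.cat_functor_axioms R.cat_functor_axioms])
      (use push_element(2) in \<open>simp add: right_adj_def\<close>)
  then show ?thesis using opfibration_homology by (rule iso_trans)
qed

abbreviation lan_unit :: "'o \<Rightarrow> 'g \<Rightarrow> (('o \<times> 'q) \<times> 'g) list set" where
  "lan_unit \<equiv> lan_fin_unit C D S fin G"

lemma lan_unit_eq:
  assumes "c \<in> Ob C"
  shows "lan_unit c x = lan_in (FOb S c) (final_of (unit_obj c)) (GAr G (to_final (unit_obj c)) x)"
  using lan_push_eq[of "unit_obj c" x] unit_obj_over[OF assms]
  by (simp add: lan_fin_unit_def) (simp add: unit_obj_def)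

lemma unit_val:
  assumes "c \<in> Ob C"
  shows "final_of (unit_obj c) \<in> fin (FOb S c)" "to_final (unit_obj c) \<in> Ar C"
    "Dom C (to_final (unit_obj c)) = c" "Cod C (to_final (unit_obj c)) = fst (final_of (unit_obj c))"
    "x \<in> carrier (GOb G c) \<Longrightarrow> GAr G (to_final (unit_obj c)) x \<in> carrier (GOb G (fst (final_of (unit_obj c))))"
proof -
  have o: "unit_obj c \<in> over" "Cod D (snd (unit_obj c)) = FOb S c" "fst (unit_obj c) = c"
    using unit_obj_over[OF assms] by (simp_all add: unit_obj_def)
  show "final_of (unit_obj c) \<in> fin (FOb S c)" "to_final (unit_obj c) \<in> Ar C"
    "Dom C (to_final (unit_obj c)) = c" "Cod C (to_final (unit_obj c)) = fst (final_of (unit_obj c))"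
    using final_of_fin[OF o(1)] to_final_arr[OF o(1)] o by simp_all
  show "GAr G (to_final (unit_obj c)) x \<in> carrier (GOb G (fst (final_of (unit_obj c))))" if "x \<in> carrier (GOb G c)"
    using hom_in_carrier[OF to_final_hom[OF o(1)], of x] that o by simp
qed

text \<open>The unit lands in the factor at the final object of the component of the identity, and \<open>b\<close> pushes it on to
  the final object of the component of \<open>b\<close>.\<close>

lemma lan_arr_unit:
  assumes \<gamma>: "(c, b) \<in> over" and x: "x \<in> carrier (GOb G c)"
  shows "GAr lan b (lan_unit c x) = lan_in (Cod D b) (final_of (c, b)) (GAr G (to_final (c, b)) x)"
proof -
  have c: "c \<in> Ob C" and b: "b \<in> Ar D" "Dom D b = FOb S c" using \<gamma> by (simp_all add: over_iff)
  let ?t = "final_of (unit_obj c)"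
  note u = unit_val[OF c]
  have "(?t, b) \<in> Ar Elts" using left_adj_ob[OF c] b by (simp add: Ar_elements)
  then have v: "to_final (push b ?t) \<in> Ar C" "Dom C (to_final (push b ?t)) = fst ?t"
    using to_final_arr[OF push_over(1)] by (simp_all add: push_def)
  have "GAr lan b (lan_unit c x)
      = lan_in (Cod D b) (final_of (push b ?t)) (GAr G (to_final (push b ?t)) (GAr G (to_final (unit_obj c)) x))"
    using lan_arr_in[OF b(1), of ?t] u x b(2) by (simp add: lan_unit_eq[OF c])
  also have "GAr G (to_final (push b ?t)) (GAr G (to_final (unit_obj c)) x)
      = GAr G (Cmp C (to_final (push b ?t)) (to_final (unit_obj c))) x"
    using u v x by (intro C.gar_cmp[symmetric]) simp_all
  finally show ?thesis using push_unit[OF \<gamma>] by simp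
qed

lemma lan_unit_map: "diagram_map C G (diagram_comp lan S) lan_unit"
  unfolding diagram_map_def
proof (intro conjI ballI)
  fix c assume c: "c \<in> Ob C"
  have "lan_unit c = (\<lambda>x. lan_in (FOb S c) (final_of (unit_obj c)) (GAr G (to_final (unit_obj c)) x))"
    by (rule ext) (rule lan_unit_eq[OF c])
  then show "lan_unit c \<in> hom (GOb G c) (GOb (diagram_comp lan S) c)"
    using lan_push_hom[of "unit_obj c"] unit_obj_over[OF c]
    by (simp add: diagram_comp_def) (simp add: unit_obj_def)
next
  fix f x assume f: "f \<in> Ar C" and x: "x \<in> carrier (GOb G (Dom C f))"
  note u = unit_val[OF C.cod_closed[OF f]]
  have "lan_unit (Cod C f) (GAr G f x) = lan_in (FOb S (Cod C f)) (final_of (unit_obj (Cod C f))) (GAr G (to_final (unit_obj (Cod C f))) (GAr G f x))"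
    by (rule lan_unit_eq[OF C.cod_closed[OF f]])
  also have "GAr G (to_final (unit_obj (Cod C f))) (GAr G f x) = GAr G (Cmp C (to_final (unit_obj (Cod C f))) f) x"
    using u f x by (intro C.gar_cmp[symmetric]) simp_all
  also have "lan_in (FOb S (Cod C f)) (final_of (unit_obj (Cod C f))) \<dots> = GAr lan (FAr S f) (lan_unit (Dom C f) x)"
    using lan_arr_unit[OF image_over[OF f] x] final_of_image[OF f] f by (simp add: S.cod_far)
  finally show "lan_unit (Cod C f) (GAr G f x) = GAr (diagram_comp lan S) f (lan_unit (Dom C f) x)"
    by (simp add: diagram_comp_def)
qed

text \<open>Every factor comes from the unit. This forces the values of a map from the diagram to \<open>H\<close>, once its
  composite with the unit is prescribed.\<close>

lemma lan_in_unit: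
  assumes "d \<in> Ob D" "\<beta> \<in> fin d" "x \<in> carrier (GOb G (fst \<beta>))"
  shows "lan_in d \<beta> x = GAr lan (snd \<beta>) (lan_unit (fst \<beta>) x)"
proof -
  note \<beta> = fin_over[OF assms(1,2)]
  have "GAr G (Idn C (fst \<beta>)) x = x" using assms(3) \<beta> by (simp add: C.gar_idn over_iff)
  then show ?thesis
    using lan_arr_unit[of "fst \<beta>" "snd \<beta>" x] final_of_self[OF assms(1,2)] \<beta> assms(3) by simp
qed

lemma lan_map_unique:
  assumes H: "group_diagram D H" and \<sigma>: "diagram_map D lan H \<sigma>" and \<sigma>': "diagram_map D lan H \<sigma>'"
    and eq: "\<And>c x. c \<in> Ob C \<Longrightarrow> x \<in> carrier (GOb G c) \<Longrightarrow> \<sigma> (FOb S c) (lan_unit c x) = \<sigma>' (FOb S c) (lan_unit c x)"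
    and d: "d \<in> Ob D" and A: "A \<in> carrier (GOb lan d)"
  shows "\<sigma> d A = \<sigma>' d A"
proof (rule lan_hom_eqI[OF d group_diagram.gob_group[OF H d] _ _ _ A])
  show "\<sigma> d \<in> hom (GOb lan d) (GOb H d)" "\<sigma>' d \<in> hom (GOb lan d) (GOb H d)"
    using \<sigma> \<sigma>' d by (simp_all add: diagram_map_def)
  fix \<beta> x assume *: "\<beta> \<in> fin d" "x \<in> carrier (GOb G (fst \<beta>))"
  note \<beta> = fin_over[OF d *(1)]
  have c: "fst \<beta> \<in> Ob C" "snd \<beta> \<in> Ar D" "Dom D (snd \<beta>) = FOb S (fst \<beta>)" using \<beta>(1) by (simp_all add: over_iff)
  have "lan_unit (fst \<beta>) x \<in> carrier (GOb lan (FOb S (fst \<beta>)))"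
    using lan_unit_map c(1) *(2) by (auto simp: diagram_map_def diagram_comp_def dest!: bspec hom_in_carrier)
  then have nat: "\<tau> d (lan_in d \<beta> x) = GAr H (snd \<beta>) (\<tau> (FOb S (fst \<beta>)) (lan_unit (fst \<beta>) x))"
    if "diagram_map D lan H \<tau>" for \<tau>
    using that c \<beta>(2) by (auto simp: lan_in_unit[OF d *] diagram_map_def)
  show "\<sigma> d (lan_in d \<beta> x) = \<sigma>' d (lan_in d \<beta> x)"
    by (simp add: nat[OF \<sigma>] nat[OF \<sigma>'] eq[OF c(1) *(2)])
qed

text \<open>The factor at \<open>\<beta> : S c \<rightarrow> d\<close> is mapped by \<open>H(\<beta>) \<circ> \<tau>\<^sub>c\<close>. By naturality of \<open>\<tau>\<close> the same formula computes the
  map for an arbitrary \<open>\<gamma>\<close> in place of \<open>\<beta>\<close>, after moving to the final object of its component; naturality and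
  the factorization of \<open>\<tau>\<close> are then immediate.\<close>

lemma lan_map_exists:
  assumes H: "group_diagram D H" and \<tau>: "diagram_map C G (diagram_comp H S) \<tau>"
  shows "\<exists>\<sigma>. diagram_map D lan H \<sigma> \<and> (\<forall>c\<in>Ob C. \<forall>x\<in>carrier (GOb G c). \<sigma> (FOb S c) (lan_unit c x) = \<tau> c x)"
proof -
  interpret H: group_diagram D H by (rule H)
  have \<tau>_hom: "\<tau> c \<in> hom (GOb G c) (GOb H (FOb S c))" if "c \<in> Ob C" for c
    using \<tau> that by (simp add: diagram_map_def diagram_comp_def)
  have \<tau>_nat: "\<tau> (Cod C f) (GAr G f x) = GAr H (FAr S f) (\<tau> (Dom C f) x)"
    if "f \<in> Ar C" "x \<in> carrier (GOb G (Dom C f))" for f x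
    using \<tau> that by (simp add: diagram_map_def diagram_comp_def)
  let ?s = "\<lambda>\<beta> x. GAr H (snd \<beta>) (\<tau> (fst \<beta>) x)"
  let ?\<sigma> = "\<lambda>d. fp_lift (GOb H d) ?s"
  have s_hom: "?s \<beta> \<in> hom (lan_factors G \<beta>) (GOb H d)" if "d \<in> Ob D" "\<beta> \<in> fin d" for d \<beta>
    using fin_over[OF that] hom_compose[OF \<tau>_hom[of "fst \<beta>"], of "GAr H (snd \<beta>)" "GOb H d"] H.gar_hom[of "snd \<beta>"]
    by (simp add: over_iff comp_def lan_factors_eq)
  have \<sigma>_hom: "?\<sigma> d \<in> hom (GOb lan d) (GOb H d)" if "d \<in> Ob D" for d
    unfolding GOb_lan by (rule group_family.fp_lift_hom[OF fin_group_family[OF that] H.gob_group[OF that] s_hom[OF that]])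
  have \<sigma>_in: "?\<sigma> d (lan_in d \<beta> x) = ?s \<beta> x" if "d \<in> Ob D" "\<beta> \<in> fin d" "x \<in> carrier (GOb G (fst \<beta>))" for d \<beta> x
  proof -
    have x: "x \<in> carrier (lan_factors G \<beta>)" using that(3) by (simp add: lan_factors_eq)
    show ?thesis
      by (rule group_family.fp_lift_in[OF fin_group_family[OF that(1)] H.gob_group[OF that(1)] s_hom[OF that(1)] that(2) x])
  qed
  have \<sigma>_push: "?\<sigma> (Cod D (snd \<gamma>)) (lan_in (Cod D (snd \<gamma>)) (final_of \<gamma>) (GAr G (to_final \<gamma>) x)) = ?s \<gamma> x"
    if \<gamma>: "\<gamma> \<in> over" and x: "x \<in> carrier (GOb G (fst \<gamma>))" for \<gamma> x
  proof -
    note u = to_final_arr[OF \<gamma>] and t = final_of_over[OF \<gamma>]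
    have c: "\<tau> (fst \<gamma>) x \<in> carrier (GOb H (FOb S (fst \<gamma>)))"
      using hom_in_carrier[OF \<tau>_hom x] \<gamma> by (simp add: over_iff)
    have "?\<sigma> (Cod D (snd \<gamma>)) (lan_in (Cod D (snd \<gamma>)) (final_of \<gamma>) (GAr G (to_final \<gamma>) x))
        = ?s (final_of \<gamma>) (GAr G (to_final \<gamma>) x)"
      using \<gamma> final_of_fin[OF \<gamma>] hom_in_carrier[OF to_final_hom[OF \<gamma>] x]
      by (intro \<sigma>_in) (simp_all add: over_iff D.cod_closed)
    also have "\<dots> = GAr H (snd (final_of \<gamma>)) (GAr H (FAr S (to_final \<gamma>)) (\<tau> (fst \<gamma>) x))"
      using \<tau>_nat[OF u(1), of x] x u by simp
    also have "\<dots> = GAr H (Cmp D (snd (final_of \<gamma>)) (FAr S (to_final \<gamma>))) (\<tau> (fst \<gamma>) x)"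
      using u t c by (intro H.gar_cmp[symmetric]) (simp_all add: over_iff S.far_closed S.dom_far S.cod_far)
    finally show ?thesis using final_factor[OF \<gamma>] by simp
  qed
  have "diagram_map D lan H ?\<sigma>"
    unfolding diagram_map_def
  proof (intro conjI ballI)
    show "?\<sigma> d \<in> hom (GOb lan d) (GOb H d)" if "d \<in> Ob D" for d by (rule \<sigma>_hom[OF that])
    fix \<alpha> A assume \<alpha>: "\<alpha> \<in> Ar D" and A: "A \<in> carrier (GOb lan (Dom D \<alpha>))"
    note d = D.dom_closed[OF \<alpha>] D.cod_closed[OF \<alpha>]
    have "(?\<sigma> (Cod D \<alpha>) \<circ> GAr lan \<alpha>) A = (GAr H \<alpha> \<circ> ?\<sigma> (Dom D \<alpha>)) A"
    proof (rule lan_hom_eqI[OF d(1) H.gob_group[OF d(2)] hom_compose[OF lan_arr_hom[OF \<alpha>] \<sigma>_hom[OF d(2)]]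
          hom_compose[OF \<sigma>_hom[OF d(1)] H.gar_hom[OF \<alpha>]] _ A])
      fix \<beta> x assume *: "\<beta> \<in> fin (Dom D \<alpha>)" "x \<in> carrier (GOb G (fst \<beta>))"
      note \<beta> = fin_over[OF d(1) *(1)]
      have e: "(\<beta>, \<alpha>) \<in> Ar Elts" using \<beta> * \<alpha> by (simp add: Ar_elements Ob_elements)
      have c: "\<tau> (fst \<beta>) x \<in> carrier (GOb H (FOb S (fst \<beta>)))"
        using hom_in_carrier[OF \<tau>_hom *(2)] \<beta> by (simp add: over_iff)
      have "?\<sigma> (Cod D \<alpha>) (GAr lan \<alpha> (lan_in (Dom D \<alpha>) \<beta> x)) = ?s (push \<alpha> \<beta>) x"
        using \<sigma>_push[OF push_over(1)[OF e], of x] push_over(2)[OF e] * by (simp add: lan_arr_in[OF \<alpha> *]) (simp add: push_def)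
      also have "\<dots> = GAr H \<alpha> (?s \<beta> x)"
        using H.gar_cmp[of "snd \<beta>" \<alpha> "\<tau> (fst \<beta>) x"] \<alpha> \<beta> c by (simp add: push_def over_iff)
      finally show "(?\<sigma> (Cod D \<alpha>) \<circ> GAr lan \<alpha>) (lan_in (Dom D \<alpha>) \<beta> x) = (GAr H \<alpha> \<circ> ?\<sigma> (Dom D \<alpha>)) (lan_in (Dom D \<alpha>) \<beta> x)"
        using \<sigma>_in[OF d(1) *] by simp
    qed
    then show "?\<sigma> (Cod D \<alpha>) (GAr lan \<alpha> A) = GAr H \<alpha> (?\<sigma> (Dom D \<alpha>) A)" by simp
  qed
  moreover have "?\<sigma> (FOb S c) (lan_unit c x) = \<tau> c x" if c: "c \<in> Ob C" and x: "x \<in> carrier (GOb G c)" for c x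
  proof -
    have "?\<sigma> (FOb S c) (lan_unit c x) = ?s (unit_obj c) x"
      using \<sigma>_push[of "unit_obj c" x] unit_obj_over[OF c] x by (simp add: lan_unit_eq[OF c]) (simp add: unit_obj_def)
    also have "\<dots> = \<tau> c x"
      using H.gar_idn[OF S.fob_closed[OF c] hom_in_carrier[OF \<tau>_hom[OF c] x]] by (simp add: unit_obj_def)
    finally show ?thesis .
  qed
  ultimately show ?thesis by blast
qed

lemma lan_left_kan_extension: "left_kan_extension TYPE('h) C D S G lan lan_unit"
  unfolding left_kan_extension_def Let_def
proof (intro conjI allI impI ballI)
  fix H :: "('p, 'q, 'h) diagram" and \<tau>
  assume "group_diagram D H \<and> diagram_map C G (diagram_comp H S) \<tau>"
  then show "\<exists>\<sigma>. diagram_map D lan H \<sigma> \<and> (\<forall>c\<in>Ob C. \<forall>x\<in>carrier (GOb G c). \<sigma> (FOb S c) (lan_unit c x) = \<tau> c x)"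
    using lan_map_exists by blast
next
  fix H :: "('p, 'q, 'h) diagram" and \<tau> \<sigma> \<sigma>' d x
  assume H: "group_diagram D H \<and> diagram_map C G (diagram_comp H S) \<tau>"
    and *: "(diagram_map D lan H \<sigma> \<and> (\<forall>c\<in>Ob C. \<forall>x\<in>carrier (GOb G c). \<sigma> (FOb S c) (lan_unit c x) = \<tau> c x)) \<and>
      diagram_map D lan H \<sigma>' \<and> (\<forall>c\<in>Ob C. \<forall>x\<in>carrier (GOb G c). \<sigma>' (FOb S c) (lan_unit c x) = \<tau> c x)"
    and d: "d \<in> Ob D" and x: "x \<in> carrier (GOb lan d)"
  show "\<sigma> d x = \<sigma>' d x"
    by (rule lan_map_unique[OF conjunct1[OF H] _ _ _ d x]) (use * in simp_all)
qed (simp_all add: group_diagram_lan lan_unit_map)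

end

section \<open>Uniqueness of left Kan extensions\<close>

lemma diagram_map_id: "diagram_map C G G (\<lambda>c x. x)"
  by (simp add: diagram_map_def hom_def)

lemma diagram_map_compose:
  assumes "category C" "diagram_map C G H \<tau>" "diagram_map C H K \<tau>'"
  shows "diagram_map C G K (\<lambda>c x. \<tau>' c (\<tau> c x))"
proof -
  interpret category C by fact
  have \<tau>: "\<tau> c \<in> hom (GOb G c) (GOb H c)" "\<tau>' c \<in> hom (GOb H c) (GOb K c)" if "c \<in> Ob C" for c
    using assms that by (simp_all add: diagram_map_def)
  have "(\<lambda>x. \<tau>' c (\<tau> c x)) \<in> hom (GOb G c) (GOb K c)" if "c \<in> Ob C" for c
    using hom_compose[OF \<tau>[OF that]] by (simp add: comp_def)
  moreover have "\<tau>' (Cod C f) (\<tau> (Cod C f) (GAr G f x)) = GAr K f (\<tau>' (Dom C f) (\<tau> (Dom C f) x))"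
    if "f \<in> Ar C" "x \<in> carrier (GOb G (Dom C f))" for f x
    using assms(2,3) that hom_in_carrier[OF \<tau>(1)[OF dom_closed[OF that(1)]] that(2)]
    by (simp add: diagram_map_def)
  ultimately show ?thesis by (simp add: diagram_map_def)
qed

lemma left_kan_extensionD:
  fixes H :: "('p, 'q, 'h) diagram"
  assumes "left_kan_extension TYPE('h) C D S G L \<eta>"
    and "group_diagram D H" "diagram_map C G (diagram_comp H S) \<tau>"
  defines "factors \<equiv> \<lambda>\<sigma>. diagram_map D L H \<sigma> \<and> (\<forall>c\<in>Ob C. \<forall>x\<in>carrier (GOb G c). \<sigma> (FOb S c) (\<eta> c x) = \<tau> c x)"
  shows "\<exists>\<sigma>. factors \<sigma>"
    and "\<And>\<sigma> \<sigma>' d x. \<lbrakk>factors \<sigma>; factors \<sigma>'; d \<in> Ob D; x \<in> carrier (GOb L d)\<rbrakk> \<Longrightarrow> \<sigma> d x = \<sigma>' d x"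
proof -
  have "\<forall>(H :: ('p, 'q, 'h) diagram) \<tau>. group_diagram D H \<and> diagram_map C G (diagram_comp H S) \<tau> \<longrightarrow>
      (let factors = (\<lambda>\<sigma>. diagram_map D L H \<sigma> \<and> (\<forall>c\<in>Ob C. \<forall>x\<in>carrier (GOb G c). \<sigma> (FOb S c) (\<eta> c x) = \<tau> c x))
       in (\<exists>\<sigma>. factors \<sigma>) \<and> (\<forall>\<sigma> \<sigma>'. factors \<sigma> \<and> factors \<sigma>' \<longrightarrow> (\<forall>d\<in>Ob D. \<forall>x\<in>carrier (GOb L d). \<sigma> d x = \<sigma>' d x)))"
    using assms(1) unfolding left_kan_extension_def by (elim conjE)
  from this[rule_format, OF conjI, OF assms(2,3)]
  have *: "(\<exists>\<sigma>. factors \<sigma>) \<and> (\<forall>\<sigma> \<sigma>'. factors \<sigma> \<and> factors \<sigma>' \<longrightarrow> (\<forall>d\<in>Ob D. \<forall>x\<in>carrier (GOb L d). \<sigma> d x = \<sigma>' d x))"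
    unfolding Let_def factors_def .
  then show "\<exists>\<sigma>. factors \<sigma>" by (rule conjunct1)
  show "\<sigma> d x = \<sigma>' d x" if "factors \<sigma>" "factors \<sigma>'" "d \<in> Ob D" "x \<in> carrier (GOb L d)" for \<sigma> \<sigma>' d x
    using conjunct2[OF *, rule_format, OF conjI, OF that] .
qed

lemma left_kan_extension_endo:
  assumes "left_kan_extension TYPE('l) C D S G (L :: ('p, 'q, 'l) diagram) \<eta>"
    and "diagram_map D L L \<sigma>" "\<And>c x. c \<in> Ob C \<Longrightarrow> x \<in> carrier (GOb G c) \<Longrightarrow> \<sigma> (FOb S c) (\<eta> c x) = \<eta> c x"
    and "d \<in> Ob D" "x \<in> carrier (GOb L d)"
  shows "\<sigma> d x = x"
proof -
  have L: "group_diagram D L" "diagram_map C G (diagram_comp L S) \<eta>"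
    using assms(1) by (auto simp: left_kan_extension_def)
  show ?thesis
    by (rule left_kan_extensionD(2)[OF assms(1) L, of \<sigma> "\<lambda>d x. x"]) (use assms(2-) diagram_map_id in auto)
qed

text \<open>Universality against both element types is needed: against the type of the other diagram for the comparison
  map, against the own type to see that the round trip is the identity.\<close>

lemma left_kan_extension_unique:
  fixes L :: "('p, 'q, 'l) diagram" and K :: "('p, 'q, 'k) diagram"
  assumes "category D"
    and L: "left_kan_extension TYPE('l) C D S G L \<eta>" "left_kan_extension TYPE('k) C D S G L \<eta>"
    and K: "left_kan_extension TYPE('l) C D S G K \<kappa>" "left_kan_extension TYPE('k) C D S G K \<kappa>"
  obtains \<theta> \<sigma> where "diagram_map D L K \<theta>" "diagram_map D K L \<sigma>"
    "\<And>c x. c \<in> Ob C \<Longrightarrow> x \<in> carrier (GOb G c) \<Longrightarrow> \<theta> (FOb S c) (\<eta> c x) = \<kappa> c x"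
    "\<And>d x. d \<in> Ob D \<Longrightarrow> x \<in> carrier (GOb L d) \<Longrightarrow> \<sigma> d (\<theta> d x) = x"
    "\<And>d x. d \<in> Ob D \<Longrightarrow> x \<in> carrier (GOb K d) \<Longrightarrow> \<theta> d (\<sigma> d x) = x"
proof -
  have gd: "group_diagram D L" "diagram_map C G (diagram_comp L S) \<eta>"
    "group_diagram D K" "diagram_map C G (diagram_comp K S) \<kappa>"
    using L(1) K(1) by (auto simp: left_kan_extension_def)
  obtain \<theta> where \<theta>: "diagram_map D L K \<theta>" "\<And>c x. c \<in> Ob C \<Longrightarrow> x \<in> carrier (GOb G c) \<Longrightarrow> \<theta> (FOb S c) (\<eta> c x) = \<kappa> c x"
    using left_kan_extensionD(1)[OF L(2) gd(3,4)] by blast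
  obtain \<sigma> where \<sigma>: "diagram_map D K L \<sigma>" "\<And>c x. c \<in> Ob C \<Longrightarrow> x \<in> carrier (GOb G c) \<Longrightarrow> \<sigma> (FOb S c) (\<kappa> c x) = \<eta> c x"
    using left_kan_extensionD(1)[OF K(1) gd(1,2)] by blast
  have "\<sigma> d (\<theta> d x) = x" if "d \<in> Ob D" "x \<in> carrier (GOb L d)" for d x
    by (rule left_kan_extension_endo[OF L(1) diagram_map_compose[OF assms(1) \<theta>(1) \<sigma>(1)] _ that]) (simp add: \<theta>(2) \<sigma>(2))
  moreover have "\<theta> d (\<sigma> d x) = x" if "d \<in> Ob D" "x \<in> carrier (GOb K d)" for d x
    by (rule left_kan_extension_endo[OF K(2) diagram_map_compose[OF assms(1) \<sigma>(1) \<theta>(1)] _ that]) (simp add: \<theta>(2) \<sigma>(2))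
  ultimately show ?thesis using that[OF \<theta>(1) \<sigma>(1) \<theta>(2)] by blast
qed

lemma diagram_isoI:
  assumes "diagram_map C G H \<theta>" "diagram_map C H G \<sigma>"
    and "\<And>c x. c \<in> Ob C \<Longrightarrow> x \<in> carrier (GOb G c) \<Longrightarrow> \<sigma> c (\<theta> c x) = x"
    and "\<And>c x. c \<in> Ob C \<Longrightarrow> x \<in> carrier (GOb H c) \<Longrightarrow> \<theta> c (\<sigma> c x) = x"
  shows "diagram_iso C G H \<theta>"
proof -
  have "\<theta> c \<in> iso (GOb G c) (GOb H c)" if c: "c \<in> Ob C" for c
  proof -
    have h: "\<theta> c \<in> hom (GOb G c) (GOb H c)" "\<sigma> c \<in> hom (GOb H c) (GOb G c)"
      using assms(1,2) c by (simp_all add: diagram_map_def)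
    have "bij_betw (\<theta> c) (carrier (GOb G c)) (carrier (GOb H c))"
      using assms(3,4)[OF c] h by (intro bij_betw_byWitness[of _ "\<sigma> c"]) (auto simp: hom_in_carrier)
    then show ?thesis using h(1) by (simp add: iso_def)
  qed
  then show ?thesis using assms(1) by (simp add: diagram_iso_def)
qed

theorem theorem4p6:
  fixes C :: "('o, 'm) cat" and D :: "('p, 'q) cat" and S :: "('o, 'm, 'p, 'q) funct"
    and G :: "('o, 'm, 'g) diagram" and fin :: "'p \<Rightarrow> ('o \<times> 'q) set"
  assumes "category C" and "category D"
    and "virtual_discrete_cofibration C D S"
    and "group_diagram C G"
    and "\<And>d. d \<in> Ob D \<Longrightarrow> is_fin (comma C D S d) (fin d)"
  shows "left_kan_extension TYPE('h) C D S G (lan_fin C D S fin G) (lan_fin_unit C D S fin G)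
    \<and> (\<forall>n. nonabelian_homology C G n \<cong> nonabelian_homology D (lan_fin C D S fin G) n)
    \<and> (\<forall>(L :: ('p, 'q, 'l) diagram) \<eta>.
         left_kan_extension TYPE((('o \<times> 'q) \<times> 'g) list set) C D S G L \<eta>
         \<and> left_kan_extension TYPE('l) C D S G L \<eta> \<longrightarrow>
           (\<exists>\<theta>. diagram_iso D L (lan_fin C D S fin G) \<theta>
             \<and> (\<forall>c \<in> Ob C. \<forall>x \<in> carrier (GOb G c).
                   \<theta> (FOb S c) (\<eta> c x) = lan_fin_unit C D S fin G c x))
         \<and> (\<forall>n. nonabelian_homology C G n \<cong> nonabelian_homology D L n))"
proof -
  have S: "cat_functor C D S" using assms(3) by (simp add: virtual_discrete_cofibration_def)
  interpret virtual_cofibration_diagram C D S fin G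
    by (intro virtual_cofibration_diagram.intro virtual_cofibration.intro virtual_cofibration_axioms.intro
        category_diagram.intro assms S)
  show ?thesis
  proof (intro conjI allI impI)
    show "left_kan_extension TYPE('h) C D S G lan lan_unit" by (rule lan_left_kan_extension)
    show "nonabelian_homology C G n \<cong> nonabelian_homology D lan n" for n by (rule lan_homology)
    fix L :: "('p, 'q, 'l) diagram" and \<eta>
    assume "left_kan_extension TYPE((('o \<times> 'q) \<times> 'g) list set) C D S G L \<eta> \<and> left_kan_extension TYPE('l) C D S G L \<eta>"
    then have L: "left_kan_extension TYPE('l) C D S G L \<eta>"
      "left_kan_extension TYPE((('o \<times> 'q) \<times> 'g) list set) C D S G L \<eta>" by auto
    obtain \<theta> \<sigma> where \<theta>: "diagram_map D L lan \<theta>" "diagram_map D lan L \<sigma>"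
      "\<And>c x. c \<in> Ob C \<Longrightarrow> x \<in> carrier (GOb G c) \<Longrightarrow> \<theta> (FOb S c) (\<eta> c x) = lan_unit c x"
      "\<And>d x. d \<in> Ob D \<Longrightarrow> x \<in> carrier (GOb L d) \<Longrightarrow> \<sigma> d (\<theta> d x) = x"
      "\<And>d x. d \<in> Ob D \<Longrightarrow> x \<in> carrier (GOb lan d) \<Longrightarrow> \<theta> d (\<sigma> d x) = x"
      using left_kan_extension_unique[OF assms(2) L lan_left_kan_extension lan_left_kan_extension] by blast
    show "\<exists>\<theta>. diagram_iso D L lan \<theta> \<and> (\<forall>c\<in>Ob C. \<forall>x\<in>carrier (GOb G c). \<theta> (FOb S c) (\<eta> c x) = lan_unit c x)"
      using diagram_isoI[OF \<theta>(1,2,4,5)] \<theta>(3) by blast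
    fix n
    have "group_diagram D L" using L(1) by (simp add: left_kan_extension_def)
    then have "nonabelian_homology D lan n \<cong> nonabelian_homology D L n"
      by (intro diagram_iso_homology[OF assms(2) group_diagram_lan _ \<theta>(2,1)]) (simp_all add: \<theta>(4,5))
    then show "nonabelian_homology C G n \<cong> nonabelian_homology D L n"
      using lan_homology by (rule iso_trans[rotated])
  qed
qed

end
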